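(* Let $k$ be a positive integer. Then $k$-Precolouring Extension is polynomial-time solvable for graphs of maximum degree at most $k$.
   Context: A colouring of a graph $G=(V,E)$ is a map $c:V\to\{1,2,\dots\}$ with $c(u)\neq c(v)$ for every edge $uv$; it is a $k$-colouring if all colours lie in $\{1,\dots,k\}$. A $k$-precolouring of $G$ is a map $c_W:W\to\{1,\dots,k\}$ for some $W\subseteq V$; a $k$-colouring $c$ extends $c_W$ if $c(v)=c_W(v)$ for all $v\in W$. For fixed $k$, the problem $k$-Precolouring Extension takes as input a graph $G$ and a $k$-precolouring $c_W$ of $G$ and asks whether $G$ has a $k$-colouring extending $c_W$. *)

theory Defs
  imports Main "HOL-Computational_Algebra.Polynomial"
begin

section \<open>Deterministic multitape Turing machines\<close>

text \<open>
  States and tape symbols are natural numbers below explicit bounds. Symbol \<open>0\<close> is the blank,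
  and the input bits \<open>False\<close> and \<open>True\<close> are the symbols \<open>1\<close> and \<open>2\<close>. Tapes are infinite in both
  directions.
\<close>

datatype direction = Move_Left | Stay | Move_Right

record tm =
  num_tapes :: nat
  num_states :: nat
  num_symbols :: nat
  start_state :: nat
  accept_state :: nat
  reject_state :: nat
  delta :: "nat \<Rightarrow> nat list \<Rightarrow> nat \<times> (nat \<times> direction) list"

text \<open>
  A well-formed machine never leaves its finitely many states and symbols, so only a finite part of
  the function \<open>delta\<close> is ever used: it is a finite transition table.
\<close>

definition wf_tm :: "tm \<Rightarrow> bool" where
  "wf_tm M \<longleftrightarrow>
     num_tapes M \<ge> 1 \<and> num_symbols M \<ge> 3 \<and>
     start_state M < num_states M \<and> accept_state M < num_states M \<and> reject_state M < num_states M \<and>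
     accept_state M \<noteq> reject_state M \<and>
     (\<forall>q syms. q < num_states M \<and> length syms = num_tapes M \<and> set syms \<subseteq> {..<num_symbols M} \<longrightarrow>
        (case delta M q syms of (q', acts) \<Rightarrow>
           q' < num_states M \<and> length acts = num_tapes M \<and> fst ` set acts \<subseteq> {..<num_symbols M}))"

text \<open>A tape is its contents together with the head position.\<close>

type_synonym tape = "(int \<Rightarrow> nat) \<times> int"
type_synonym config = "nat \<times> tape list"

fun offset :: "direction \<Rightarrow> int" where
  "offset Move_Left = - 1"
| "offset Stay = 0"
| "offset Move_Right = 1"

fun read_tape :: "tape \<Rightarrow> nat" where
  "read_tape (f, i) = f i"

fun act_tape :: "tape \<Rightarrow> nat \<times> direction \<Rightarrow> tape" where
  "act_tape (f, i) (a, d) = (f(i := a), i + offset d)"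

fun tm_step :: "tm \<Rightarrow> config \<Rightarrow> config" where
  "tm_step M (q, ts) =
     (if q = accept_state M \<or> q = reject_state M then (q, ts)
      else case delta M q (map read_tape ts) of (q', acts) \<Rightarrow> (q', map2 act_tape ts acts))"

definition input_tape :: "bool list \<Rightarrow> tape" where
  "input_tape w =
     ((\<lambda>i. if 0 \<le> i \<and> i < int (length w) then (if w ! nat i then 2 else 1) else 0), 0)"

definition blank_tape :: tape where
  "blank_tape = ((\<lambda>_. 0), 0)"

definition init_config :: "tm \<Rightarrow> bool list \<Rightarrow> config" where
  "init_config M w = (start_state M, input_tape w # replicate (num_tapes M - 1) blank_tape)"

definition accepts_within :: "tm \<Rightarrow> bool list \<Rightarrow> nat \<Rightarrow> bool" where
  "accepts_within M w T \<longleftrightarrow> (\<exists>t\<le>T. fst ((tm_step M ^^ t) (init_config M w)) = accept_state M)"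

definition rejects_within :: "tm \<Rightarrow> bool list \<Rightarrow> nat \<Rightarrow> bool" where
  "rejects_within M w T \<longleftrightarrow> (\<exists>t\<le>T. fst ((tm_step M ^^ t) (init_config M w)) = reject_state M)"

text \<open>
  A decision problem is given by an encoding of its instances as bit strings, the set of admissible
  instances, and the predicate singling out the yes-instances. Nothing is required of the machine on
  inputs that do not encode an admissible instance.
\<close>

definition polytime_solvable :: "('i \<Rightarrow> bool list) \<Rightarrow> 'i set \<Rightarrow> ('i \<Rightarrow> bool) \<Rightarrow> bool" where
  "polytime_solvable enc inst yes \<longleftrightarrow>
     (\<exists>M (p :: nat poly). wf_tm M \<and>
        (\<forall>x\<in>inst. if yes x then accepts_within M (enc x) (poly p (length (enc x)))
                   else rejects_within M (enc x) (poly p (length (enc x)))))"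


section \<open>Graphs and colourings\<close>

type_synonym ugraph = "nat set \<times> nat set set"

definition simple_graph :: "ugraph \<Rightarrow> bool" where
  "simple_graph G \<longleftrightarrow> finite (fst G) \<and> (\<forall>e\<in>snd G. e \<subseteq> fst G \<and> card e = 2)"

definition vdegree :: "ugraph \<Rightarrow> nat \<Rightarrow> nat" where
  "vdegree G v = card {e \<in> snd G. v \<in> e}"

text \<open>The graph without vertices has maximum degree \<open>0\<close>.\<close>

definition max_degree :: "ugraph \<Rightarrow> nat" where
  "max_degree G = Max (insert 0 (vdegree G ` fst G))"

definition colouring :: "ugraph \<Rightarrow> (nat \<Rightarrow> nat) \<Rightarrow> bool" where
  "colouring G c \<longleftrightarrow> (\<forall>v\<in>fst G. c v \<ge> 1) \<and> (\<forall>u v. {u, v} \<in> snd G \<longrightarrow> c u \<noteq> c v)"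

definition k_colouring :: "nat \<Rightarrow> ugraph \<Rightarrow> (nat \<Rightarrow> nat) \<Rightarrow> bool" where
  "k_colouring k G c \<longleftrightarrow> colouring G c \<and> c ` fst G \<subseteq> {1..k}"

text \<open>The precoloured set \<open>W\<close> is the domain of the partial map. A precolouring need not be proper.\<close>

definition k_precolouring :: "nat \<Rightarrow> ugraph \<Rightarrow> (nat \<rightharpoonup> nat) \<Rightarrow> bool" where
  "k_precolouring k G cW \<longleftrightarrow> dom cW \<subseteq> fst G \<and> ran cW \<subseteq> {1..k}"

definition extends :: "(nat \<Rightarrow> nat) \<Rightarrow> (nat \<rightharpoonup> nat) \<Rightarrow> bool" where
  "extends c cW \<longleftrightarrow> (\<forall>v\<in>dom cW. cW v = Some (c v))"


section \<open>Precolouring extension as a decision problem\<close>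

definition precol_instances :: "nat \<Rightarrow> (ugraph \<times> (nat \<rightharpoonup> nat)) set" where
  "precol_instances k = {(G, cW). simple_graph G \<and> k_precolouring k G cW}"

definition precol_extendable :: "nat \<Rightarrow> ugraph \<times> (nat \<rightharpoonup> nat) \<Rightarrow> bool" where
  "precol_extendable k = (\<lambda>(G, cW). \<exists>c. k_colouring k G c \<and> extends c cW)"

text \<open>
  With the vertices listed in increasing order, an instance is encoded as the number of vertices in
  unary, then the adjacency matrix row by row, then the colour of each vertex in unary, where \<open>0\<close>
  stands for an uncoloured vertex. Each unary number is terminated by \<open>False\<close>.
\<close>

definition encode_unary :: "nat \<Rightarrow> bool list" where
  "encode_unary m = replicate m True @ [False]"

definition encode_instance :: "ugraph \<times> (nat \<rightharpoonup> nat) \<Rightarrow> bool list" where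
  "encode_instance = (\<lambda>((V, E), cW).
     (let vs = sorted_list_of_set V in
        encode_unary (length vs) @
        concat (map (\<lambda>u. map (\<lambda>v. {u, v} \<in> E) vs) vs) @
        concat (map (\<lambda>v. encode_unary (case cW v of None \<Rightarrow> 0 | Some i \<Rightarrow> i)) vs)))"

end

theory Submission
  imports Defs "HOL-Library.Nat_Bijection"
begin

text \<open>
  The machine tests a list assignment for consistency at level \<open>k + 1\<close>: level \<open>0\<close> only asks for nonempty
  lists and no edge whose ends share a one-element list; level \<open>j + 1\<close> repeatedly deletes a colour \<open>c\<close>
  from the list of a vertex \<open>v\<close> when fixing \<open>c\<close> at \<open>v\<close> is refuted at level \<open>j\<close>, and asks that no list
  becomes empty. For fixed \<open>k\<close> this takes polynomial time, and it never rejects a colourable instance.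

  Conversely, after deleting the precoloured vertices every list is at least as large as the degree.
  If such an assignment is not colourable, the lists are tight on some component, and a component
  without cut vertex is a clique or has lists of one or two colours, all lists being equal (Brooks).
  These are refuted by pigeonhole and by propagation. In general a vertex \<open>v\<close> and a smallest part \<open>K\<close>
  cut off by \<open>v\<close> form such a block; the colours of \<open>v\<close> that do not extend to \<open>K\<close> are refuted, and
  removing \<open>K\<close> together with these colours leaves a smaller instance of the same kind.
\<close>

section \<open>List colourings and consistency\<close>

text \<open>An algorithm that finds blocks and colours along them would have to be programmed on a
  Turing machine. The consistency test avoids this: it knows nothing of degrees or blocks, is a nest
  of loops of constant depth, and all graph theory moves into the proof that it accepts nothing
  uncolourable. That proof can work locally because consistency is monotone: it survives passing to
  fewer vertices and larger lists, so whatever is refuted inside a block is refuted in the whole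
  graph. The level \<open>k + 1\<close> is spent on one outer level, whose surviving lists decide
  which side of the vertex \<open>v\<close> is contradictory, and \<open>k\<close> further levels
  with a colour fixed at \<open>v\<close>, enough for pigeonhole on a clique with at most
  \<open>k\<close> colours. The sizes fit because an uncolourable connected instance is tight: the
  degree of \<open>v\<close> splits over the two sides exactly as its list splits into the colours
  that fail in the block and those that extend to it.\<close>

locale sym_graph =
  fixes E :: "'a \<Rightarrow> 'a \<Rightarrow> bool"
  assumes E_sym: "E u v \<Longrightarrow> E v u" and E_irrefl: "\<not> E v v"
begin

definition nb :: "'a set \<Rightarrow> 'a \<Rightarrow> 'a set" where
  "nb X v = {u \<in> X. E v u}"

definition list_col :: "'a set \<Rightarrow> ('a \<Rightarrow> nat set) \<Rightarrow> bool" where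
  "list_col X L \<longleftrightarrow> (\<exists>f. (\<forall>v\<in>X. f v \<in> L v) \<and> (\<forall>u\<in>X. \<forall>v\<in>X. E u v \<longrightarrow> f u \<noteq> f v))"

text \<open>These are the unions of connected components of the graph induced on \<open>X\<close>,
  including \<open>{}\<close> and \<open>X\<close>. Connectedness is expressed through them, without
  paths, and the empty set counts as connected.\<close>

definition sep :: "'a set \<Rightarrow> 'a set \<Rightarrow> bool" where
  "sep X Y \<longleftrightarrow> Y \<subseteq> X \<and> (\<forall>y\<in>Y. \<forall>z\<in>X - Y. \<not> E y z)"

definition conn :: "'a set \<Rightarrow> bool" where
  "conn X \<longleftrightarrow> (\<forall>Y. sep X Y \<longrightarrow> Y = {} \<or> Y = X)"

section \<open>Components and greedy list colouring\<close>

lemma finite_nb [simp]: "finite X \<Longrightarrow> finite (nb X v)"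
  by (simp add: nb_def)

lemma nb_mono: "X \<subseteq> Y \<Longrightarrow> nb X v \<subseteq> nb Y v"
  by (auto simp: nb_def)

lemma card_nb_mono: "X \<subseteq> Y \<Longrightarrow> finite Y \<Longrightarrow> card (nb X v) \<le> card (nb Y v)"
  by (simp add: card_mono nb_mono)

lemma sep_compl: "sep X Y \<Longrightarrow> sep X (X - Y)"
  unfolding sep_def using E_sym by blast

text \<open>A set that contains \<open>y\<close> can be replaced by its complement, so only sets
  avoiding \<open>y\<close> have to be examined.\<close>

lemma conn_rootI:
  assumes "y \<in> X" "\<And>Y. sep X Y \<Longrightarrow> y \<notin> Y \<Longrightarrow> Y = {}"
  shows "conn X"
  unfolding conn_def
proof (intro allI impI)
  fix Y assume Y: "sep X Y"
  show "Y = {} \<or> Y = X"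
  proof (cases "y \<in> Y")
    case True
    then have "X - Y = {}" using assms(2)[OF sep_compl[OF Y]] by blast
    then show ?thesis using Y by (auto simp: sep_def)
  qed (use assms(2) Y in blast)
qed

lemma not_conn_rootE:
  assumes "\<not> conn X" "y \<in> X"
  obtains Y where "sep X Y" "y \<notin> Y" "Y \<noteq> {}"
  using assms conn_rootI by metis

text \<open>Greedy colouring in which a vertex \<open>s\<close> with more colours than neighbours
  comes last: whatever its neighbours receive, a colour is left. Deleting \<open>s\<close> gives
  each of its neighbours a surplus, so every part of the rest again has a surplus vertex, either
  next to \<open>s\<close> or because the part was already separate in \<open>X\<close>.\<close>

lemma list_col_peel:
  assumes "finite X" "\<forall>v\<in>X. finite (L v) \<and> card (nb X v) \<le> card (L v)"
    "\<And>Y. sep X Y \<Longrightarrow> Y \<noteq> {} \<Longrightarrow> \<exists>y\<in>Y. card (nb X y) < card (L y)"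
  shows "list_col X L"
  using assms
proof (induction X rule: finite_psubset_induct)
  case (psubset X)
  show ?case
  proof (cases "X = {}")
    case True
    then show ?thesis by (simp add: list_col_def)
  next
    case False
    then obtain s where s: "s \<in> X" "card (nb X s) < card (L s)"
      using psubset.prems(2)[of X] by (auto simp: sep_def)
    let ?X = "X - {s}"
    have 1: "\<forall>v\<in>?X. finite (L v) \<and> card (nb ?X v) \<le> card (L v)"
    proof
      fix v assume "v \<in> ?X"
      then show "finite (L v) \<and> card (nb ?X v) \<le> card (L v)"
        using psubset.prems(1) card_nb_mono[of ?X X v] psubset.hyps(1) by fastforce
    qed
    have "list_col ?X L"
    proof (rule psubset.IH)
      show "?X \<subset> X" using s by blast
      show "\<forall>v\<in>?X. finite (L v) \<and> card (nb ?X v) \<le> card (L v)" by (rule 1)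
      fix Y assume Y: "sep ?X Y" "Y \<noteq> {}"
      show "\<exists>y\<in>Y. card (nb ?X y) < card (L y)"
      proof (cases "\<exists>y\<in>Y. E y s")
        case True
        then obtain y where y: "y \<in> Y" "E y s" by blast
        have "nb ?X y \<subset> nb X y" using y s by (auto simp: nb_def)
        then have "card (nb ?X y) < card (nb X y)"
          using psubset.hyps(1) by (simp add: psubset_card_mono)
        moreover have "card (nb X y) \<le> card (L y)"
          using psubset.prems(1) y Y(1) by (auto simp: sep_def)
        ultimately show ?thesis using y by force
      next
        case False
        then have "sep X Y" using Y(1) by (auto simp: sep_def)
        then obtain y where "y \<in> Y" "card (nb X y) < card (L y)"
          using psubset.prems(2) Y(2) by blast
        moreover have "card (nb ?X y) \<le> card (nb X y)"
          using psubset.hyps(1) by (intro card_nb_mono) auto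
        ultimately show ?thesis by force
      qed
    qed
    then obtain f where f: "\<forall>v\<in>?X. f v \<in> L v" "\<forall>u\<in>?X. \<forall>v\<in>?X. E u v \<longrightarrow> f u \<noteq> f v"
      by (auto simp: list_col_def)
    have "card (f ` nb X s) < card (L s)"
      using s(2) card_image_le[of "nb X s" f] psubset.hyps(1) by simp
    then have "\<not> L s \<subseteq> f ` nb X s"
      using card_mono[of "f ` nb X s" "L s"] psubset.hyps(1) by fastforce
    then obtain c where c: "c \<in> L s" "c \<notin> f ` nb X s" by blast
    have "\<forall>v\<in>X. (f(s := c)) v \<in> L v" using f c by auto
    moreover have "\<forall>u\<in>X. \<forall>v\<in>X. E u v \<longrightarrow> (f(s := c)) u \<noteq> (f(s := c)) v"
      using f(2) c(2) E_sym E_irrefl by (auto simp: nb_def)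
    ultimately show ?thesis unfolding list_col_def by blast
  qed
qed

text \<open>Used mostly in contrapositive form: in a connected uncolourable instance every list is
  exactly as large as the degree.\<close>

lemma list_col_peel_conn:
  assumes "finite X" "conn X" "\<forall>v\<in>X. finite (L v) \<and> card (nb X v) \<le> card (L v)"
    "s \<in> X" "card (nb X s) < card (L s)"
  shows "list_col X L"
  using assms list_col_peel[of X L] unfolding conn_def by blast

text \<open>The independent set \<open>S\<close> receives the single colour \<open>a\<close>. A
  neighbour of \<open>S\<close> loses one colour however many neighbours it has in \<open>S\<close>;
  this saving is what makes greedy colouring possible afterwards.\<close>

lemma list_col_assign:
  assumes "list_col (X - S) (\<lambda>u. if \<exists>x\<in>S. E x u then L u - {a} else L u)"
    "\<forall>x\<in>S. a \<in> L x" "\<forall>x\<in>S. \<forall>y\<in>S. \<not> E x y"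
  shows "list_col X L"
proof -
  obtain f where f: "\<forall>v\<in>X - S. f v \<in> (if \<exists>x\<in>S. E x v then L v - {a} else L v)"
    "\<forall>u\<in>X - S. \<forall>v\<in>X - S. E u v \<longrightarrow> f u \<noteq> f v"
    using assms(1) by (auto simp: list_col_def)
  let ?g = "\<lambda>v. if v \<in> S then a else f v"
  have "\<forall>v\<in>X. ?g v \<in> L v" using f(1) assms(2) by (auto split: if_splits)
  moreover have "\<forall>u\<in>X. \<forall>v\<in>X. E u v \<longrightarrow> ?g u \<noteq> ?g v"
  proof (intro ballI impI)
    fix u v assume uv: "u \<in> X" "v \<in> X" "E u v"
    have "f w \<noteq> a" if "w \<in> X - S" "x \<in> S" "E x w" for w x
      using f(1) that by (metis DiffE singletonI)
    note this[of v u] this[of u v]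
    then show "?g u \<noteq> ?g v" using f(2) uv assms(3) E_sym[OF uv(3)] by (cases "u \<in> S"; cases "v \<in> S") auto
  qed
  ultimately show ?thesis unfolding list_col_def by (intro exI[of _ ?g] conjI)
qed

lemma list_col_join:
  assumes "sep X Y" "list_col Y L" "list_col (X - Y) L"
  shows "list_col X L"
proof -
  obtain f g where f: "\<forall>v\<in>Y. f v \<in> L v" "\<forall>u\<in>Y. \<forall>v\<in>Y. E u v \<longrightarrow> f u \<noteq> f v"
    and g: "\<forall>v\<in>X - Y. g v \<in> L v" "\<forall>u\<in>X - Y. \<forall>v\<in>X - Y. E u v \<longrightarrow> g u \<noteq> g v"
    using assms by (auto simp: list_col_def)
  let ?h = "\<lambda>v. if v \<in> Y then f v else g v"
  have "\<forall>v\<in>X. ?h v \<in> L v" using f g by auto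
  moreover have "\<forall>u\<in>X. \<forall>v\<in>X. E u v \<longrightarrow> ?h u \<noteq> ?h v"
  proof (intro ballI impI)
    fix u v assume uv: "u \<in> X" "v \<in> X" "E u v"
    then have "u \<in> Y \<longleftrightarrow> v \<in> Y" using assms(1) E_sym[OF uv(3)] unfolding sep_def by blast
    then show "?h u \<noteq> ?h v" using f(2) g(2) uv by (cases "u \<in> Y") auto
  qed
  ultimately show ?thesis unfolding list_col_def by (intro exI[of _ ?h] conjI)
qed

section \<open>Consistency levels\<close>

text \<open>A higher level does not describe the deletions; it asks for lists \<open>L'\<close>
  inside \<open>L\<close> that are stable under them, every remaining colour surviving when it is
  fixed. Deleting refuted colours never destroys such an \<open>L'\<close>, so the order of
  deletions is immaterial.\<close>

primrec consistent :: "nat \<Rightarrow> 'a set \<Rightarrow> ('a \<Rightarrow> nat set) \<Rightarrow> bool" where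
  "consistent 0 X L \<longleftrightarrow> (\<forall>v\<in>X. L v \<noteq> {}) \<and>
     (\<forall>u\<in>X. \<forall>v\<in>X. E u v \<longrightarrow> \<not> (L u = L v \<and> card (L u) = 1))"
| "consistent (Suc j) X L \<longleftrightarrow> (\<exists>L'. (\<forall>v\<in>X. L' v \<noteq> {} \<and> L' v \<subseteq> L v) \<and>
     (\<forall>x\<in>X. \<forall>c\<in>L' x. consistent j X (L'(x := {c}))))"

lemma consistent_nonempty: "consistent j X L \<Longrightarrow> v \<in> X \<Longrightarrow> L v \<noteq> {}"
  by (cases j) auto

text \<open>Above level 0 the same witness works, restricted to \<open>Y\<close>. At level 0, two
  equal one-element lists in \<open>M\<close> force the nonempty smaller lists in \<open>L\<close>
  to coincide with them.\<close>

lemma consistent_mono: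
  assumes "consistent j X L" "Y \<subseteq> X" "\<forall>v\<in>Y. L v \<subseteq> M v"
  shows "consistent j Y M"
  using assms
proof (induction j arbitrary: X Y L M)
  case 0
  have "\<not> (M u = M v \<and> card (M u) = 1)" if "u \<in> Y" "v \<in> Y" "E u v" for u v
  proof
    assume "M u = M v \<and> card (M u) = 1"
    then obtain c where "M u = {c}" "M v = {c}" by (auto simp: card_1_singleton_iff)
    moreover have "L u \<noteq> {}" "L v \<noteq> {}" "L u \<subseteq> M u" "L v \<subseteq> M v" using 0 that by auto
    ultimately have "L u = {c}" "L v = {c}" by (auto simp: subset_singleton_iff)
    moreover have "u \<in> X" "v \<in> X" using that 0(2) by auto
    moreover from this have "\<not> (L u = L v \<and> card (L u) = 1)"
      using 0(1) that(3) unfolding consistent.simps by blast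
    ultimately show False by simp
  qed
  moreover have "\<forall>v\<in>Y. M v \<noteq> {}"
  proof
    fix v assume "v \<in> Y"
    then have "L v \<noteq> {}" "L v \<subseteq> M v" using 0 by auto
    then show "M v \<noteq> {}" by blast
  qed
  ultimately show ?case by simp
next
  case (Suc j)
  then obtain L' where L': "\<forall>v\<in>X. L' v \<noteq> {} \<and> L' v \<subseteq> L v" "\<forall>x\<in>X. \<forall>c\<in>L' x. consistent j X (L'(x := {c}))"
    by auto
  have "\<forall>x\<in>Y. \<forall>c\<in>L' x. consistent j Y (L'(x := {c}))"
    by (intro ballI Suc.IH[OF _ Suc.prems(2)]) (use L'(2) Suc.prems(2) in auto)
  moreover have "\<forall>v\<in>Y. L' v \<noteq> {} \<and> L' v \<subseteq> M v" using L'(1) Suc.prems(2,3) by blast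
  ultimately show ?case by auto
qed

text \<open>Fixing any surviving colour gives lists inside \<open>L\<close> that are consistent one
  level lower, and monotonicity finishes. Without vertices there is no colour to fix, hence the case
  split.\<close>

lemma consistent_Suc_D: "consistent (Suc j) X L \<Longrightarrow> consistent j X L"
proof (cases "X = {}")
  case True
  then show ?thesis by (cases j) auto
next
  case False
  assume "consistent (Suc j) X L"
  then obtain L' where L': "\<forall>v\<in>X. L' v \<noteq> {} \<and> L' v \<subseteq> L v" "\<forall>x\<in>X. \<forall>c\<in>L' x. consistent j X (L'(x := {c}))"
    by auto
  obtain x c where "x \<in> X" "c \<in> L' x" using False L'(1) by blast
  then have "consistent j X (L'(x := {c}))" using L'(2) by blast
  then show ?thesis by (rule consistent_mono) (use L'(1) \<open>c \<in> L' x\<close> in auto)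
qed

lemma consistent_le: "consistent j X L \<Longrightarrow> i \<le> j \<Longrightarrow> consistent i X L"
  by (induction j) (use consistent_Suc_D le_SucE in blast)+

text \<open>The witness is closed under propagation along edges: were \<open>c\<close> still present
  at a neighbour \<open>v\<close> of a vertex \<open>u\<close> with list \<open>{c}\<close>, fixing
  it at \<open>v\<close> would create two equal one-element lists on an edge, which already level 0
  forbids.\<close>

lemma consistent_Suc_prune:
  assumes "consistent (Suc j) X L"
  obtains L' where "\<And>v. v \<in> X \<Longrightarrow> L' v \<noteq> {}" "\<And>v. v \<in> X \<Longrightarrow> L' v \<subseteq> L v"
    "\<And>x c. x \<in> X \<Longrightarrow> c \<in> L' x \<Longrightarrow> consistent j X (L'(x := {c}))"
    "\<And>u v c. u \<in> X \<Longrightarrow> v \<in> X \<Longrightarrow> E u v \<Longrightarrow> L' u = {c} \<Longrightarrow> c \<notin> L' v"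
proof -
  obtain L' where L': "\<forall>v\<in>X. L' v \<noteq> {} \<and> L' v \<subseteq> L v" "\<forall>x\<in>X. \<forall>c\<in>L' x. consistent j X (L'(x := {c}))"
    using assms by auto
  have "c \<notin> L' v" if "u \<in> X" "v \<in> X" "E u v" "L' u = {c}" for u v c
  proof
    assume "c \<in> L' v"
    then have "consistent 0 X (L'(v := {c}))" using L'(2) that consistent_le by blast
    moreover have "u \<noteq> v" using that E_irrefl by blast
    ultimately show False using that by force
  qed
  then show ?thesis using L' by (intro that[of L']) auto
qed

text \<open>Pigeonhole by levels: one level fixes a colour \<open>c\<close> at a vertex
  \<open>x\<close>, propagation removes \<open>c\<close> everywhere else, and a clique with one
  vertex and one colour fewer is left to the next level.\<close>

lemma consistent_clique:
  assumes "consistent j X M" "finite X" "\<forall>u\<in>X. \<forall>v\<in>X. u \<noteq> v \<longrightarrow> E u v" "\<forall>v\<in>X. M v \<subseteq> D"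
    "finite D" "card D < card X" "card D \<le> j"
  shows False
  using assms
proof (induction j arbitrary: X M D)
  case 0
  then obtain x where "x \<in> X" by fastforce
  then show False using 0 by auto
next
  case (Suc j)
  obtain L' where L': "\<And>v. v \<in> X \<Longrightarrow> L' v \<noteq> {}" "\<And>v. v \<in> X \<Longrightarrow> L' v \<subseteq> M v"
    "\<And>x c. x \<in> X \<Longrightarrow> c \<in> L' x \<Longrightarrow> consistent j X (L'(x := {c}))"
    by (rule consistent_Suc_prune[OF Suc.prems(1)]) blast
  obtain x where x: "x \<in> X" using Suc.prems(6) by fastforce
  obtain c where c: "c \<in> L' x" using L'(1) x by blast
  have cD: "c \<in> D" using c x L'(2) Suc.prems(4) by blast
  have card1: "card (D - {c}) = card D - 1" "card D > 0" "card (X - {x}) = card X - 1"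
    using cD x Suc.prems card_gt_0_iff by auto
  have ok: "consistent j X (L'(x := {c}))" using L'(3) x c by blast
  show False
  proof (cases "j = 0")
    \<comment> \<open>No level remains for propagation, but then \<open>c\<close> is the only colour
      and a second vertex has the same one-element list.\<close>
    case True
    then have "card D = 1" using card1 Suc.prems(7) True by simp
    then have D: "D = {c}" using cD by (auto simp: card_1_singleton_iff)
    have "card (X - {x}) \<noteq> 0" using card1 Suc.prems(6) \<open>card D = 1\<close> by linarith
    then have "X - {x} \<noteq> {}" by (metis card.empty)
    then obtain y where y: "y \<in> X" "y \<noteq> x" by blast
    have "L' y \<subseteq> {c}" using L'(2)[OF y(1)] Suc.prems(4) y(1) D by blast
    then have "L' y = {c}" using L'(1)[OF y(1)] by (simp add: subset_singleton_iff)
    moreover have "E x y" using Suc.prems(3) x y by auto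
    moreover have "consistent 0 X (L'(x := {c}))" using ok True by simp
    then have "\<not> ((L'(x := {c})) x = (L'(x := {c})) y \<and> card ((L'(x := {c})) x) = 1)"
      unfolding consistent.simps using x y(1) \<open>E x y\<close> by blast
    ultimately show False using y(2) by simp
  next
    case False
    then obtain i where i: "j = Suc i" by (cases j) auto
    obtain L'' where L'': "\<And>v. v \<in> X \<Longrightarrow> L'' v \<noteq> {}" "\<And>v. v \<in> X \<Longrightarrow> L'' v \<subseteq> (L'(x := {c})) v"
      "\<And>x c. x \<in> X \<Longrightarrow> c \<in> L'' x \<Longrightarrow> consistent i X (L''(x := {c}))"
      "\<And>u v c. u \<in> X \<Longrightarrow> v \<in> X \<Longrightarrow> E u v \<Longrightarrow> L'' u = {c} \<Longrightarrow> c \<notin> L'' v"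
      by (rule consistent_Suc_prune[OF ok[unfolded i]]) blast
    have Lx: "L'' x = {c}" using L''(1,2)[OF x] by auto
    have "consistent j X L''" unfolding i consistent.simps using L''(1-3) by (intro exI[of _ L'']) blast
    then have ok': "consistent j (X - {x}) L''" by (rule consistent_mono) auto
    show False
    proof (rule Suc.IH[OF ok', of "D - {c}"])
      show "\<forall>v\<in>X - {x}. L'' v \<subseteq> D - {c}"
      proof
        fix v assume v: "v \<in> X - {x}"
        then have "E x v" using Suc.prems(3) x by auto
        then have "c \<notin> L'' v" using L''(4)[of x v c] x v Lx by blast
        moreover have "L'' v \<subseteq> L' v" using L''(2)[of v] v by auto
        ultimately show "L'' v \<subseteq> D - {c}" using L'(2)[of v] Suc.prems(4) v by blast
      qed
    qed (use Suc.prems card1 in auto)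
  qed
qed

text \<open>With at most two colours, a one-element list forces one-element lists at all neighbours.
  Starting at \<open>v\<close> this reaches the whole connected graph, and the pruned lists are
  themselves a colouring.\<close>

lemma consistent_propagate:
  assumes "consistent 1 X L" "conn X" "v \<in> X" "\<forall>u\<in>X. L u \<subseteq> D" "finite D" "card D \<le> 2" "L v = {c}"
    "\<forall>u\<in>X. L u \<subseteq> M u"
  shows "list_col X M"
proof -
  obtain L' where L': "\<And>v. v \<in> X \<Longrightarrow> L' v \<noteq> {}" "\<And>v. v \<in> X \<Longrightarrow> L' v \<subseteq> L v"
    "\<And>u v c. u \<in> X \<Longrightarrow> v \<in> X \<Longrightarrow> E u v \<Longrightarrow> L' u = {c} \<Longrightarrow> c \<notin> L' v"
    by (rule consistent_Suc_prune[OF assms(1)[unfolded One_nat_def]]) blast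
  define S where "S = {u\<in>X. \<exists>a. L' u = {a}}"
  have "sep X S"
    unfolding sep_def
  proof (intro conjI ballI notI)
    fix u w assume u: "u \<in> S" and w: "w \<in> X - S" and e: "E u w"
    obtain a where a: "L' u = {a}" "u \<in> X" using u by (auto simp: S_def)
    have "L' w \<subseteq> D - {a}" using L'(3)[OF a(2) _ e a(1)] L'(2)[of w] w assms(4) by blast
    moreover have "a \<in> D" using a L'(2)[of u] assms(4) by blast
    then have "card (D - {a}) \<le> 1" using assms(5,6) by simp
    ultimately have "card (L' w) \<le> 1" using card_mono[of "D - {a}" "L' w"] assms(5) by fastforce
    moreover have "finite (L' w)" using \<open>L' w \<subseteq> D - {a}\<close> assms(5) finite_subset by blast
    ultimately have "card (L' w) = 1" using L'(1)[of w] w by (simp add: le_Suc_eq)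
    then show False using w by (auto simp: S_def card_1_singleton_iff)
  qed (auto simp: S_def)
  moreover have "v \<in> S" using L'(1,2)[OF assms(3)] assms(3,7) by (auto simp: S_def)
  ultimately have SX: "S = X" using assms(2) by (auto simp: conn_def)
  have el: "L' u = {the_elem (L' u)}" if "u \<in> X" for u
  proof -
    have "u \<in> S" using SX that by simp
    then obtain a where "L' u = {a}" by (auto simp: S_def)
    then show ?thesis by simp
  qed
  have "\<forall>u\<in>X. the_elem (L' u) \<in> M u" using el L'(2) assms(8) by blast
  moreover have "\<forall>u\<in>X. \<forall>w\<in>X. E u w \<longrightarrow> the_elem (L' u) \<noteq> the_elem (L' w)"
  proof (intro ballI impI)
    fix u w assume uw: "u \<in> X" "w \<in> X" "E u w"
    then show "the_elem (L' u) \<noteq> the_elem (L' w)" using L'(3)[OF uw el[OF uw(1)]] el[OF uw(2)] by auto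
  qed
  ultimately show ?thesis unfolding list_col_def by (intro exI[of _ "\<lambda>u. the_elem (L' u)"]) auto
qed


section \<open>Nonadjacent pairs whose removal keeps the graph connected\<close>

definition dist2 :: "'a set \<Rightarrow> 'a \<Rightarrow> 'a \<Rightarrow> bool" where
  "dist2 X x y \<longleftrightarrow> x \<in> X \<and> y \<in> X \<and> x \<noteq> y \<and> \<not> E x y \<and> (\<exists>r\<in>X. E r x \<and> E r y)"

lemma dist2I:
  "x \<in> X \<Longrightarrow> y \<in> X \<Longrightarrow> x \<noteq> y \<Longrightarrow> \<not> E x y \<Longrightarrow> r \<in> X \<Longrightarrow> E r x \<Longrightarrow> E r y \<Longrightarrow> dist2 X x y"
  unfolding dist2_def by blast

lemma dist2_sym: "dist2 X x y \<Longrightarrow> dist2 X y x"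
  unfolding dist2_def using E_sym by blast

text \<open>Otherwise \<open>y\<close> alone would cut \<open>W\<close> off, while \<open>x\<close>
  stays outside \<open>W\<close>.\<close>

lemma sep_no_cut:
  assumes "\<forall>w\<in>X. conn (X - {w})" "sep (X - {x, y}) W" "W \<noteq> {}" "x \<in> X" "y \<in> X" "x \<noteq> y"
  shows "\<exists>w\<in>W. E w x"
proof (rule ccontr)
  assume *: "\<not> (\<exists>w\<in>W. E w x)"
  have "sep (X - {y}) W" using assms(2) * unfolding sep_def by blast
  then have "W = X - {y}" using assms(1,3,5) unfolding conn_def by blast
  then show False using assms(2,4,6) unfolding sep_def by blast
qed

text \<open>If \<open>w\<close> were at distance two from \<open>x\<close>, removing both would cut
  off a set \<open>Y\<close> without \<open>y\<close>. The part of \<open>Y\<close> outside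
  \<open>Z\<close> would be cut off by \<open>x\<close> and \<open>y\<close> although it has no edge
  to \<open>y\<close>, so it is empty; \<open>Y\<close> then lies in \<open>Z\<close> without
  \<open>w\<close> and is too small.\<close>

lemma minimal_separator_far:
  assumes no_cut: "\<forall>w\<in>X. conn (X - {w})" and fin: "finite X"
    and contra: "\<And>x y. dist2 X x y \<Longrightarrow> \<not> conn (X - {x, y})"
    and xy: "dist2 X x y" and Z: "sep (X - {x, y}) Z"
    and minimal: "\<And>a b W. dist2 X a b \<Longrightarrow> sep (X - {a, b}) W \<Longrightarrow> W \<noteq> {} \<Longrightarrow> W \<noteq> X - {a, b} \<Longrightarrow>
      card Z \<le> card W"
    and w: "w \<in> Z"
  shows "\<not> dist2 X x w"
proof
  assume xw: "dist2 X x w"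
  have y: "y \<in> X - {x, w}" using xy w Z by (auto simp: dist2_def sep_def)
  obtain Y where Y: "sep (X - {x, w}) Y" "y \<notin> Y" "Y \<noteq> {}"
    using not_conn_rootE[OF contra[OF xw] y] .
  define Z' where "Z' = X - {x, y} - Z"
  have "sep (X - {x, y}) (Y \<inter> Z')"
    using Y(1) Z w E_sym unfolding sep_def Z'_def by blast
  moreover have "\<not> (\<exists>z\<in>Y \<inter> Z'. E z y)" using Y y unfolding sep_def by blast
  ultimately have "Y \<inter> Z' = {}"
    using sep_no_cut[OF no_cut, of y x "Y \<inter> Z'"] xy by (auto simp: dist2_def insert_commute)
  then have "Y \<subseteq> Z - {w}" using Y y unfolding sep_def Z'_def by blast
  moreover have "finite Z" using Z fin unfolding sep_def by (auto intro: finite_subset)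
  ultimately have "card Y < card Z" using w by (intro psubset_card_mono) auto
  then show False using minimal[OF xw Y(1,3)] Y(2) y by force
qed

text \<open>Some edge leaves the closed neighbourhood of \<open>u\<close>. It starts at a neighbour
  of \<open>u\<close>, so its other end is at distance two.\<close>

lemma dist2_exists:
  assumes "conn X" "u \<in> X" "v \<in> X" "u \<noteq> v" "\<not> E u v"
  shows "\<exists>x y. dist2 X x y"
proof -
  let ?Y = "insert u (nb X u)"
  have "v \<notin> ?Y" using assms by (auto simp: nb_def)
  then have "\<not> sep X ?Y" using assms by (auto simp: conn_def)
  then obtain y z where yz: "y \<in> ?Y" "z \<in> X - ?Y" "E y z"
    using assms(2) unfolding sep_def nb_def by blast
  then have "dist2 X u z" using assms(2) E_sym unfolding dist2_def nb_def by blast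
  then show ?thesis by blast
qed

text \<open>
  Among all vertices x, y at distance two and parts Z of the graph cut off by them, a smallest Z turns
  out to be a clique completely joined to x and y; replacing x and y by a vertex of Z and a
  neighbour of x on the other side then gives a pair that separates nothing.
\<close>

lemma nonseparating_pair:
  assumes fin: "finite X" and con: "conn X" and no_cut: "\<forall>w\<in>X. conn (X - {w})"
    and deg: "\<forall>v\<in>X. card (nb X v) \<ge> 3"
    and nonadj: "u \<in> X" "v \<in> X" "u \<noteq> v" "\<not> E u v"
  shows "\<exists>x y. dist2 X x y \<and> conn (X - {x, y})"
proof (rule ccontr)
  assume "\<not> ?thesis"
  then have contra: "\<And>x y. dist2 X x y \<Longrightarrow> \<not> conn (X - {x, y})" by blast
  define P where "P = (\<lambda>(x, y, Z). dist2 X x y \<and> sep (X - {x, y}) Z \<and> Z \<noteq> {} \<and> Z \<noteq> X - {x, y})"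
  obtain x0 y0 where "dist2 X x0 y0" using dist2_exists[OF con nonadj] by blast
  moreover obtain Z0 where "sep (X - {x0, y0}) Z0" "Z0 \<noteq> {}" "Z0 \<noteq> X - {x0, y0}"
    using contra[OF calculation] unfolding conn_def by blast
  ultimately have "P (x0, y0, Z0)" by (simp add: P_def)
  then obtain t where t: "P t" "\<And>t'. P t' \<Longrightarrow> card (snd (snd t)) \<le> card (snd (snd t'))"
    using ex_has_least_nat[of P _ "\<lambda>t. card (snd (snd t))"] by blast
  obtain x y Z where txyz: "t = (x, y, Z)" by (cases t)
  have xy: "dist2 X x y" and Z: "sep (X - {x, y}) Z" "Z \<noteq> {}" "Z \<noteq> X - {x, y}"
    using t(1) by (auto simp: P_def txyz)
  have minimal: "card Z \<le> card W"
    if "dist2 X a b" "sep (X - {a, b}) W" "W \<noteq> {}" "W \<noteq> X - {a, b}" for a b W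
    using t(2)[of "(a, b, W)"] that by (simp add: P_def txyz)
  have finZ: "finite Z" using Z fin unfolding sep_def by (auto intro: finite_subset)
  have yx: "dist2 X y x" and Zyx: "sep (X - {y, x}) Z"
    using xy Z by (auto simp: dist2_sym insert_commute)
  have xX: "x \<in> X" "y \<in> X" "x \<noteq> y" "\<not> E x y" using xy by (auto simp: dist2_def)
  have farx: "\<not> dist2 X x w" if "w \<in> Z" for w
    by (rule minimal_separator_far[OF no_cut fin contra xy Z(1) minimal that])
  have fary: "\<not> dist2 X y w" if "w \<in> Z" for w
    by (rule minimal_separator_far[OF no_cut fin contra yx Zyx minimal that])
  define Z' where "Z' = X - {x, y} - Z"
  have Z': "sep (X - {x, y}) Z'" "Z' \<noteq> {}"
    using sep_compl[OF Z(1)] Z unfolding Z'_def sep_def by auto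
  \<comment> \<open>An edge from a vertex of \<open>Z\<close> adjacent to \<open>a\<close> to one
    not adjacent to \<open>a\<close> would give a vertex of \<open>Z\<close> at distance two from
    \<open>a\<close>. So the vertices adjacent to \<open>a\<close> form a cut-off part
    \<open>Z1\<close>, and minimality gives \<open>Z1 = Z\<close>.\<close>
  have joined: "\<forall>z\<in>Z. E z a"
    if a: "a \<in> X" "\<And>w. w \<in> Z \<Longrightarrow> \<not> dist2 X a w" "\<exists>w\<in>Z. E w a" "a \<notin> Z" for a
  proof -
    define Z1 where "Z1 = {z\<in>Z. E z a}"
    have "sep (X - {x, y}) Z1"
      unfolding sep_def
    proof (intro conjI ballI notI)
      show "Z1 \<subseteq> X - {x, y}" using Z(1) by (auto simp: sep_def Z1_def)
      fix z w assume zw: "z \<in> Z1" "w \<in> X - {x, y} - Z1" "E z w"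
      then have "w \<in> Z" "z \<in> X" using Z(1) by (auto simp: sep_def Z1_def)
      moreover from this have "\<not> E w a" using zw by (auto simp: Z1_def)
      ultimately have "dist2 X a w"
        using zw a(1,4) E_sym unfolding dist2_def Z1_def by blast
      then show False using a(2) \<open>w \<in> Z\<close> by blast
    qed
    moreover have "Z1 \<noteq> {}" using a(3) by (auto simp: Z1_def)
    moreover have "Z1 \<subseteq> Z" by (auto simp: Z1_def)
    moreover from this have "Z1 \<noteq> X - {x, y}" using Z unfolding sep_def by blast
    ultimately have "card Z \<le> card Z1" using minimal[OF xy] by blast
    then have "Z1 = Z" using \<open>Z1 \<subseteq> Z\<close> finZ by (simp add: card_seteq)
    then show ?thesis by (auto simp: Z1_def)
  qed
  have notZ: "x \<notin> Z" "y \<notin> Z" "x \<notin> Z'" "y \<notin> Z'" using Z(1) by (auto simp: sep_def Z'_def)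
  have Zx: "\<forall>z\<in>Z. E z x"
    by (rule joined[OF xX(1) farx sep_no_cut[OF no_cut Z(1,2) xX(1,2,3)] notZ(1)])
  have Zy: "\<forall>z\<in>Z. E z y"
    by (rule joined[OF xX(2) fary sep_no_cut[OF no_cut Zyx Z(2) xX(2,1) xX(3)[symmetric]] notZ(2)])
  have ZZ': "\<not> E z z'" "\<not> E z' z" if "z \<in> Z" "z' \<in> Z'" for z z'
    using that Z(1) E_sym unfolding sep_def Z'_def by blast+
  have ZX: "Z \<subseteq> X" "Z' \<subseteq> X" using Z(1) by (auto simp: sep_def Z'_def)
  have hasx: "\<exists>w\<in>W. E w x" and hasy: "\<exists>w\<in>W. E w y" if "sep (X - {x, y}) W" "W \<noteq> {}" for W
    using sep_no_cut[OF no_cut that xX(1,2,3)] sep_no_cut[OF no_cut, of y x W] that xX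
    by (auto simp: insert_commute)
  \<comment> \<open>If \<open>z\<close> and \<open>z'\<close> were not adjacent, removing them would
    cut off a set \<open>Y\<close> without \<open>x\<close>. It misses \<open>Z\<close>, which is
    joined to \<open>x\<close>, and the other side \<open>Z'\<close>, each of whose parts touches
    \<open>x\<close>. Only \<open>y\<close> is left, but \<open>y\<close> has a neighbour in
    \<open>Z'\<close>.\<close>
  have clique: "E z z'" if z: "z \<in> Z" "z' \<in> Z" "z \<noteq> z'" for z z'
  proof (rule ccontr)
    assume "\<not> E z z'"
    moreover have "z \<in> X" "z' \<in> X" "E x z" "E x z'" using z ZX Zx E_sym by auto
    ultimately have dzz: "dist2 X z z'" using z(3) xX(1) by (auto intro: dist2I)
    have "x \<in> X - {z, z'}" using xX notZ z by auto
    then obtain Y where Y: "sep (X - {z, z'}) Y" "x \<notin> Y" "Y \<noteq> {}"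
      using not_conn_rootE[OF contra[OF dzz]] by metis
    have "sep (X - {x, y}) (Y \<inter> Z')"
      using Y(1) Z(1) ZZ' z unfolding sep_def Z'_def by blast
    moreover have "\<not> (\<exists>w\<in>Y \<inter> Z'. E w x)" using Y xX notZ z unfolding sep_def by blast
    ultimately have YZ': "Y \<inter> Z' = {}" using hasx by blast
    moreover have "Y \<inter> Z = {}" using Y(1,2) Zx xX notZ z unfolding sep_def by blast
    moreover have "Y \<subseteq> X" using Y by (auto simp: sep_def)
    ultimately have "Y \<subseteq> {y}" using Y(2) unfolding Z'_def by blast
    then have "Y = {y}" using Y(3) by blast
    moreover obtain w where "w \<in> Z'" "E w y" using hasy[OF Z'] by blast
    ultimately show False using Y(1) E_sym ZX notZ z Z'_def unfolding sep_def by blast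
  qed
  obtain z where z: "z \<in> Z" using Z(2) by blast
  \<comment> \<open>Degree three enters here: \<open>z\<close> has neighbours only in
    \<open>Z\<close> and among \<open>x\<close>, \<open>y\<close>, so \<open>Z\<close> has a second
    vertex \<open>z2\<close>. It keeps \<open>x\<close> and \<open>y\<close> connected when
    \<open>z\<close> is removed.\<close>
  have "nb X z \<subseteq> (Z - {z}) \<union> {x, y}"
    using z ZZ' E_irrefl unfolding nb_def Z'_def by blast
  then have "3 \<le> card ((Z - {z}) \<union> {x, y})"
    using deg z ZX finZ card_mono[of "(Z - {z}) \<union> {x, y}" "nb X z"] by fastforce
  also have "\<dots> \<le> card (Z - {z}) + card {x, y}" by (rule card_Un_le)
  also have "card {x, y} = 2" using xX by simp
  finally have "Z - {z} \<noteq> {}" by force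
  then obtain z2 where z2: "z2 \<in> Z" "z2 \<noteq> z" by blast
  \<comment> \<open>The contradictory pair is \<open>x'\<close> and \<open>z\<close>. A part without
    \<open>x\<close> misses \<open>Z\<close> and then also \<open>y\<close>, hence lies in
    \<open>Z'\<close>; as \<open>z\<close> has no neighbours there, \<open>x'\<close> alone cuts the
    part off.\<close>
  obtain x' where x': "x' \<in> Z'" "E x' x" using hasx[OF Z'] by blast
  have "x' \<noteq> z" using x' z by (auto simp: Z'_def)
  moreover have "x' \<in> X" "z \<in> X" "E x z" "E x x'" using x' z ZX Zx E_sym by auto
  ultimately have x'z: "dist2 X x' z" using ZZ'(2)[OF z x'(1)] xX(1) by (auto intro: dist2I)
  have "x \<in> X - {x', z}" using xX notZ z x' by auto
  then obtain Y where Y: "sep (X - {x', z}) Y" "x \<notin> Y" "Y \<noteq> {}"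
    using not_conn_rootE[OF contra[OF x'z]] by metis
  have YX: "Y \<subseteq> X - {x', z}" using Y by (auto simp: sep_def)
  have YZ: "Y \<inter> Z = {}" using Y(1,2) Zx xX notZ z x' unfolding sep_def by blast
  have "z2 \<in> X - {x', z}" using z2 ZX x' by (auto simp: Z'_def)
  then have "y \<notin> Y" using Y(1) YZ z2 Zy E_sym unfolding sep_def by blast
  then have "Y \<subseteq> Z'" using YX YZ Y(2) unfolding Z'_def by blast
  then have "sep (X - {x'}) Y" using Y(1) ZZ' z unfolding sep_def by blast
  then have "Y = X - {x'}" using no_cut x' ZX Y(3) unfolding conn_def by blast
  then show False using Y(2) xX notZ x' by blast
qed

text \<open>Brooks' theorem by the argument of Lovasz: \<open>x\<close> and \<open>y\<close> receive
  the same colour, so their common neighbour \<open>r\<close> loses two neighbours but one colour.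
  The rest is connected and is coloured greedily with \<open>r\<close> last.\<close>

lemma list_col_regular:
  assumes fin: "finite X" and con: "conn X" and no_cut: "\<forall>w\<in>X. conn (X - {w})"
    and deg: "\<forall>v\<in>X. card (nb X v) = card C" and C: "finite C" "card C \<ge> 3"
    and L: "\<forall>v\<in>X. L v = C" and nonadj: "u \<in> X" "v \<in> X" "u \<noteq> v" "\<not> E u v"
  shows "list_col X L"
proof -
  obtain x y where xy: "dist2 X x y" and con2: "conn (X - {x, y})"
    using nonseparating_pair[OF fin con no_cut _ nonadj] deg C by auto
  then obtain r where r: "r \<in> X" "E r x" "E r y" and xX: "x \<in> X" "y \<in> X" "x \<noteq> y" "\<not> E x y"
    by (auto simp: dist2_def)
  obtain c where c: "c \<in> C" using C(2) by fastforce
  let ?X = "X - {x, y}"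
  let ?L = "\<lambda>u. if \<exists>s\<in>{x, y}. E s u then L u - {c} else L u"
  have card_C1: "card (C - {c}) = card C - 1" using c by simp
  have "list_col ?X ?L"
  proof (rule list_col_peel_conn[where s = r])
    show "r \<in> ?X" using r E_irrefl by blast
    have "nb ?X r = nb X r - {x, y}" by (auto simp: nb_def)
    moreover have "{x, y} \<subseteq> nb X r" using r xX by (auto simp: nb_def)
    ultimately have "card (nb ?X r) = card C - 2"
      using deg r(1) xX(3) by (simp add: card_Diff_subset)
    then show "card (nb ?X r) < card (?L r)"
      using r E_sym L c C card_C1 by auto
    show "\<forall>v\<in>?X. finite (?L v) \<and> card (nb ?X v) \<le> card (?L v)"
    proof
      fix v assume v: "v \<in> ?X"
      have "card (nb ?X v) \<le> card (?L v)"
      proof (cases "\<exists>s\<in>{x, y}. E s v")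
        case True
        then have "nb ?X v \<subset> nb X v" using xX E_sym by (auto simp: nb_def)
        then have "card (nb ?X v) < card C"
          using deg v psubset_card_mono[of "nb X v" "nb ?X v"] fin by auto
        then show ?thesis using True L v card_C1 by auto
      next
        case False
        have "card (nb ?X v) \<le> card (nb X v)" using fin by (intro card_nb_mono) auto
        then show ?thesis using False deg L v by auto
      qed
      then show "finite (?L v) \<and> card (nb ?X v) \<le> card (?L v)" using C L v by auto
    qed
  qed (use fin con2 in auto)
  then show ?thesis
    by (rule list_col_assign) (use L c xX E_sym E_irrefl in auto)
qed

section \<open>Blocks and the decomposition at a vertex\<close>

text \<open>If a colour \<open>a\<close> of \<open>w\<close> were missing at \<open>u\<close>,
  giving \<open>a\<close> to \<open>w\<close> would cost \<open>u\<close> a neighbour but no colour.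
  With this surplus the connected set \<open>X - {w}\<close> could be coloured greedily.\<close>

lemma neighbour_list_subset:
  assumes fin: "finite X" and no_cut: "conn (X - {w})" and uncol: "\<not> list_col X L"
    and deg: "\<forall>v\<in>X. finite (L v) \<and> card (nb X v) \<le> card (L v)"
    and uw: "u \<in> X" "w \<in> X" "E w u"
  shows "L w \<subseteq> L u"
proof
  fix a assume a: "a \<in> L w"
  show "a \<in> L u"
  proof (rule ccontr)
    assume au: "a \<notin> L u"
    let ?L = "\<lambda>u. if \<exists>s\<in>{w}. E s u then L u - {a} else L u"
    have less: "card (nb (X - {w}) v) < card (nb X v)" if "E w v" for v
      using that uw E_sym fin by (intro psubset_card_mono) (auto simp: nb_def)
    have "list_col (X - {w}) ?L"
    proof (rule list_col_peel_conn[where s = u])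
      show "u \<in> X - {w}" using uw E_irrefl by blast
      show "card (nb (X - {w}) u) < card (?L u)"
        using less[OF uw(3)] deg uw au by fastforce
      show "\<forall>v\<in>X - {w}. finite (?L v) \<and> card (nb (X - {w}) v) \<le> card (?L v)"
      proof
        fix v assume v: "v \<in> X - {w}"
        have "card (nb (X - {w}) v) \<le> card (nb X v)" using fin by (intro card_nb_mono) auto
        moreover have "card (L v) - 1 \<le> card (L v - {a})" by (simp add: card_Diff_singleton_if)
        ultimately show "finite (?L v) \<and> card (nb (X - {w}) v) \<le> card (?L v)"
          using less[of v] bspec[OF deg, of v] v by auto
      qed
    qed (use fin no_cut in auto)
    then have "list_col X L" by (rule list_col_assign) (use a E_irrefl in auto)
    then show False using uncol by blast
  qed
qed

text \<open>Comparing lists along edges in both directions makes all lists equal, so the block is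
  regular of degree \<open>card (L v)\<close>. With at most two colours propagation from
  \<open>v\<close> would colour it; with more, Brooks' theorem leaves only a clique, which
  pigeonhole refutes.\<close>

lemma consistent_block:
  assumes fin: "finite X" and con: "conn X" and no_cut: "\<forall>w\<in>X. conn (X - {w})"
    and deg: "\<forall>v\<in>X. finite (L v) \<and> card (nb X v) \<le> card (L v)"
    and uncol: "\<not> list_col X L" and v: "v \<in> X" "c \<in> L v" "card (L v) \<le> k" "1 \<le> k"
    and ok: "consistent k X (L(v := {c}))"
  shows False
proof -
  let ?C = "L v"
  have tight: "card (nb X u) = card (L u)" if "u \<in> X" for u
    using list_col_peel_conn[OF fin con deg that] uncol deg that by fastforce
  have "sep X {u\<in>X. L u = ?C}"
    unfolding sep_def
  proof (intro conjI ballI notI)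
    fix y z assume yz: "y \<in> {u\<in>X. L u = ?C}" "z \<in> X - {u\<in>X. L u = ?C}" "E y z"
    then have "y \<in> X" "z \<in> X" "conn (X - {y})" "conn (X - {z})" using no_cut by auto
    then have "L y \<subseteq> L z" "L z \<subseteq> L y"
      using neighbour_list_subset[OF fin _ uncol deg] yz(3) E_sym[OF yz(3)] by simp_all
    then show False using yz(1,2) by auto
  qed auto
  then have LC: "L u = ?C" if "u \<in> X" for u using that con v(1) unfolding conn_def by blast
  have finC: "finite ?C" using deg v by blast
  have sub: "\<forall>u\<in>X. (L(v := {c})) u \<subseteq> ?C" using LC v(2) by auto
  show False
  proof (cases "card ?C \<le> 2")
    case True
    have "consistent 1 X (L(v := {c}))" using consistent_le[OF ok v(4)] .
    then have "list_col X L"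
      by (rule consistent_propagate[OF _ con v(1) sub finC True]) (use v in auto)
    then show False using uncol by blast
  next
    case False
    show False
    proof (rule consistent_clique[OF ok fin _ sub finC _ v(3)])
      show clique: "\<forall>u\<in>X. \<forall>w\<in>X. u \<noteq> w \<longrightarrow> E u w"
      proof (intro ballI impI, rule ccontr)
        fix u w assume *: "u \<in> X" "w \<in> X" "u \<noteq> w" "\<not> E u w"
        have "\<forall>u\<in>X. card (nb X u) = card ?C" using tight LC by metis
        then have "list_col X L"
          by (rule list_col_regular[OF fin con no_cut _ finC _ _ *]) (use False LC in auto)
        then show False using uncol by blast
      qed
      \<comment> \<open>Tightness turns the degree into a count of vertices: \<open>v\<close> has as
        many neighbours as colours, so together with \<open>v\<close> there are more vertices than
        colours.\<close>
      have "nb X v \<subseteq> X - {v}" using E_irrefl by (auto simp: nb_def)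
      then have "card ?C \<le> card (X - {v})" using tight[OF v(1)] fin by (metis card_mono finite_Diff)
      then show "card ?C < card X" using v(1) fin by (metis card_Diff1_less order.strict_trans1)
    qed
  qed
qed

text \<open>An uncolourable instance on a set whose proper subsets are settled is connected and
  tight. It is cut at one vertex \<open>v\<close> into a block and a remainder, and the colours
  surviving at \<open>v\<close> tell which of the two yields the contradiction.\<close>

lemma consistent_imp_list_col:
  assumes "finite X" "consistent (Suc k) X L" "1 \<le> k"
    "\<forall>v\<in>X. finite (L v) \<and> card (L v) \<le> k \<and> card (nb X v) \<le> card (L v)"
  shows "list_col X L"
  using assms
proof (induction X arbitrary: L rule: finite_psubset_induct)
  case (psubset X)
  note fin = psubset.hyps
  have deg: "\<forall>v\<in>X. finite (L v) \<and> card (nb X v) \<le> card (L v)" using psubset.prems by blast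
  show ?case
  proof (rule ccontr)
    assume uncol: "\<not> list_col X L"
    have con: "conn X"
      unfolding conn_def
    proof (intro allI impI, rule ccontr)
      fix Y assume Y: "sep X Y" "\<not> (Y = {} \<or> Y = X)"
      have part: "list_col Z L" if "Z \<subset> X" for Z
      proof (rule psubset.IH[OF that _ psubset.prems(2)])
        show "consistent (Suc k) Z L" by (rule consistent_mono[OF psubset.prems(1)]) (use that in auto)
        show "\<forall>v\<in>Z. finite (L v) \<and> card (L v) \<le> k \<and> card (nb Z v) \<le> card (L v)"
        proof
          fix v assume v: "v \<in> Z"
          have "card (nb Z v) \<le> card (nb X v)" using that fin by (intro card_nb_mono) auto
          then show "finite (L v) \<and> card (L v) \<le> k \<and> card (nb Z v) \<le> card (L v)"
            using psubset.prems(3) v that by fastforce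
        qed
      qed
      have "Y \<subset> X" "X - Y \<subset> X" using Y by (auto simp: sep_def)
      then show False using list_col_join[OF Y(1) part part] uncol by blast
    qed
    have tight: "card (nb X u) = card (L u)" if "u \<in> X" for u
      using list_col_peel_conn[OF fin con deg that] uncol deg that by fastforce
    have X_ne: "X \<noteq> {}" using uncol by (auto simp: list_col_def)
    \<comment> \<open>A smallest \<open>K\<close> forms an end block together with \<open>v\<close>.
      The vertex need not be a cut vertex: if there is none, \<open>K\<close> is all of
      \<open>X\<close> but \<open>v\<close>, and the remainder \<open>R\<close> is \<open>v\<close>
      alone.\<close>
    define P where "P = (\<lambda>(v, K). v \<in> X \<and> K \<noteq> {} \<and> sep (X - {v}) K)"
    obtain v0 where v0: "v0 \<in> X" using X_ne by blast
    \<comment> \<open>By tightness a lone vertex would have an empty list, which consistency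
      excludes.\<close>
    have "X - {v0} \<noteq> {}"
    proof
      assume "X - {v0} = {}"
      then have "nb X v0 = {}" using E_irrefl by (auto simp: nb_def)
      then have "L v0 = {}" using tight[OF v0] deg v0 by simp
      then show False using consistent_nonempty[OF psubset.prems(1) v0] by blast
    qed
    then have "P (v0, X - {v0})" using v0 by (auto simp: P_def sep_def)
    then obtain t where t: "P t" "\<And>t'. P t' \<Longrightarrow> card (snd t) \<le> card (snd t')"
      using ex_has_least_nat[of P _ "\<lambda>t. card (snd t)"] by blast
    obtain v K where tvK: "t = (v, K)" by (cases t)
    have v: "v \<in> X" and K: "K \<noteq> {}" "sep (X - {v}) K" using t(1) by (auto simp: P_def tvK)
    have minimal: "card K \<le> card W" if "w \<in> X" "W \<noteq> {}" "sep (X - {w}) W" for w W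
      using t(2)[of "(w, W)"] that by (auto simp: P_def tvK)
    define B where "B = insert v K"
    define R where "R = X - K"
    have KX: "K \<subseteq> X" "v \<notin> K" using K by (auto simp: sep_def)
    have BX: "B \<subseteq> X" "R \<subseteq> X" "finite B" "finite R" "finite K"
      using KX v fin finite_subset[OF KX(1)] by (auto simp: B_def R_def)
    have KR: "\<not> E u w" if "u \<in> K" "w \<in> X - B" for u w
      using that K(2) unfolding sep_def B_def by blast
    have sep_lift: "sep X Y" if "sep B Y" "v \<notin> Y" for Y
      using that KR BX(1) unfolding sep_def B_def by blast
    have conB: "conn B"
      by (rule conn_rootI[where y = v])
        (use sep_lift con v in \<open>auto simp: conn_def B_def\<close>)
    \<comment> \<open>For \<open>w\<close> in \<open>K\<close>, a part of \<open>B - {w}\<close>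
      without \<open>v\<close> has no edge to the rest of \<open>X\<close>, so \<open>w\<close> cuts
      it off in \<open>X\<close>; being smaller than \<open>K\<close>, it is empty. For
      \<open>w = v\<close> the same minimality makes \<open>K\<close> connected.\<close>
    have conB_del: "conn (B - {w})" if w: "w \<in> B" for w
    proof (cases "w = v")
      case True
      have "B - {w} = K" using True KX by (auto simp: B_def)
      moreover have "conn K"
        unfolding conn_def
      proof (intro allI impI)
        fix Y assume Y: "sep K Y"
        then have "sep (X - {v}) Y" using K(2) unfolding sep_def by blast
        moreover have "Y \<subseteq> K" using Y by (simp add: sep_def)
        ultimately show "Y = {} \<or> Y = K"
          using minimal[OF v, of Y] BX(5) card_seteq by blast
      qed
      ultimately show ?thesis by simp
    next
      case False
      show ?thesis
      proof (rule conn_rootI[where y = v])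
        show "v \<in> B - {w}" using False by (auto simp: B_def)
        fix Y assume Y: "sep (B - {w}) Y" "v \<notin> Y"
        have YK: "Y \<subseteq> K - {w}" using Y by (auto simp: sep_def B_def)
        have "sep (X - {w}) Y" using Y YK KR BX(1) unfolding sep_def by blast
        moreover have "w \<in> K" using w False by (auto simp: B_def)
        then have "card Y < card K" using YK BX(5) by (intro psubset_card_mono) auto
        ultimately show "Y = {}" using minimal[of w Y] w BX(1) by auto
      qed
    qed
    have sepR: "sep X Y" if "sep R Y" "v \<notin> Y" for Y
      using that KR E_sym unfolding sep_def R_def B_def by blast
    have conR: "conn R"
      by (rule conn_rootI[where y = v]) (use sepR con v KX in \<open>auto simp: conn_def R_def\<close>)
    have vR: "v \<in> B" "v \<in> R" using v KX by (auto simp: B_def R_def)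
    have "nb B v \<inter> nb R v = {}" "nb B v \<union> nb R v = nb X v"
      using BX(1) v E_irrefl by (auto simp: nb_def B_def R_def)
    then have deg_split: "card (nb B v) + card (nb R v) = card (L v)"
      using tight[OF v] card_Un_disjoint[of "nb B v" "nb R v"] BX by simp
    \<comment> \<open>Each colour of \<open>v\<close> is sorted by whether it extends to the block.
      Then \<open>B\<close> is uncolourable with the list \<open>C\<close> at \<open>v\<close>, and
      \<open>R\<close> is uncolourable with the remaining colours at \<open>v\<close>, since a
      colouring of \<open>R\<close> could be combined with one of \<open>B\<close>.\<close>
    define C where "C = {c\<in>L v. \<not> list_col B (L(v := {c}))}"
    have finL: "finite (L v)" using deg v by blast
    then have finC: "finite C" "C \<subseteq> L v" by (auto simp: C_def)
    have degB: "\<forall>u\<in>B - {v}. finite (L u) \<and> card (nb B u) \<le> card (L u)"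
      using deg BX(1) card_nb_mono[OF BX(1) fin] by (meson DiffD1 dual_order.trans subsetD)
    have degR: "\<forall>u\<in>R - {v}. finite (L u) \<and> card (nb R u) \<le> card (L u)"
      using deg BX(2) card_nb_mono[OF BX(2) fin] by (meson DiffD1 dual_order.trans subsetD)
    have uncolB: "\<not> list_col B (L(v := C))"
    proof
      assume "list_col B (L(v := C))"
      then obtain f where f: "\<forall>u\<in>B. f u \<in> (L(v := C)) u" "\<forall>u\<in>B. \<forall>w\<in>B. E u w \<longrightarrow> f u \<noteq> f w"
        by (auto simp: list_col_def)
      then have "f v \<in> C" using vR by auto
      moreover have "list_col B (L(v := {f v}))"
        unfolding list_col_def using f by (intro exI[of _ f]) auto
      ultimately show False by (simp add: C_def)
    qed
    have cardC1: "card C \<le> card (nb B v)"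
      using list_col_peel_conn[OF BX(3) conB, of "L(v := C)" v] uncolB degB finC vR by force
    have uncolR: "\<not> list_col R (L(v := L v - C))"
    proof
      assume "list_col R (L(v := L v - C))"
      then obtain f where f: "\<forall>u\<in>R. f u \<in> (L(v := L v - C)) u" "\<forall>u\<in>R. \<forall>w\<in>R. E u w \<longrightarrow> f u \<noteq> f w"
        by (auto simp: list_col_def)
      have fv: "f v \<in> L v" "f v \<notin> C" using f(1) vR by auto
      then have "list_col B (L(v := {f v}))" by (simp add: C_def)
      then obtain g where g: "\<forall>u\<in>B. g u \<in> (L(v := {f v})) u" "\<forall>u\<in>B. \<forall>w\<in>B. E u w \<longrightarrow> g u \<noteq> g w"
        by (auto simp: list_col_def)
      have gv: "g v = f v" using g(1) vR by auto
      let ?h = "\<lambda>u. if u \<in> K then g u else f u"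
      have hB: "?h u = g u" if "u \<in> B" for u using that gv by (auto simp: B_def)
      have hR: "?h u = f u" if "u \<in> R" for u using that by (auto simp: R_def)
      have "?h u \<in> L u" if "u \<in> X" for u
      proof (cases "u \<in> K")
        case True
        then have "g u \<in> (L(v := {f v})) u" using g(1) by (auto simp: B_def)
        moreover have "u \<noteq> v" using True KX by blast
        ultimately show ?thesis using True by simp
      next
        case False
        then have "f u \<in> (L(v := L v - C)) u" using f(1) that by (auto simp: R_def)
        then show ?thesis using False fv by (auto split: if_splits)
      qed
      moreover have "?h u \<noteq> ?h w" if e: "u \<in> X" "w \<in> X" "E u w" for u w
      proof -
        have "u \<in> B \<and> w \<in> B \<or> u \<in> R \<and> w \<in> R"
          using e KR[of u w] KR[of w u] E_sym[OF e(3)] unfolding B_def R_def by blast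
        then show ?thesis using hB hR f(2) g(2) e(3) by metis
      qed
      ultimately have "list_col X L" unfolding list_col_def by (intro exI[of _ ?h]) blast
      then show False using uncol by blast
    qed
    have "card (L v - C) = card (L v) - card C" using finC by (simp add: card_Diff_subset)
    moreover have "card (L v - C) \<le> card (nb R v)"
      using list_col_peel_conn[OF BX(4) conR, of "L(v := L v - C)" v] uncolR degR finL vR by force
    \<comment> \<open>Greedy colouring bounds the two parts of the list by the two parts of the
      degree. The totals agree, so both bounds are equalities, and both sides satisfy the degree
      hypothesis at \<open>v\<close>.\<close>
    ultimately have cardC: "card C = card (nb B v)" "card (L v - C) = card (nb R v)"
      using deg_split cardC1 card_mono[OF finL finC(2)] by linarith+
    obtain L' where L': "\<forall>v\<in>X. L' v \<noteq> {} \<and> L' v \<subseteq> L v" "\<forall>x\<in>X. \<forall>c\<in>L' x. consistent k X (L'(x := {c}))"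
      using psubset.prems(1) by auto
    show False
    \<comment> \<open>If no colour of \<open>C\<close> survives, the surviving lists make
      \<open>R\<close> consistent without \<open>C\<close>, and the induction colours it. A
      surviving colour of \<open>C\<close>, on the other hand, is refuted inside the block at level
      \<open>k\<close>.\<close>
    proof (cases "L' v \<inter> C = {}")
      case True
      have "list_col R (L(v := L v - C))"
      proof (rule psubset.IH[OF _ _ psubset.prems(2)])
        show "R \<subset> X" using K(1) KX by (auto simp: R_def)
        have "consistent (Suc k) X L'" using L' by auto
        then show "consistent (Suc k) R (L(v := L v - C))"
          by (rule consistent_mono) (use L'(1) True BX(2) in auto)
        show "\<forall>u\<in>R. finite ((L(v := L v - C)) u) \<and> card ((L(v := L v - C)) u) \<le> k \<and>
            card (nb R u) \<le> card ((L(v := L v - C)) u)"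
        proof
          fix u assume u: "u \<in> R"
          have "card (L v - C) \<le> card (L v)" using finL by (simp add: card_mono)
          then show "finite ((L(v := L v - C)) u) \<and> card ((L(v := L v - C)) u) \<le> k \<and>
            card (nb R u) \<le> card ((L(v := L v - C)) u)"
            using degR u cardC finL psubset.prems(3) BX(2) v by fastforce
        qed
      qed
      then show False using uncolR by blast
    next
      case False
      then obtain c where c: "c \<in> L' v" "c \<in> C" by blast
      show False
      proof (rule consistent_block[OF BX(3) conB _ _ uncolB vR(1), of c k])
        have "consistent k X (L'(v := {c}))" using L'(2) c v by blast
        then show "consistent k B (L(v := C, v := {c}))"
          by (rule consistent_mono) (use L'(1) BX(1) in auto)
        show "\<forall>w\<in>B. conn (B - {w})" using conB_del by blast
        show "\<forall>u\<in>B. finite ((L(v := C)) u) \<and> card (nb B u) \<le> card ((L(v := C)) u)"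
          using degB cardC finC by auto
        show "card ((L(v := C)) v) \<le> k"
          using psubset.prems(3) v card_mono[OF finL finC(2)] by fastforce
      qed (use c psubset.prems in auto)
    qed
  qed
qed

end

section \<open>Structured programs for Turing machines\<close>

type_synonym mem = "nat \<Rightarrow> tape"
type_synonym view = "nat \<Rightarrow> nat"

datatype prog =
  Move nat direction
| Write nat "view \<Rightarrow> nat"
| Seq prog prog (infixr ";;" 60)
| Cond "view \<Rightarrow> bool" prog prog
| While "view \<Rightarrow> bool" prog

definition rd :: "mem \<Rightarrow> view" where
  "rd \<sigma> = (\<lambda>i. read_tape (\<sigma> i))"

inductive runs :: "prog \<Rightarrow> mem \<Rightarrow> mem \<Rightarrow> nat \<Rightarrow> bool" where
  runs_Move: "runs (Move i d) \<sigma> (\<sigma>(i := act_tape (\<sigma> i) (rd \<sigma> i, d))) 1"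
| runs_Write: "runs (Write i g) \<sigma> (\<sigma>(i := act_tape (\<sigma> i) (g (rd \<sigma>), Stay))) 1"
| runs_Seq: "runs p \<sigma> \<sigma>' t \<Longrightarrow> runs q \<sigma>' \<sigma>'' u \<Longrightarrow> runs (p ;; q) \<sigma> \<sigma>'' (t + u)"
| runs_Cond_True: "c (rd \<sigma>) \<Longrightarrow> runs p \<sigma> \<sigma>' t \<Longrightarrow> runs (Cond c p q) \<sigma> \<sigma>' (1 + t)"
| runs_Cond_False: "\<not> c (rd \<sigma>) \<Longrightarrow> runs q \<sigma> \<sigma>' t \<Longrightarrow> runs (Cond c p q) \<sigma> \<sigma>' (1 + t)"
| runs_While_False: "\<not> c (rd \<sigma>) \<Longrightarrow> runs (While c p) \<sigma> \<sigma> 1"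
| runs_While_True: "c (rd \<sigma>) \<Longrightarrow> runs p \<sigma> \<sigma>' t \<Longrightarrow> runs (While c p) \<sigma>' \<sigma>'' u \<Longrightarrow>
    runs (While c p) \<sigma> \<sigma>'' (1 + t + u)"

primrec psize :: "prog \<Rightarrow> nat" where
  "psize (Move i d) = 1"
| "psize (Write i g) = 1"
| "psize (p ;; q) = psize p + psize q"
| "psize (Cond c p q) = 1 + psize p + psize q"
| "psize (While c p) = 1 + psize p"

text \<open>
  The states of a program are \<open>0, \<dots>, psize p - 1\<close>, with entry \<open>0\<close>; state \<open>psize p\<close> is its exit. A
  transition acts on a single tape; a test rewrites the symbol read on tape \<open>0\<close>.
\<close>

primrec prog_trans :: "prog \<Rightarrow> nat \<Rightarrow> view \<Rightarrow> nat \<times> nat \<times> nat \<times> direction" where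
  "prog_trans (Move i d) q s = (1, i, s i, d)"
| "prog_trans (Write i g) q s = (1, i, g s, Stay)"
| "prog_trans (p ;; p') q s =
     (if q < psize p then prog_trans p q s
      else case prog_trans p' (q - psize p) s of (q', r) \<Rightarrow> (q' + psize p, r))"
| "prog_trans (Cond c p p') q s =
     (if q = 0 then (if c s then 1 else 1 + psize p, 0, s 0, Stay)
      else if q \<le> psize p then
        (case prog_trans p (q - 1) s of (q', r) \<Rightarrow>
           (if q' = psize p then 1 + psize p + psize p' else q' + 1, r))
      else case prog_trans p' (q - 1 - psize p) s of (q', r) \<Rightarrow> (q' + 1 + psize p, r))"
| "prog_trans (While c p) q s =
     (if q = 0 then (if c s then 1 else 1 + psize p, 0, s 0, Stay)
      else case prog_trans p (q - 1) s of (q', r) \<Rightarrow> (if q' = psize p then 0 else q' + 1, r))"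

definition pstep :: "prog \<Rightarrow> nat \<times> mem \<Rightarrow> nat \<times> mem" where
  "pstep p = (\<lambda>(q, \<sigma>). case prog_trans p q (rd \<sigma>) of (q', i, a, d) \<Rightarrow>
     (q', \<sigma>(i := act_tape (\<sigma> i) (a, d))))"

primrec path :: "prog \<Rightarrow> nat \<Rightarrow> nat \<times> mem \<Rightarrow> nat \<times> mem \<Rightarrow> bool" where
  "path p 0 c c' \<longleftrightarrow> c = c'"
| "path p (Suc t) c c' \<longleftrightarrow> fst c < psize p \<and> path p t (pstep p c) c'"

lemma path_trans: "path p t c c' \<Longrightarrow> path p u c' c'' \<Longrightarrow> path p (t + u) c c''"
  by (induction t arbitrary: c) auto

text \<open>Simulation of a subprogram whose states are renamed by \<open>h\<close>. The hypothesis
  concerns only states before the exit, so \<open>h\<close> may send the exit to wherever control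
  continues.\<close>

lemma path_map:
  assumes "\<And>q \<sigma>. q < psize a \<Longrightarrow> h q < psize p \<and> pstep p (h q, \<sigma>) = apfst h (pstep a (q, \<sigma>))"
  shows "path a t c c' \<Longrightarrow> path p t (apfst h c) (apfst h c')"
proof (induction t arbitrary: c)
  case (Suc t)
  obtain q \<sigma> where c: "c = (q, \<sigma>)" by (cases c)
  then show ?case using Suc assms[of q \<sigma>] by auto
qed simp

lemma act_tape_id [simp]: "act_tape x (read_tape x, Stay) = x"
  by (cases x) simp

lemma psize_pos: "psize p > 0"
  by (induction p) auto

lemma prog_trans_le: "q < psize p \<Longrightarrow> fst (prog_trans p q s) \<le> psize p"
proof (induction p arbitrary: q)
  case (Seq p1 p2)
  show ?case
  proof (cases "q < psize p1")
    case True
    then show ?thesis using Seq.IH(1)[OF True] by simp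
  next
    case False
    then have "q - psize p1 < psize p2" using Seq.prems by simp
    then show ?thesis using Seq.IH(2)[of "q - psize p1"] False
      by (cases "prog_trans p2 (q - psize p1) s") simp
  qed
next
  case (Cond c p1 p2)
  show ?case
  proof (cases "q \<le> psize p1")
    case True
    then have "q \<noteq> 0 \<Longrightarrow> fst (prog_trans p1 (q - 1) s) \<le> psize p1" using Cond.IH(1)[of "q - 1"] by auto
    then show ?thesis using True by (cases "q = 0"; cases "prog_trans p1 (q - 1) s") auto
  next
    case False
    then have "q - 1 - psize p1 < psize p2" using Cond.prems by simp
    then show ?thesis using Cond.IH(2)[of "q - 1 - psize p1"] False
      by (cases "prog_trans p2 (q - 1 - psize p1) s") simp
  qed
next
  case (While c p)
  then have "q \<noteq> 0 \<Longrightarrow> fst (prog_trans p (q - 1) s) \<le> psize p" using While.IH[of "q - 1"] by auto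
  then show ?case by (cases "q = 0"; cases "prog_trans p (q - 1) s") auto
qed auto

text \<open>Every construct contains its parts with renumbered states. The exit of a part becomes
  the entry of the next part, the common exit, or the test of the loop.\<close>

lemma runs_imp_path: "runs p \<sigma> \<sigma>' t \<Longrightarrow> path p t (0, \<sigma>) (psize p, \<sigma>')"
proof (induction rule: runs.induct)
  case (runs_Seq p \<sigma> \<sigma>' t q \<sigma>'' u)
  have "path (p ;; q) t (apfst id (0, \<sigma>)) (apfst id (psize p, \<sigma>'))"
    by (rule path_map[OF _ runs_Seq.IH(1)]) (auto simp: pstep_def split: prod.splits)
  moreover have "path (p ;; q) u (apfst (\<lambda>r. r + psize p) (0, \<sigma>')) (apfst (\<lambda>r. r + psize p) (psize q, \<sigma>''))"
    by (rule path_map[OF _ runs_Seq.IH(2)]) (auto simp: pstep_def split: prod.splits)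
  ultimately show ?case by (auto intro: path_trans simp: add.commute)
next
  case (runs_Cond_True c \<sigma> p \<sigma>' t q)
  let ?h = "\<lambda>r. if r = psize p then 1 + psize p + psize q else r + 1"
  have "path (Cond c p q) t (apfst ?h (0, \<sigma>)) (apfst ?h (psize p, \<sigma>'))"
    by (rule path_map[OF _ runs_Cond_True.IH]) (auto simp: pstep_def split: prod.splits)
  then show ?case using runs_Cond_True.hyps(1) psize_pos[of p] by (simp add: pstep_def rd_def)
next
  case (runs_Cond_False c \<sigma> q \<sigma>' t p)
  let ?h = "\<lambda>r. r + 1 + psize p"
  have "path (Cond c p q) t (apfst ?h (0, \<sigma>)) (apfst ?h (psize q, \<sigma>'))"
    by (rule path_map[OF _ runs_Cond_False.IH]) (auto simp: pstep_def split: prod.splits)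
  then show ?case using runs_Cond_False.hyps(1) by (simp add: pstep_def rd_def add_ac)
next
  case (runs_While_True c \<sigma> p \<sigma>' t \<sigma>'' u)
  let ?h = "\<lambda>r. if r = psize p then 0 else r + 1"
  have "path (While c p) t (apfst ?h (0, \<sigma>)) (apfst ?h (psize p, \<sigma>'))"
    by (rule path_map[OF _ runs_While_True.IH(1)]) (auto simp: pstep_def split: prod.splits)
  then have "path (While c p) (1 + t) (0, \<sigma>) (0, \<sigma>')"
    using runs_While_True.hyps(1) psize_pos[of p] by (simp add: pstep_def rd_def)
  then show ?case using path_trans runs_While_True.IH(2) by blast
qed (auto simp: pstep_def rd_def fun_eq_iff)

section \<open>From programs to Turing machines\<close>

primrec wf_prog :: "nat \<Rightarrow> nat \<Rightarrow> prog \<Rightarrow> bool" where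
  "wf_prog N S (Move i d) \<longleftrightarrow> i < N"
| "wf_prog N S (Write i g) \<longleftrightarrow> i < N \<and> (\<forall>s. (\<forall>j. s j < S) \<longrightarrow> g s < S)"
| "wf_prog N S (p ;; q) \<longleftrightarrow> wf_prog N S p \<and> wf_prog N S q"
| "wf_prog N S (Cond c p q) \<longleftrightarrow> wf_prog N S p \<and> wf_prog N S q"
| "wf_prog N S (While c p) \<longleftrightarrow> wf_prog N S p"

lemma prog_trans_wf:
  assumes "wf_prog N S p" "\<forall>j. s j < S" "q < psize p" "prog_trans p q s = (q', i, a, d)" "0 < N"
  shows "i < N \<and> a < S"
  using assms
proof (induction p arbitrary: q q')
  case (Seq p1 p2)
  then show ?case by (auto split: if_splits prod.splits) (metis Seq.IH(2) add_diff_inverse_nat less_diff_conv2 nat_add_left_cancel_less not_le)+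
next
  case (Cond c p1 p2)
  have "q - 1 < psize p1" if "q \<le> psize p1" "q \<noteq> 0" using that by auto
  moreover have "q - 1 - psize p1 < psize p2" if "\<not> q \<le> psize p1" using that Cond.prems by auto
  ultimately show ?case using Cond by (auto split: if_splits prod.splits)
next
  case (While c p)
  have "q - 1 < psize p" if "q \<noteq> 0" using that While.prems by auto
  then show ?case using While by (auto split: if_splits prod.splits)
qed auto

text \<open>The exit state \<open>psize p\<close> makes one more step, which reads the verdict
  through \<open>dec\<close> and enters one of two added halting states. Tapes that are not acted
  upon get back the symbol just read.\<close>

definition machine :: "nat \<Rightarrow> nat \<Rightarrow> (view \<Rightarrow> bool) \<Rightarrow> prog \<Rightarrow> tm" where
  "machine N S dec p = \<lparr>num_tapes = N, num_states = psize p + 3, num_symbols = S, start_state = 0,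
     accept_state = psize p + 1, reject_state = psize p + 2,
     delta = (\<lambda>q syms.
       let s = (\<lambda>i. if i < length syms then syms ! i else 0); idle = map (\<lambda>a. (a, Stay)) syms in
       if q < psize p then (case prog_trans p q s of (q', i, a, d) \<Rightarrow> (q', idle[i := (a, d)]))
       else (if dec s then psize p + 1 else psize p + 2, idle))\<rparr>"

lemma wf_machine:
  assumes "wf_prog N S p" "1 \<le> N" "3 \<le> S"
  shows "wf_tm (machine N S dec p)"
proof -
  have "case delta (machine N S dec p) q syms of (q', acts) \<Rightarrow>
           q' < psize p + 3 \<and> length acts = N \<and> fst ` set acts \<subseteq> {..<S}"
    if q: "length syms = N" "set syms \<subseteq> {..<S}" for q syms
  proof -
    let ?s = "\<lambda>i. if i < length syms then syms ! i else 0"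
    have s: "\<forall>j. ?s j < S" using q assms(3) by (auto dest: nth_mem)
    have idle: "fst ` set (map (\<lambda>a. (a, Stay)) syms) \<subseteq> {..<S}" using q by auto
    have upd: "fst ` set (xs[i := (a, d)]) \<subseteq> {..<S}"
      if "fst ` set xs \<subseteq> {..<S}" "a < S" for xs :: "(nat \<times> direction) list" and i a d
      using that image_mono[OF set_update_subset_insert[of xs i "(a, d)"], of fst]
      by (metis fst_conv image_insert insert_subset lessThan_iff order_trans)
    show ?thesis
    proof (cases "q < psize p")
      case True
      obtain q' i a d where tr: "prog_trans p q ?s = (q', i, a, d)" by (metis prod_cases4)
      have "q' \<le> psize p" using prog_trans_le[OF True, of ?s] tr by simp
      moreover have "a < S" using prog_trans_wf[OF assms(1) s True tr] assms(2) by simp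
      ultimately show ?thesis using True tr q upd[OF idle] by (simp add: machine_def Let_def)
    next
      case False
      then show ?thesis using q idle by (simp add: machine_def Let_def)
    qed
  qed
  then show ?thesis using assms by (auto simp: wf_tm_def machine_def)
qed

definition config_of :: "nat \<Rightarrow> nat \<times> mem \<Rightarrow> config" where
  "config_of N = (\<lambda>(q, \<sigma>). (q, map \<sigma> [0..<N]))"

text \<open>A memory has infinitely many tapes and a machine only \<open>N\<close>. Both see the
  same symbols as long as the surplus tapes read blank.\<close>

definition blank_beyond :: "nat \<Rightarrow> mem \<Rightarrow> bool" where
  "blank_beyond N \<sigma> \<longleftrightarrow> (\<forall>i\<ge>N. rd \<sigma> i = 0)"

definition syms_below :: "nat \<Rightarrow> mem \<Rightarrow> bool" where
  "syms_below S \<sigma> \<longleftrightarrow> (\<forall>i x. fst (\<sigma> i) x < S)"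

lemma rd_view:
  "blank_beyond N \<sigma> \<Longrightarrow>
   (\<lambda>i. if i < length (map read_tape (map \<sigma> [0..<N])) then map read_tape (map \<sigma> [0..<N]) ! i else 0) = rd \<sigma>"
  by (auto simp: blank_beyond_def rd_def fun_eq_iff)

lemma tm_step_machine:
  assumes "wf_prog N S p" "0 < N" "q < psize p" "blank_beyond N \<sigma>" "syms_below S \<sigma>"
    "pstep p (q, \<sigma>) = (q', \<sigma>')"
  shows "tm_step (machine N S dec p) (config_of N (q, \<sigma>)) = config_of N (q', \<sigma>')"
    "blank_beyond N \<sigma>'" "syms_below S \<sigma>'"
proof -
  obtain i a d where tr: "prog_trans p q (rd \<sigma>) = (q', i, a, d)"
    and \<sigma>': "\<sigma>' = \<sigma>(i := act_tape (\<sigma> i) (a, d))"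
    using assms(6) by (auto simp: pstep_def split: prod.splits)
  have "\<forall>j. rd \<sigma> j < S"
    using assms(5) unfolding syms_below_def rd_def by (metis fst_conv read_tape.elims)
  then have ia: "i < N" "a < S" using prog_trans_wf[OF assms(1) _ assms(3) tr assms(2)] by auto
  show "blank_beyond N \<sigma>'" using assms(4) ia by (auto simp: blank_beyond_def rd_def \<sigma>')
  show "syms_below S \<sigma>'"
    unfolding \<sigma>' syms_below_def
  proof (intro allI)
    fix j x
    obtain f h where fh: "\<sigma> i = (f, h)" by (cases "\<sigma> i")
    have "fst (\<sigma> i) x < S" "fst (\<sigma> j) x < S" using assms(5) by (auto simp: syms_below_def)
    then show "fst ((\<sigma>(i := act_tape (\<sigma> i) (a, d))) j) x < S" using ia(2) fh by auto
  qed
  let ?syms = "map read_tape (map \<sigma> [0..<N])"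
  have "delta (machine N S dec p) q ?syms = (q', (map (\<lambda>a. (a, Stay)) ?syms)[i := (a, d)])"
    using assms(3) tr rd_view[OF assms(4)] by (simp add: machine_def Let_def del: map_map)
  moreover have "map2 act_tape (map \<sigma> [0..<N]) ((map (\<lambda>a. (a, Stay)) ?syms)[i := (a, d)]) =
      map \<sigma>' [0..<N]"
    by (rule nth_equalityI) (auto simp: nth_list_update \<sigma>')
  ultimately show "tm_step (machine N S dec p) (config_of N (q, \<sigma>)) = config_of N (q', \<sigma>')"
    using assms(3) by (simp add: config_of_def machine_def del: map_map)
qed

lemma path_machine:
  assumes "wf_prog N S p" "0 < N"
  shows "path p t (q, \<sigma>) (q', \<sigma>') \<Longrightarrow> blank_beyond N \<sigma> \<Longrightarrow> syms_below S \<sigma> \<Longrightarrow>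
    (tm_step (machine N S dec p) ^^ t) (config_of N (q, \<sigma>)) = config_of N (q', \<sigma>') \<and>
    blank_beyond N \<sigma>'"
proof (induction t arbitrary: q \<sigma>)
  case (Suc t)
  obtain q1 \<sigma>1 where *: "pstep p (q, \<sigma>) = (q1, \<sigma>1)" by fastforce
  have q: "q < psize p" and p1: "path p t (q1, \<sigma>1) (q', \<sigma>')" using Suc.prems(1) * by auto
  note step = tm_step_machine[OF assms q Suc.prems(2,3) *]
  show ?case using Suc.IH[OF p1 step(2,3)] step(1)[of dec] by (simp add: funpow_swap1)
qed auto

definition init_mem :: "bool list \<Rightarrow> mem" where
  "init_mem w = (\<lambda>i. if i = 0 then input_tape w else blank_tape)"

lemma machine_decides:
  assumes "wf_prog N S p" "1 \<le> N" "3 \<le> S" "runs p (init_mem w) \<sigma> t"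
  shows "if dec (rd \<sigma>) then accepts_within (machine N S dec p) w (t + 1)
         else rejects_within (machine N S dec p) w (t + 1)"
proof -
  let ?M = "machine N S dec p"
  have init: "init_config ?M w = config_of N (0, init_mem w)"
  proof -
    have "map (init_mem w) [0..<N] = input_tape w # replicate (N - 1) blank_tape"
      using assms(2) by (intro nth_equalityI) (auto simp: init_mem_def nth_Cons')
    then show ?thesis by (simp add: init_config_def config_of_def machine_def)
  qed
  have "blank_beyond N (init_mem w)" "syms_below S (init_mem w)"
    using assms(2,3) by (auto simp: blank_beyond_def syms_below_def init_mem_def rd_def
        blank_tape_def input_tape_def)
  then have t: "(tm_step ?M ^^ t) (init_config ?M w) = config_of N (psize p, \<sigma>)" "blank_beyond N \<sigma>"
    using path_machine[OF assms(1) _ runs_imp_path[OF assms(4)], where dec = dec] assms(2) init by auto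
  have "fst (tm_step ?M (config_of N (psize p, \<sigma>))) = (if dec (rd \<sigma>) then psize p + 1 else psize p + 2)"
    using rd_view[OF t(2)] by (simp add: config_of_def machine_def Let_def del: map_map)
  then have "fst ((tm_step ?M ^^ (t + 1)) (init_config ?M w)) =
      (if dec (rd \<sigma>) then psize p + 1 else psize p + 2)"
    using t(1) by simp
  then show ?thesis
    by (auto simp: accepts_within_def rejects_within_def machine_def intro!: exI[of _ "t + 1"])
qed

section \<open>Running times of loops\<close>

definition goes :: "prog \<Rightarrow> nat \<Rightarrow> mem \<Rightarrow> mem \<Rightarrow> bool" where
  "goes p T \<sigma> \<sigma>' \<longleftrightarrow> (\<exists>t\<le>T. runs p \<sigma> \<sigma>' t)"

lemma goesI: "runs p \<sigma> \<sigma>' t \<Longrightarrow> t \<le> T \<Longrightarrow> goes p T \<sigma> \<sigma>'"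
  unfolding goes_def by (intro exI conjI)

lemma goesE:
  assumes "goes p T \<sigma> \<sigma>'"
  obtains t where "t \<le> T" "runs p \<sigma> \<sigma>' t"
  using assms unfolding goes_def by (elim exE conjE)

lemma goes_le: "goes p T \<sigma> \<sigma>' \<Longrightarrow> T \<le> U \<Longrightarrow> goes p U \<sigma> \<sigma>'"
  by (elim goesE) (rule goesI, assumption, simp)

lemma goes_Seq: "goes p T \<sigma> \<sigma>' \<Longrightarrow> goes q U \<sigma>' \<sigma>'' \<Longrightarrow> goes (p ;; q) (T + U) \<sigma> \<sigma>''"
  by (elim goesE) (rule goesI, rule runs_Seq, auto)

lemma goes_Cond_True: "c (rd \<sigma>) \<Longrightarrow> goes p T \<sigma> \<sigma>' \<Longrightarrow> goes (Cond c p q) (1 + T) \<sigma> \<sigma>'"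
  by (elim goesE) (rule goesI, rule runs_Cond_True, auto)

lemma goes_Cond_False: "\<not> c (rd \<sigma>) \<Longrightarrow> goes q T \<sigma> \<sigma>' \<Longrightarrow> goes (Cond c p q) (1 + T) \<sigma> \<sigma>'"
  by (elim goesE) (rule goesI, rule runs_Cond_False, auto)

lemma goes_While_False: "\<not> c (rd \<sigma>) \<Longrightarrow> goes (While c p) 1 \<sigma> \<sigma>"
  by (rule goesI, rule runs_While_False, auto)

lemma goes_While_True:
  assumes "c (rd \<sigma>)" "goes p T \<sigma> \<sigma>'" "goes (While c p) U \<sigma>' \<sigma>''"
  shows "goes (While c p) (1 + T + U) \<sigma> \<sigma>''"
  by (rule goesE[OF assms(2)], rule goesE[OF assms(3)], rule goesI, rule runs_While_True)
    (use assms(1) in auto)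

lemma goes_for:
  assumes "\<And>p. p < n \<Longrightarrow> c (rd (f p)) \<and> goes b B (f p) (f (Suc p))" "\<not> c (rd (f n))"
  shows "goes (While c b) (n * (B + 1) + 1) (f 0) (f n)"
proof -
  have "goes (While c b) (i * (B + 1) + 1) (f (n - i)) (f n)" if "i \<le> n" for i
    using that
  proof (induction i)
    case 0
    then show ?case using goes_While_False[of c "f n" b] assms(2) by simp
  next
    case (Suc i)
    then have "n - Suc i < n" "Suc (n - Suc i) = n - i" by auto
    then show ?case
      using goes_While_True[of c "f (n - Suc i)" b B "f (n - i)"] assms(1)[of "n - Suc i"] Suc
      by (force simp: algebra_simps)
  qed
  from this[of n] show ?thesis by simp
qed

text \<open>For the deletion loop, where a failed test restarts the scan: the number of rounds is
  unknown but bounded by a decreasing measure.\<close>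

lemma goes_while:
  assumes "\<And>x \<sigma>. I x \<sigma> \<Longrightarrow> c (rd \<sigma>) \<Longrightarrow> \<exists>y \<sigma>'. y < x \<and> I y \<sigma>' \<and> goes b B \<sigma> \<sigma>'" "I (x :: nat) \<sigma>"
  shows "\<exists>y \<sigma>'. I y \<sigma>' \<and> \<not> c (rd \<sigma>') \<and> goes (While c b) (x * (B + 1) + 1) \<sigma> \<sigma>'"
  using assms(2)
proof (induction x arbitrary: \<sigma> rule: less_induct)
  case (less x)
  show ?case
  proof (cases "c (rd \<sigma>)")
    case True
    then obtain y \<sigma>1 where y: "y < x" "I y \<sigma>1" "goes b B \<sigma> \<sigma>1" using assms(1) less.prems by blast
    then obtain z \<sigma>' where z: "I z \<sigma>'" "\<not> c (rd \<sigma>')" "goes (While c b) (y * (B + 1) + 1) \<sigma>1 \<sigma>'"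
      using less.IH by blast
    have "1 + B + (y * (B + 1) + 1) = Suc y * (B + 1) + 1" by simp
    also have "\<dots> \<le> x * (B + 1) + 1" using y(1) by (intro add_right_mono mult_le_mono1) simp
    finally show ?thesis using goes_le[OF goes_While_True[OF True y(3) z(3)]] z(1,2) by blast
  next
    case False
    then show ?thesis using goes_le[OF goes_While_False[of c \<sigma> b]] less.prems by (metis le_add2)
  qed
qed

section \<open>Words on tapes\<close>

text \<open>The head is an integer because rewinding passes through position
  \<open>- 1\<close>.\<close>

definition tp :: "nat list \<Rightarrow> int \<Rightarrow> tape" where
  "tp xs h = ((\<lambda>i. if 0 \<le> i \<and> i < int (length xs) then xs ! nat i else 0), h)"

lemma blank_tape_tp: "blank_tape = tp [] 0"
  by (auto simp: blank_tape_def tp_def fun_eq_iff)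

lemma input_tape_tp: "input_tape w = tp (map (\<lambda>b. if b then 2 else 1) w) 0"
  by (auto simp: input_tape_def tp_def fun_eq_iff)

lemma read_tp [simp]: "read_tape (tp xs (int p)) = (if p < length xs then xs ! p else 0)"
  by (simp add: tp_def)

lemma read_tp0 [simp]: "read_tape (tp xs 0) = (if xs = [] then 0 else xs ! 0)"
  using read_tp[of xs 0] by simp

lemma rd_apply [simp]: "rd \<sigma> i = read_tape (\<sigma> i)"
  by (simp add: rd_def)

lemma goes_Move:
  assumes "act_tape (\<sigma> i) (read_tape (\<sigma> i), d) = t" "\<sigma>' = \<sigma>(i := t)"
  shows "goes (Move i d) 1 \<sigma> \<sigma>'"
  unfolding goes_def using runs_Move[of i d \<sigma>] assms by (intro exI[of _ 1]) simp

lemma goes_Right: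
  assumes "\<sigma> i = tp xs (int p)" "\<sigma>' = \<sigma>(i := tp xs (int (Suc p)))"
  shows "goes (Move i Move_Right) 1 \<sigma> \<sigma>'"
  by (rule goes_Move[OF _ assms(2)]) (auto simp: assms(1) tp_def)

lemma goes_Skip: "goes (Move i Stay) 1 \<sigma> \<sigma>"
  using runs_Move[of i Stay \<sigma>] by (auto simp: goes_def rd_def)

lemma goes_Write:
  assumes "\<sigma> i = tp xs (int p)" "p < length xs" "\<sigma>' = \<sigma>(i := tp (xs[p := g (rd \<sigma>)]) (int p))"
  shows "goes (Write i g) 1 \<sigma> \<sigma>'"
proof -
  have "act_tape (\<sigma> i) (g (rd \<sigma>), Stay) = tp (xs[p := g (rd \<sigma>)]) (int p)"
    using assms(1,2) by (auto simp: tp_def fun_eq_iff nth_list_update)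
  then show ?thesis using assms(3) runs_Write[of i g \<sigma>] by (auto simp: goes_def)
qed

lemma goes_append:
  assumes "\<sigma> i = tp xs (int p)" "p = length xs" "\<sigma>' = \<sigma>(i := tp (xs @ [g (rd \<sigma>)]) (int p))"
  shows "goes (Write i g) 1 \<sigma> \<sigma>'"
proof -
  have "act_tape (\<sigma> i) (g (rd \<sigma>), Stay) = tp (xs @ [g (rd \<sigma>)]) (int p)"
    using assms(1,2) by (auto simp: tp_def fun_eq_iff nth_append nat_less_iff)
  then show ?thesis using assms(3) runs_Write[of i g \<sigma>] by (auto simp: goes_def)
qed

text \<open>The first move is unconditional because the head may stand on the blank just behind the
  word. The loop then stops on the blank at position \<open>- 1\<close>, one cell before the
  start.\<close>

definition rewind :: "nat \<Rightarrow> prog" where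
  "rewind i = Move i Move_Left ;; While (\<lambda>s. s i \<noteq> 0) (Move i Move_Left) ;; Move i Move_Right"

lemma goes_rewind:
  assumes "\<sigma> i = tp xs (int p)" "p \<le> length xs" "0 \<notin> set xs" "\<sigma>' = \<sigma>(i := tp xs 0)"
  shows "goes (rewind i) (2 * p + 3) \<sigma> \<sigma>'"
proof -
  have left: "goes (Move i Move_Left) 1 (\<tau>(i := tp xs h)) (\<tau>(i := tp xs (h - 1)))" for \<tau> h
  proof -
    have "act_tape (tp xs h) (read_tape (tp xs h), Move_Left) = tp xs (h - 1)"
      by (auto simp: tp_def)
    then show ?thesis by (intro goes_Move[of _ i Move_Left "tp xs (h - 1)"]) (simp_all del: act_tape.simps read_tape.simps)
  qed
  define f where "f j = \<sigma>(i := tp xs (int p - 1 - int j))" for j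
  have 1: "goes (Move i Move_Left) 1 \<sigma> (f 0)"
    using left[of \<sigma> "int p"] assms(1) by (auto simp: f_def fun_upd_idem)
  have 2: "goes (While (\<lambda>s. s i \<noteq> 0) (Move i Move_Left)) (p * (1 + 1) + 1) (f 0) (f p)"
  proof (rule goes_for)
    fix j assume j: "j < p"
    have "int p - 1 - int j = int (p - 1 - j)" using j by simp
    then have "f j i = tp xs (int (p - 1 - j))" by (simp only: f_def fun_upd_same)
    then have "rd (f j) i = xs ! (p - 1 - j)" using j assms(2) by (simp del: of_nat_diff)
    moreover have "xs ! (p - 1 - j) \<in> set xs" using j assms(2) by simp
    ultimately have "rd (f j) i \<noteq> 0" using assms(3) by metis
    moreover have "int p - 1 - int j - 1 = int p - 1 - int (Suc j)" by simp
    then have "goes (Move i Move_Left) 1 (f j) (f (Suc j))"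
      using left[of \<sigma> "int p - 1 - int j"] by (simp only: f_def)
    ultimately show "rd (f j) i \<noteq> 0 \<and> goes (Move i Move_Left) 1 (f j) (f (Suc j))" ..
  qed (simp add: f_def tp_def)
  have 3: "goes (Move i Move_Right) 1 (f p) \<sigma>'"
  proof -
    have "int p - 1 - int p = - 1" by simp
    then have "f p i = tp xs (- 1)" by (simp only: f_def fun_upd_same)
    moreover have "act_tape (tp xs (- 1)) (read_tape (tp xs (- 1)), Move_Right) = tp xs 0"
      unfolding tp_def read_tape.simps act_tape.simps by (simp only: prod.inject fun_eq_iff fun_upd_apply offset.simps) simp
    ultimately show ?thesis
      by (intro goes_Move[of _ i Move_Right "tp xs 0"]) (simp_all only: f_def assms(4) fun_upd_upd)
  qed
  show ?thesis
    unfolding rewind_def by (rule goes_le[OF goes_Seq[OF 1 goes_Seq[OF 2 3]]]) simp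
qed

definition copy :: "nat \<Rightarrow> nat \<Rightarrow> (nat \<Rightarrow> nat) \<Rightarrow> prog" where
  "copy i j g =
     While (\<lambda>s. s i \<noteq> 0) (Write j (\<lambda>s. g (s i)) ;; Move j Move_Right ;; Move i Move_Right) ;;
     rewind j ;; rewind i"

lemma goes_copy:
  assumes "\<sigma> i = tp xs 0" "\<sigma> j = tp ys 0" "length ys = length xs" "i \<noteq> j"
    "0 \<notin> set xs" "0 \<notin> g ` set xs"
  shows "goes (copy i j g) (8 * length xs + 7) \<sigma> (\<sigma>(j := tp (map g xs) 0))"
proof -
  define zs where "zs p = map g (take p xs) @ drop p ys" for p
  define f where "f p = \<sigma>(i := tp xs (int p), j := tp (zs p) (int p))" for p
  have len: "length (zs p) = length xs" if "p \<le> length xs" for p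
    using that assms(3) by (simp add: zs_def)
  have "goes (While (\<lambda>s. s i \<noteq> 0) (Write j (\<lambda>s. g (s i)) ;; Move j Move_Right ;; Move i Move_Right))
      (length xs * (3 + 1) + 1) (f 0) (f (length xs))"
  proof (rule goes_for, rule conjI)
    fix p assume p: "p < length xs"
    have nz: "xs ! p \<noteq> 0" using p assms(5) by (metis nth_mem)
    then show "rd (f p) i \<noteq> 0" using p assms(4) by (simp add: f_def)
    have zs: "(zs p)[p := g (xs ! p)] = zs (Suc p)"
      using p assms(3) by (simp add: zs_def take_Suc_conv_app_nth list_update_append Cons_nth_drop_Suc[symmetric])
    define \<sigma>1 where "\<sigma>1 = (f p)(j := tp (zs (Suc p)) (int p))"
    define \<sigma>2 where "\<sigma>2 = \<sigma>1(j := tp (zs (Suc p)) (int (Suc p)))"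
    have "goes (Write j (\<lambda>s. g (s i))) 1 (f p) \<sigma>1"
      by (rule goes_Write[of _ _ "zs p" p]) (use p len zs assms(4) in \<open>auto simp: f_def \<sigma>1_def\<close>)
    moreover have "goes (Move j Move_Right) 1 \<sigma>1 \<sigma>2"
      by (rule goes_Right[of _ _ "zs (Suc p)" p]) (auto simp: \<sigma>1_def \<sigma>2_def)
    moreover have "goes (Move i Move_Right) 1 \<sigma>2 (f (Suc p))"
      by (rule goes_Right[of _ _ xs p])
        (use assms(4) in \<open>auto simp: f_def \<sigma>1_def \<sigma>2_def fun_eq_iff\<close>)
    ultimately have "goes (Write j (\<lambda>s. g (s i)) ;; Move j Move_Right ;; Move i Move_Right) (1 + (1 + 1)) (f p) (f (Suc p))"
      by (intro goes_Seq)
    then show "goes (Write j (\<lambda>s. g (s i)) ;; Move j Move_Right ;; Move i Move_Right) 3 (f p) (f (Suc p))"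
      by (simp add: numeral_3_eq_3)
  qed (use assms(4) in \<open>simp add: f_def\<close>)
  moreover have "f 0 = \<sigma>" using assms by (simp add: f_def zs_def fun_upd_idem)
  ultimately have 1: "goes (While (\<lambda>s. s i \<noteq> 0) (Write j (\<lambda>s. g (s i)) ;; Move j Move_Right ;; Move i Move_Right))
      (length xs * (3 + 1) + 1) \<sigma> (f (length xs))" by simp
  have 2: "goes (rewind j) (2 * length xs + 3) (f (length xs)) ((f (length xs))(j := tp (map g xs) 0))"
    by (rule goes_rewind) (use assms in \<open>auto simp: f_def zs_def\<close>)
  have 3: "goes (rewind i) (2 * length xs + 3) ((f (length xs))(j := tp (map g xs) 0)) (\<sigma>(j := tp (map g xs) 0))"
    by (rule goes_rewind) (use assms in \<open>auto simp: f_def zs_def fun_eq_iff\<close>)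
  show ?thesis
    unfolding copy_def by (rule goes_le[OF goes_Seq[OF 1 goes_Seq[OF 2 3]]]) simp
qed

text \<open>
  A cell of a table holds the list \<open>A\<close> of a vertex together with a mark \<open>m\<close>: the colour of that
  vertex which is being tested, or \<open>0\<close>. Both are truncated so that every write stays in the alphabet.
\<close>

definition cell :: "nat \<Rightarrow> nat set \<Rightarrow> nat \<Rightarrow> nat" where
  "cell k A m = 1 + (set_encode (A \<inter> {..k}) * (k + 1) + min m k)"

definition cset :: "nat \<Rightarrow> nat \<Rightarrow> nat set" where
  "cset k s = set_decode ((s - 1) div (k + 1))"

definition cmark :: "nat \<Rightarrow> nat \<Rightarrow> nat" where
  "cmark k s = (s - 1) mod (k + 1)"

text \<open>There are \<open>2 ^ (k + 1)\<close> subsets of \<open>{..k}\<close>,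
  \<open>k + 1\<close> marks, and the blank.\<close>

definition alphabet :: "nat \<Rightarrow> nat" where
  "alphabet k = 2 ^ (k + 1) * (k + 1) + 1"

lemma cell_pos [simp]: "cell k A m \<noteq> 0"
  by (simp add: cell_def)

lemma cset_cell [simp]: "A \<subseteq> {..k} \<Longrightarrow> cset k (cell k A m) = A"
  by (simp add: cset_def cell_def Int_absorb2 finite_subset del: mult_Suc_right)

lemma cmark_cell [simp]: "cmark k (cell k A m) = min m k"
  by (simp add: cmark_def cell_def del: mult_Suc_right)

lemma cell_less [simp]: "cell k A m < alphabet k"
proof -
  have "set_encode (A \<inter> {..k}) \<le> set_encode {..k}"
    unfolding set_encode_def by (simp add: sum_mono2)
  also have "\<dots> < 2 ^ (k + 1)"
  proof -
    have "set_encode {..<i} < 2 ^ i" for i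
      by (induction i) (auto simp: lessThan_Suc set_encode_insert)
    from this[of "k + 1"] show ?thesis by (simp add: lessThan_Suc_atMost)
  qed
  finally have "(set_encode (A \<inter> {..k}) + 1) * (k + 1) \<le> 2 ^ (k + 1) * (k + 1)"
    by (intro mult_le_mono1) simp
  then show ?thesis by (simp add: cell_def alphabet_def)
qed

lemma alphabet_ge: "3 \<le> alphabet k"
proof -
  have "2 ^ 1 * 1 \<le> 2 ^ (k + 1) * (k + 1)" by (intro mult_le_mono power_increasing) auto
  then show ?thesis by (simp add: alphabet_def)
qed

definition cells :: "nat \<Rightarrow> nat \<Rightarrow> (nat \<Rightarrow> nat set) \<Rightarrow> (nat \<Rightarrow> nat) \<Rightarrow> nat list" where
  "cells k n L mk = map (\<lambda>v. cell k (L v) (mk v)) [0..<n]"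

lemma length_cells [simp]: "length (cells k n L mk) = n"
  by (simp add: cells_def)

lemma nth_cells [simp]: "v < n \<Longrightarrow> cells k n L mk ! v = cell k (L v) (mk v)"
  by (simp add: cells_def)

lemma cells_nonzero [simp]: "0 \<notin> set (cells k n L mk)"
  by (auto simp: cells_def cell_def)

lemma cells_update:
  "p < n \<Longrightarrow> (cells k n L mk)[p := cell k A m] = cells k n (L(p := A)) (mk(p := m))"
  by (auto simp: nth_list_update intro!: nth_equalityI)

section \<open>The consistency test as a program\<close>

text \<open>
  Tapes: \<open>0\<close> input, \<open>1\<close> adjacency matrix, \<open>2\<close> second copy of the level \<open>0\<close> table (so that two vertices can
  be read at once), \<open>3\<close> verdict (\<open>1\<close> consistent, \<open>2\<close> refuted), \<open>4 + j\<close> table of lists at level \<open>j\<close>.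
  Adjacency bits are \<open>1\<close> and \<open>2\<close> as on the input tape.
\<close>

definition conflict :: "nat \<Rightarrow> view \<Rightarrow> bool" where
  "conflict k s \<longleftrightarrow> cset k (s 2) = {} \<or> s 1 = 2 \<and> s 2 = s 4 \<and> card (cset k (s 2)) = 1"

text \<open>The matrix head is not rewound inside the loops: since the matrix is stored row by row,
  it moves in step with the pair of vertices under inspection.\<close>

definition check :: "nat \<Rightarrow> prog" where
  "check k =
     copy 4 2 id ;; Write 3 (\<lambda>s. 1) ;;
     While (\<lambda>s. s 2 \<noteq> 0)
       (While (\<lambda>s. s 4 \<noteq> 0)
          (Write 3 (\<lambda>s. if conflict k s then 2 else s 3) ;; Move 4 Move_Right ;; Move 1 Move_Right) ;;
        rewind 4 ;; Move 2 Move_Right) ;;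
     rewind 2 ;; rewind 1"

definition select :: "nat \<Rightarrow> nat \<Rightarrow> nat" where
  "select k s = cell k (if cmark k s = 0 then cset k s else {cmark k s}) 0"

text \<open>The mark remembers the tested vertex and colour while the head is away; afterwards the
  only nonzero mark locates the cell. A refutation deletes the colour, clears the mark and goes back
  to the first vertex, because earlier tests may fail for the smaller lists.\<close>

definition test_colour :: "nat \<Rightarrow> nat \<Rightarrow> nat \<Rightarrow> prog \<Rightarrow> prog" where
  "test_colour k i i' p =
     rewind i ;; copy i i' (select k) ;; p ;;
     While (\<lambda>s. cmark k (s i) = 0) (Move i Move_Right) ;;
     Cond (\<lambda>s. s 3 = 2)
       (Write i (\<lambda>s. cell k (cset k (s i) - {cmark k (s i)}) 0) ;; rewind i)
       (Move i Stay)"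

definition advance :: "nat \<Rightarrow> nat \<Rightarrow> nat \<Rightarrow> prog \<Rightarrow> prog" where
  "advance k i i' p =
     Cond (\<lambda>s. cmark k (s i) = k)
       (Write i (\<lambda>s. cell k (cset k (s i)) 0) ;; Move i Move_Right)
       (Write i (\<lambda>s. cell k (cset k (s i)) (cmark k (s i) + 1)) ;;
        Cond (\<lambda>s. cmark k (s i) \<in> cset k (s i)) (test_colour k i i' p) (Move i Stay))"

definition all_nonempty :: "nat \<Rightarrow> nat \<Rightarrow> prog" where
  "all_nonempty k i =
     rewind i ;; Write 3 (\<lambda>s. 1) ;;
     While (\<lambda>s. s i \<noteq> 0)
       (Write 3 (\<lambda>s. if cset k (s i) = {} then 2 else s 3) ;; Move i Move_Right) ;;
     rewind i"

primrec decide :: "nat \<Rightarrow> nat \<Rightarrow> prog" where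
  "decide k 0 = check k"
| "decide k (Suc j) =
     While (\<lambda>s. s (5 + j) \<noteq> 0) (advance k (5 + j) (4 + j) (decide k j)) ;; all_nonempty k (5 + j)"

lemma wf_rewind [simp]: "wf_prog N S (rewind i) \<longleftrightarrow> i < N"
  by (auto simp: rewind_def)

lemma wf_copy: "i < N \<Longrightarrow> j < N \<Longrightarrow> (\<And>s. s < S \<Longrightarrow> g s < S) \<Longrightarrow> wf_prog N S (copy i j g)"
  by (auto simp: copy_def)

lemma wf_decide: "5 + j \<le> N \<Longrightarrow> wf_prog N (alphabet k) (decide k j)"
  using alphabet_ge[of k]
  by (induction j)
    (auto simp: check_def advance_def test_colour_def all_nonempty_def select_def intro!: wf_copy)

section \<open>Correctness of the deletions\<close>

context sym_graph
begin

text \<open>A colour refuted for the lists \<open>L\<close> is refuted for all smaller lists, so it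
  lies in no witness \<open>L'\<close>, and every witness survives the deletion.\<close>

lemma consistent_remove_colour:
  assumes "x \<in> X" "\<not> consistent j X (L(x := {c}))"
  shows "consistent (Suc j) X (L(x := L x - {c})) \<longleftrightarrow> consistent (Suc j) X L"
proof
  assume "consistent (Suc j) X (L(x := L x - {c}))"
  then show "consistent (Suc j) X L" by (rule consistent_mono) auto
next
  assume "consistent (Suc j) X L"
  then obtain L' where L': "\<forall>v\<in>X. L' v \<noteq> {} \<and> L' v \<subseteq> L v" "\<forall>x\<in>X. \<forall>c\<in>L' x. consistent j X (L'(x := {c}))"
    by auto
  have "c \<notin> L' x"
  proof
    assume "c \<in> L' x"
    then have "consistent j X (L'(x := {c}))" using L'(2) assms(1) by blast
    then have "consistent j X (L(x := {c}))" by (rule consistent_mono) (use L'(1) in auto)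
    then show False using assms(2) by blast
  qed
  then have "\<forall>v\<in>X. L' v \<noteq> {} \<and> L' v \<subseteq> (L(x := L x - {c})) v" using L'(1) by auto
  then show "consistent (Suc j) X (L(x := L x - {c}))"
    unfolding consistent.simps using L'(2) by (intro exI[of _ L'] conjI)
qed

text \<open>Once no colour is refuted, \<open>L\<close> is its own witness, and only empty lists can
  still spoil it.\<close>

lemma consistent_stable:
  assumes "\<forall>v\<in>X. \<forall>c\<in>L v. consistent j X (L(v := {c}))"
  shows "consistent (Suc j) X L \<longleftrightarrow> (\<forall>v\<in>X. L v \<noteq> {})"
proof
  assume "\<forall>v\<in>X. L v \<noteq> {}"
  then show "consistent (Suc j) X L" using assms by auto
qed (use consistent_nonempty in blast)

end

text \<open>An upper bound for the measure \<open>meas\<close> at the start of a scan: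
  \<open>n * k\<close> colours in all lists together, no vertex passed, no colour tested.\<close>

definition scan_bound :: "nat \<Rightarrow> nat \<Rightarrow> nat" where
  "scan_bound k n = n * k * ((n + 1) * (k + 1)) + n * (k + 1) + k"

primrec decide_time :: "nat \<Rightarrow> nat \<Rightarrow> nat \<Rightarrow> nat" where
  "decide_time k 0 n = 20 * (n + 1) * (n + 1)"
| "decide_time k (Suc j) n =
     scan_bound k n * (decide_time k j n + 20 * (n + 1) + 4) + 1 + 10 * (n + 1)"

locale matrix_graph = sym_graph E for E :: "nat \<Rightarrow> nat \<Rightarrow> bool" +
  fixes k n :: nat and M :: "nat list"
  assumes length_M: "length M = n * n" and M_nonzero: "0 \<notin> set M"
    and E_M: "u < n \<Longrightarrow> v < n \<Longrightarrow> E u v \<longleftrightarrow> M ! (u * n + v) = 2"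
    and k_pos: "1 \<le> k"
begin

text \<open>The contents are arbitrary, but copying overwrites cell by cell and needs a word of the
  right length with the head at its start.\<close>

definition scratch :: "mem \<Rightarrow> nat \<Rightarrow> bool" where
  "scratch \<sigma> i \<longleftrightarrow> (\<exists>ys. length ys = n \<and> \<sigma> i = tp ys 0)"

lemma scratch_tp: "length ys = n \<Longrightarrow> \<sigma> i = tp ys 0 \<Longrightarrow> scratch \<sigma> i"
  by (auto simp: scratch_def)

lemma scratch_upd: "scratch (\<sigma>(i := t)) i' \<longleftrightarrow> (if i' = i then \<exists>ys. length ys = n \<and> t = tp ys 0 else scratch \<sigma> i')"
  by (auto simp: scratch_def)

lemma cells_scratch [simp]: "\<exists>ys. length ys = n \<and> tp (cells k n L mk) 0 = tp ys 0"
  by (rule exI[of _ "cells k n L mk"]) simp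

definition env :: "nat \<Rightarrow> mem \<Rightarrow> bool" where
  "env j \<sigma> \<longleftrightarrow> \<sigma> 1 = tp M 0 \<and> scratch \<sigma> 2 \<and> (\<exists>f. \<sigma> 3 = tp [f] 0) \<and> (\<forall>i<j. scratch \<sigma> (4 + i))"

text \<open>The tables above level \<open>j\<close> must stay intact because the marks of the
  calling levels are stored there.\<close>

definition frame :: "nat \<Rightarrow> mem \<Rightarrow> mem \<Rightarrow> bool" where
  "frame j \<sigma> \<sigma>' \<longleftrightarrow> (\<forall>i. i = 0 \<or> i = 1 \<or> 4 + j < i \<longrightarrow> \<sigma>' i = \<sigma> i)"

abbreviation flag :: "bool \<Rightarrow> nat" where
  "flag b \<equiv> if b then 1 else 2"

lemma goes_check:
  assumes \<sigma>4: "\<sigma> 4 = tp (cells k n L (\<lambda>_. 0)) 0" and env: "env 0 \<sigma>" and L: "\<forall>v<n. L v \<subseteq> {..k}"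
  shows "goes (check k) (20 * (n + 1) * (n + 1)) \<sigma>
    (\<sigma>(2 := tp (cells k n L (\<lambda>_. 0)) 0, 3 := tp [flag (consistent 0 {..<n} L)] 0))"
proof -
  let ?C = "cells k n L (\<lambda>_. 0)"
  \<comment> \<open>Pairs of vertices are numbered like the matrix entries; \<open>fl N\<close> is
    the verdict after the first \<open>N\<close> pairs.\<close>
  define bad where "bad i \<longleftrightarrow> L (i div n) = {} \<or>
    E (i div n) (i mod n) \<and> L (i div n) = L (i mod n) \<and> card (L (i div n)) = 1" for i
  define fl where "fl N = (if \<exists>i<N. bad i then 2 else 1 :: nat)" for N
  obtain ys f where ys: "length ys = n" "\<sigma> 2 = tp ys 0" and f: "\<sigma> 3 = tp [f] 0" and \<sigma>1: "\<sigma> 1 = tp M 0"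
    using env by (auto simp: env_def scratch_def)
  define st where "st u v N = \<sigma>(2 := tp ?C (int u), 4 := tp ?C (int v), 1 := tp M (int N), 3 := tp [fl N] 0)"
    for u v N
  have 1: "goes (copy 4 2 id) (8 * n + 7) \<sigma> (\<sigma>(2 := tp ?C 0))"
    using goes_copy[of \<sigma> 4 ?C 2 ys id] \<sigma>4 ys by simp
  have 2: "goes (Write 3 (\<lambda>s. 1)) 1 (\<sigma>(2 := tp ?C 0)) (st 0 0 0)"
    by (rule goes_Write[of _ _ "[f]" 0])
      (use f \<sigma>4 \<sigma>1 in \<open>auto simp: st_def fl_def fun_eq_iff\<close>)
  have step: "goes (Write 3 (\<lambda>s. if conflict k s then 2 else s 3) ;; Move 4 Move_Right ;; Move 1 Move_Right)
      (1 + (1 + 1)) (st u v (u * n + v)) (st u (Suc v) (u * n + Suc v))" if uv: "u < n" "v < n" for u v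
  proof (intro goes_Seq)
    let ?N = "u * n + v"
    have N: "?N < n * n"
    proof -
      have "?N < Suc u * n" using uv by simp
      also have "\<dots> \<le> n * n" using uv by (intro mult_le_mono1) simp
      finally show ?thesis .
    qed
    have dm: "?N div n = u" "?N mod n = v" using uv by auto
    \<comment> \<open>Comparing whole symbols compares the lists, because every mark in a level 0
      table is 0.\<close>
    have "cell k (L u) 0 = cell k (L v) 0 \<longleftrightarrow> L u = L v"
      using L uv by (metis cset_cell)
    moreover have "read_tape (st u v ?N 1) = M ! ?N"
      using N by (simp add: st_def length_M del: of_nat_add of_nat_mult)
    moreover have "read_tape (st u v ?N 2) = cell k (L u) 0" "read_tape (st u v ?N 4) = cell k (L v) 0"
      using uv by (simp_all add: st_def)
    ultimately have "conflict k (rd (st u v ?N)) \<longleftrightarrow> bad ?N"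
      using uv L E_M[OF uv] by (simp add: conflict_def bad_def dm)
    then have "fl (Suc ?N) = (if conflict k (rd (st u v ?N)) then 2 else fl ?N)"
      by (auto simp: fl_def less_Suc_eq)
    then show "goes (Write 3 (\<lambda>s. if conflict k s then 2 else s 3)) 1 (st u v ?N)
        ((st u v ?N)(3 := tp [fl (Suc ?N)] 0))"
      by (intro goes_Write[of _ _ "[fl ?N]" 0]) (auto simp: st_def)
    show "goes (Move 4 Move_Right) 1 ((st u v ?N)(3 := tp [fl (Suc ?N)] 0))
        ((st u v ?N)(3 := tp [fl (Suc ?N)] 0, 4 := tp ?C (int (Suc v))))"
      by (rule goes_Right[of _ _ ?C v]) (auto simp: st_def)
    show "goes (Move 1 Move_Right) 1
        ((st u v ?N)(3 := tp [fl (Suc ?N)] 0, 4 := tp ?C (int (Suc v)))) (st u (Suc v) (u * n + Suc v))"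
      by (rule goes_Right[of _ _ M ?N]) (auto simp: st_def fun_eq_iff)
  qed
  have inner: "goes (While (\<lambda>s. s 4 \<noteq> 0)
      (Write 3 (\<lambda>s. if conflict k s then 2 else s 3) ;; Move 4 Move_Right ;; Move 1 Move_Right))
      (n * (1 + (1 + 1) + 1) + 1) (st u 0 (u * n)) (st u n (u * n + n))" if u: "u < n" for u
  proof -
    have "goes (While (\<lambda>s. s 4 \<noteq> 0)
      (Write 3 (\<lambda>s. if conflict k s then 2 else s 3) ;; Move 4 Move_Right ;; Move 1 Move_Right))
      (n * (1 + (1 + 1) + 1) + 1) (st u 0 (u * n + 0)) (st u n (u * n + n))"
      by (rule goes_for[where f = "\<lambda>v. st u v (u * n + v)"], rule conjI[OF _ step[OF u]])
        (auto simp: st_def)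
    then show ?thesis by (simp only: add_0_right)
  qed
  have outer: "goes (While (\<lambda>s. s 2 \<noteq> 0)
       (While (\<lambda>s. s 4 \<noteq> 0)
          (Write 3 (\<lambda>s. if conflict k s then 2 else s 3) ;; Move 4 Move_Right ;; Move 1 Move_Right) ;;
        rewind 4 ;; Move 2 Move_Right))
      (n * ((n * (1 + (1 + 1) + 1) + 1 + (2 * n + 3 + 1)) + 1) + 1) (st 0 0 (0 * n)) (st n 0 (n * n))"
  proof (rule goes_for, rule conjI)
    fix u assume u: "u < n"
    show "rd (st u 0 (u * n)) 2 \<noteq> 0" using u by (simp add: st_def)
    have r: "goes (rewind 4) (2 * n + 3) (st u n (u * n + n)) (st u 0 (Suc u * n))"
      by (rule goes_rewind[of _ _ ?C]) (auto simp: st_def fun_eq_iff add.commute)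
    have m: "goes (Move 2 Move_Right) 1 (st u 0 (Suc u * n)) (st (Suc u) 0 (Suc u * n))"
      by (rule goes_Right[of _ _ ?C u]) (auto simp: st_def fun_eq_iff)
    show "goes (While (\<lambda>s. s 4 \<noteq> 0)
          (Write 3 (\<lambda>s. if conflict k s then 2 else s 3) ;; Move 4 Move_Right ;; Move 1 Move_Right) ;;
        rewind 4 ;; Move 2 Move_Right) (n * (1 + (1 + 1) + 1) + 1 + (2 * n + 3 + 1))
        (st u 0 (u * n)) (st (Suc u) 0 (Suc u * n))"
      by (rule goes_Seq[OF inner[OF u] goes_Seq[OF r m]])
  qed (simp add: st_def)
  have 3: "goes (rewind 2) (2 * n + 3) (st n 0 (n * n)) (st 0 0 (n * n))"
    by (rule goes_rewind[of _ _ ?C]) (auto simp: st_def fun_eq_iff)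
  have "(\<exists>i<n * n. bad i) \<longleftrightarrow> \<not> consistent 0 {..<n} L"
  proof
    assume "\<exists>i<n * n. bad i"
    then obtain i where i: "i < n * n" "bad i" by blast
    moreover from this have "n > 0" by (cases n) auto
    ultimately have "i div n < n" "i mod n < n" by (simp_all add: less_mult_imp_div_less)
    then show "\<not> consistent 0 {..<n} L" using i by (auto simp: bad_def)
  next
    assume "\<not> consistent 0 {..<n} L"
    then obtain u v where uv: "u < n" "v < n" "L u = {} \<or> E u v \<and> L u = L v \<and> card (L u) = 1"
      by auto
    have "u * n + v < Suc u * n" using uv by simp
    also have "\<dots> \<le> n * n" using uv by (intro mult_le_mono1) simp
    finally have "u * n + v < n * n" .
    moreover have "bad (u * n + v)" using uv by (auto simp: bad_def)
    ultimately show "\<exists>i<n * n. bad i" by blast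
  qed
  then have fl: "fl (n * n) = flag (consistent 0 {..<n} L)" by (simp add: fl_def)
  have 4: "goes (rewind 1) (2 * (n * n) + 3) (st 0 0 (n * n))
      (\<sigma>(2 := tp ?C 0, 3 := tp [flag (consistent 0 {..<n} L)] 0))"
    by (rule goes_rewind[of _ _ M])
      (use length_M M_nonzero \<sigma>1 \<sigma>4 fl in \<open>auto simp: st_def fun_eq_iff\<close>)
  show ?thesis
    unfolding check_def
    by (rule goes_le[OF goes_Seq[OF 1 goes_Seq[OF 2 goes_Seq[OF outer[simplified mult_0] goes_Seq[OF 3 4]]]]])
      (simp add: algebra_simps)
qed


text \<open>The table of level \<open>j\<close> is an input and comes back as mere scratch, hence
  \<open>env (Suc j)\<close> afterwards; the caller keeps its own lists one tape higher.\<close>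

definition correct :: "nat \<Rightarrow> nat \<Rightarrow> bool" where
  "correct j B \<longleftrightarrow> (\<forall>\<sigma> L. \<sigma> (4 + j) = tp (cells k n L (\<lambda>_. 0)) 0 \<longrightarrow> env j \<sigma> \<longrightarrow> (\<forall>v<n. L v \<subseteq> {1..k}) \<longrightarrow>
     (\<exists>\<sigma>'. goes (decide k j) B \<sigma> \<sigma>' \<and> env (Suc j) \<sigma>' \<and> frame j \<sigma> \<sigma>' \<and>
       rd \<sigma>' 3 = flag (consistent j {..<n} L)))"

lemma correct_check: "correct 0 (20 * (n + 1) * (n + 1))"
  unfolding correct_def
proof (intro allI impI)
  fix \<sigma> L assume *: "\<sigma> (4 + 0) = tp (cells k n L (\<lambda>_. 0)) 0" "env 0 \<sigma>" "\<forall>v<n. L v \<subseteq> {1..k}"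
  have "\<forall>v<n. L v \<subseteq> {..k}" using *(3) by fastforce
  then have g: "goes (decide k 0) (20 * (n + 1) * (n + 1)) \<sigma>
    (\<sigma>(2 := tp (cells k n L (\<lambda>_. 0)) 0, 3 := tp [flag (consistent 0 {..<n} L)] 0))" (is "goes _ _ _ ?\<sigma>'")
    using goes_check * by (simp only: decide.simps add_0_right)
  have "env (Suc 0) ?\<sigma>'" "frame 0 \<sigma> ?\<sigma>'" "rd ?\<sigma>' 3 = flag (consistent 0 {..<n} L)"
    using * scratch_tp[of "cells k n L (\<lambda>_. 0)" \<sigma> 4]
    by (auto simp: env_def frame_def scratch_upd simp del: consistent.simps)
  then show "\<exists>\<sigma>'. goes (decide k 0) (20 * (n + 1) * (n + 1)) \<sigma> \<sigma>' \<and> env (Suc 0) \<sigma>' \<and> frame 0 \<sigma> \<sigma>' \<and>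
       rd \<sigma>' 3 = flag (consistent 0 {..<n} L)" using g by blast
qed

lemma goes_test_colour:
  assumes IH: "correct j B"
    and \<sigma>T: "\<sigma> (5 + j) = tp (cells k n L ((\<lambda>_. 0)(p := m))) (int p)"
    and env: "env (Suc j) \<sigma>" and p: "p < n" and m: "m \<in> L p" and L: "\<forall>v<n. L v \<subseteq> {1..k}"
  shows "\<exists>\<sigma>'. goes (test_colour k (5 + j) (4 + j) (decide k j)) (B + 20 * (n + 1)) \<sigma> \<sigma>' \<and>
    env (Suc j) \<sigma>' \<and> frame (Suc j) \<sigma> \<sigma>' \<and>
    \<sigma>' (5 + j) = (if consistent j {..<n} (L(p := {m})) then \<sigma> (5 + j)
      else tp (cells k n (L(p := L p - {m})) (\<lambda>_. 0)) 0)"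
proof -
  let ?T = "5 + j" and ?T' = "4 + j"
  let ?C = "cells k n L ((\<lambda>_. 0)(p := m))"
  have "m \<in> {1..k}" using L p m by blast
  then have mk: "1 \<le> m" "m \<le> k" by auto
  have Lk: "\<And>v. v < n \<Longrightarrow> L v \<subseteq> {..k}" using L by fastforce
  define \<sigma>1 where "\<sigma>1 = \<sigma>(?T := tp ?C 0)"
  define \<sigma>2 where "\<sigma>2 = \<sigma>1(?T' := tp (map (select k) ?C) 0)"
  have 1: "goes (rewind ?T) (2 * p + 3) \<sigma> \<sigma>1"
    by (rule goes_rewind[of \<sigma> ?T ?C p]) (use \<sigma>T p in \<open>auto simp: \<sigma>1_def\<close>)
  obtain ys where ys: "length ys = n" "\<sigma> ?T' = tp ys 0" using env by (auto simp: env_def scratch_def)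
  have 2: "goes (copy ?T ?T' (select k)) (8 * n + 7) \<sigma>1 \<sigma>2"
  proof -
    have "0 \<notin> select k ` set ?C" by (auto simp: select_def cell_pos[symmetric] simp del: cell_pos)
    then show ?thesis
      using goes_copy[of \<sigma>1 ?T ?C ?T' ys "select k"] ys by (simp add: \<sigma>1_def \<sigma>2_def)
  qed
  have "map (select k) ?C = cells k n (L(p := {m})) (\<lambda>_. 0)"
    using mk Lk by (intro nth_equalityI) (auto simp: select_def)
  then have \<sigma>2T': "\<sigma>2 ?T' = tp (cells k n (L(p := {m})) (\<lambda>_. 0)) 0" by (simp add: \<sigma>2_def)
  have env2: "env j \<sigma>2" using env by (auto simp: env_def scratch_def \<sigma>1_def \<sigma>2_def)
  have L2: "\<forall>v<n. (L(p := {m})) v \<subseteq> {1..k}" using L mk by auto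
  obtain \<sigma>3 where \<sigma>3: "goes (decide k j) B \<sigma>2 \<sigma>3" "env (Suc j) \<sigma>3" "frame j \<sigma>2 \<sigma>3"
    "rd \<sigma>3 3 = flag (consistent j {..<n} (L(p := {m})))"
    using IH[unfolded correct_def, rule_format, OF \<sigma>2T' env2] L2 by auto
  \<comment> \<open>The caller's table lies outside the frame of level \<open>j\<close>, so lists
    and mark have survived the recursive test.\<close>
  have \<sigma>3T: "\<sigma>3 ?T = tp ?C 0" using \<sigma>3(3) by (auto simp: frame_def \<sigma>2_def \<sigma>1_def)
  define f where "f q = \<sigma>3(?T := tp ?C (int q))" for q
  have "goes (While (\<lambda>s. cmark k (s ?T) = 0) (Move ?T Move_Right)) (p * (1 + 1) + 1) (f 0) (f p)"
  proof (rule goes_for, rule conjI)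
    fix q assume q: "q < p"
    show "cmark k (rd (f q) ?T) = 0" using q p by (simp add: f_def)
    show "goes (Move ?T Move_Right) 1 (f q) (f (Suc q))"
      by (rule goes_Right[of _ _ ?C q]) (auto simp: f_def)
  next
    show "cmark k (rd (f p) ?T) \<noteq> 0" using p mk by (simp add: f_def)
  qed
  moreover have "f 0 = \<sigma>3" using \<sigma>3T by (simp add: f_def fun_upd_idem)
  ultimately have 4: "goes (While (\<lambda>s. cmark k (s ?T) = 0) (Move ?T Move_Right)) (p * (1 + 1) + 1) \<sigma>3 (f p)"
    by simp
  let ?fix = "Write ?T (\<lambda>s. cell k (cset k (s ?T) - {cmark k (s ?T)}) 0) ;; rewind ?T"
  have flag: "rd (f p) 3 = flag (consistent j {..<n} (L(p := {m})))" using \<sigma>3(4) by (simp add: f_def)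
  have frame_fp: "frame (Suc j) \<sigma> (f p)"
    using \<sigma>3(3) by (auto simp: frame_def f_def \<sigma>1_def \<sigma>2_def)
  have env_fp: "env (Suc j) ((f p)(?T := t))" for t
    using \<sigma>3(2) by (auto simp: env_def scratch_def f_def)
  have "\<exists>\<sigma>'. goes (Cond (\<lambda>s. s 3 = 2) ?fix (Move ?T Stay)) (1 + (1 + (2 * p + 3))) (f p) \<sigma>' \<and>
    env (Suc j) \<sigma>' \<and> frame (Suc j) \<sigma> \<sigma>' \<and>
    \<sigma>' ?T = (if consistent j {..<n} (L(p := {m})) then \<sigma> ?T
      else tp (cells k n (L(p := L p - {m})) (\<lambda>_. 0)) 0)"
  proof (cases "consistent j {..<n} (L(p := {m}))")
    case True
    then have "goes (Cond (\<lambda>s. s 3 = 2) ?fix (Move ?T Stay)) (1 + 1) (f p) (f p)"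
      using flag by (intro goes_Cond_False goes_Skip) auto
    then have "goes (Cond (\<lambda>s. s 3 = 2) ?fix (Move ?T Stay)) (1 + (1 + (2 * p + 3))) (f p) (f p)"
      by (rule goes_le) simp
    moreover have "f p ?T = \<sigma> ?T" using \<sigma>T by (simp add: f_def)
    moreover have "env (Suc j) (f p)" using env_fp[of "f p ?T"] by simp
    ultimately show ?thesis using True frame_fp by (intro exI[of _ "f p"]) simp
  next
    case False
    let ?C' = "cells k n (L(p := L p - {m})) (\<lambda>_. 0)"
    have upd: "?C[p := cell k (L p - {m}) 0] = ?C'" using p by (simp add: cells_update fun_upd_idem)
    have w: "goes (Write ?T (\<lambda>s. cell k (cset k (s ?T) - {cmark k (s ?T)}) 0)) 1 (f p)
        ((f p)(?T := tp ?C' (int p)))"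
      by (rule goes_Write[of _ _ ?C p]) (use p mk Lk[OF p] upd in \<open>auto simp: f_def\<close>)
    have r: "goes (rewind ?T) (2 * p + 3) ((f p)(?T := tp ?C' (int p))) ((f p)(?T := tp ?C' 0))"
      by (rule goes_rewind[of _ _ ?C' p]) (use p in auto)
    have "goes (Cond (\<lambda>s. s 3 = 2) ?fix (Move ?T Stay)) (1 + (1 + (2 * p + 3))) (f p) ((f p)(?T := tp ?C' 0))"
      using flag False by (intro goes_Cond_True goes_Seq[OF w r]) auto
    moreover have "frame (Suc j) \<sigma> ((f p)(?T := tp ?C' 0))" using frame_fp by (auto simp: frame_def)
    ultimately show ?thesis using False env_fp by (intro exI[of _ "(f p)(?T := tp ?C' 0)"]) simp
  qed
  then obtain \<sigma>' where \<sigma>': "goes (Cond (\<lambda>s. s 3 = 2) ?fix (Move ?T Stay)) (1 + (1 + (2 * p + 3))) (f p) \<sigma>'"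
    "env (Suc j) \<sigma>'" "frame (Suc j) \<sigma> \<sigma>'"
    "\<sigma>' ?T = (if consistent j {..<n} (L(p := {m})) then \<sigma> ?T
      else tp (cells k n (L(p := L p - {m})) (\<lambda>_. 0)) 0)" by blast
  have "goes (test_colour k ?T ?T' (decide k j)) (B + 20 * (n + 1)) \<sigma> \<sigma>'"
    unfolding test_colour_def
    by (rule goes_le[OF goes_Seq[OF 1 goes_Seq[OF 2 goes_Seq[OF \<sigma>3(1) goes_Seq[OF 4 \<sigma>'(1)]]]]])
      (use p in simp)
  then show ?thesis using \<sigma>'(2-4) by blast
qed

lemma goes_all_nonempty:
  assumes \<sigma>i: "\<sigma> i = tp (cells k n L mk) (int n)" and f: "\<sigma> 3 = tp [f] 0" and i: "i \<noteq> 3"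
    and L: "\<forall>v<n. L v \<subseteq> {..k}"
  shows "goes (all_nonempty k i) (10 * (n + 1)) \<sigma>
    (\<sigma>(i := tp (cells k n L mk) 0, 3 := tp [flag (\<forall>v<n. L v \<noteq> {})] 0))"
proof -
  let ?C = "cells k n L mk"
  define fl where "fl N = flag (\<forall>v<N. L v \<noteq> {})" for N
  define st where "st N = \<sigma>(i := tp ?C (int N), 3 := tp [fl N] 0)" for N
  have 1: "goes (rewind i) (2 * n + 3) \<sigma> (\<sigma>(i := tp ?C 0))"
    by (rule goes_rewind[of \<sigma> i ?C n]) (use \<sigma>i in auto)
  have 2: "goes (Write 3 (\<lambda>s. 1)) 1 (\<sigma>(i := tp ?C 0)) (st 0)"
    by (rule goes_Write[of _ _ "[f]" 0]) (use f i in \<open>auto simp: st_def fl_def fun_eq_iff\<close>)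
  have 3: "goes (While (\<lambda>s. s i \<noteq> 0)
       (Write 3 (\<lambda>s. if cset k (s i) = {} then 2 else s 3) ;; Move i Move_Right)) (n * (1 + 1 + 1) + 1)
      (st 0) (st n)"
  proof (rule goes_for, intro conjI goes_Seq)
    fix p assume p: "p < n"
    show "rd (st p) i \<noteq> 0" using p i by (simp add: st_def)
    have "cset k (rd (st p) i) = L p" using p i L by (simp add: st_def)
    then show "goes (Write 3 (\<lambda>s. if cset k (s i) = {} then 2 else s 3)) 1 (st p) ((st p)(3 := tp [fl (Suc p)] 0))"
      by (intro goes_Write[of _ _ "[fl p]" 0]) (auto simp: st_def fl_def less_Suc_eq)
    show "goes (Move i Move_Right) 1 ((st p)(3 := tp [fl (Suc p)] 0)) (st (Suc p))"
      by (rule goes_Right[of _ _ ?C p]) (use i in \<open>auto simp: st_def fun_eq_iff\<close>)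
  qed (use i in \<open>simp add: st_def\<close>)
  have 4: "goes (rewind i) (2 * n + 3) (st n)
      (\<sigma>(i := tp ?C 0, 3 := tp [flag (\<forall>v<n. L v \<noteq> {})] 0))"
    by (rule goes_rewind[of _ _ ?C]) (use i in \<open>auto simp: st_def fl_def fun_eq_iff\<close>)
  show ?thesis
    unfolding all_nonempty_def
    by (rule goes_le[OF goes_Seq[OF 1 goes_Seq[OF 2 goes_Seq[OF 3 4]]]]) simp
qed


section \<open>The deletion loop\<close>

text \<open>A lexicographic order packed into one number: colours left, then vertices ahead, then
  colours ahead at the current vertex. The last two contribute less than
  \<open>(n + 1) * (k + 1)\<close>, so one deleted colour pays for a restart.\<close>

definition meas :: "(nat \<Rightarrow> nat set) \<Rightarrow> nat \<Rightarrow> nat \<Rightarrow> nat" where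
  "meas L p m = (\<Sum>v<n. card (L v)) * ((n + 1) * (k + 1)) + (n - p) * (k + 1) + (k - m)"

text \<open>
  Vertices before \<open>p\<close>, and the colours up to \<open>m\<close> at \<open>p\<close>, have been tested against the current lists
  \<open>L\<close>; a failed test removes a colour and restarts the scan.
\<close>

definition scan_inv :: "nat \<Rightarrow> (nat \<Rightarrow> nat set) \<Rightarrow> (nat \<Rightarrow> nat set) \<Rightarrow> nat \<Rightarrow> nat \<Rightarrow> bool" where
  "scan_inv j L0 L p m \<longleftrightarrow> m \<le> k \<and> p \<le> n \<and> (p = n \<longrightarrow> m = 0) \<and> (\<forall>v<n. L v \<subseteq> {1..k}) \<and>
     (consistent (Suc j) {..<n} L \<longleftrightarrow> consistent (Suc j) {..<n} L0) \<and>
     (\<forall>v<p. \<forall>c\<in>L v. consistent j {..<n} (L(v := {c}))) \<and>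
     (p < n \<longrightarrow> (\<forall>c\<in>L p. c \<le> m \<longrightarrow> consistent j {..<n} (L(p := {c}))))"

lemma scan_inv_start: "\<forall>v<n. L v \<subseteq> {1..k} \<Longrightarrow> scan_inv j L L 0 0"
  unfolding scan_inv_def by (cases "n = 0") force+

lemma scan_inv_next_vertex:
  assumes "scan_inv j L0 L p k" "p < n"
  shows "scan_inv j L0 L (Suc p) 0" "meas L (Suc p) 0 < meas L p k"
proof -
  \<comment> \<open>No colour exceeds \<open>k\<close>, so the mark \<open>k\<close> means that the
    whole list of \<open>p\<close> has been tested.\<close>
  have sub: "\<And>v c. v < n \<Longrightarrow> c \<in> L v \<Longrightarrow> 1 \<le> c \<and> c \<le> k"
    using assms(1) unfolding scan_inv_def by (meson atLeastAtMost_iff subsetD)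
  show "scan_inv j L0 L (Suc p) 0"
    using assms sub unfolding scan_inv_def by (auto simp: less_Suc_eq simp del: consistent.simps)
  have "n - p = Suc (n - Suc p)" using assms(2) by simp
  then show "meas L (Suc p) 0 < meas L p k" by (simp add: meas_def)
qed

lemma scan_inv_next_colour:
  assumes "scan_inv j L0 L p m" "p < n" "m < k" "Suc m \<in> L p \<Longrightarrow> consistent j {..<n} (L(p := {Suc m}))"
  shows "scan_inv j L0 L p (Suc m)" "meas L p (Suc m) < meas L p m"
  using assms unfolding scan_inv_def meas_def by (auto simp: le_Suc_eq simp del: consistent.simps)

lemma scan_inv_remove:
  assumes inv: "scan_inv j L0 L p m" and p: "p < n" and c: "c \<in> L p" "\<not> consistent j {..<n} (L(p := {c}))"
  shows "scan_inv j L0 (L(p := L p - {c})) 0 0" "meas (L(p := L p - {c})) 0 0 < meas L p m"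
proof -
  let ?L = "L(p := L p - {c})"
  have sub: "\<forall>v<n. ?L v \<subseteq> {1..k}" using inv unfolding scan_inv_def by auto
  have "consistent (Suc j) {..<n} ?L \<longleftrightarrow> consistent (Suc j) {..<n} L" using p c(2) by (intro consistent_remove_colour) auto
  then show "scan_inv j L0 ?L 0 0"
    using scan_inv_start[OF sub, of j] inv unfolding scan_inv_def by (simp del: consistent.simps)
  have fin: "finite (L p)" using inv p unfolding scan_inv_def by (meson finite_atLeastAtMost finite_subset)
  have "(\<Sum>v<n. card (?L v)) < (\<Sum>v<n. card (L v))"
  proof (rule sum_strict_mono_ex1)
    show "\<exists>v\<in>{..<n}. card (?L v) < card (L v)"
      using p card_Diff1_less[OF fin c(1)] by (intro bexI[of _ p]) simp_all
  qed (auto simp: card_Diff1_le)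
  then have "Suc (\<Sum>v<n. card (?L v)) * ((n + 1) * (k + 1)) \<le> (\<Sum>v<n. card (L v)) * ((n + 1) * (k + 1))"
    by (intro mult_le_mono1) simp
  then show "meas ?L 0 0 < meas L p m" by (simp add: meas_def)
qed

lemma meas_start: "\<forall>v<n. L v \<subseteq> {1..k} \<Longrightarrow> meas L 0 0 \<le> scan_bound k n"
proof -
  assume "\<forall>v<n. L v \<subseteq> {1..k}"
  then have "(\<Sum>v<n. card (L v)) \<le> (\<Sum>v<n. k)"
    by (intro sum_mono) (metis card_atLeastAtMost card_mono diff_Suc_1 finite_atLeastAtMost lessThan_iff)
  then have "(\<Sum>v<n. card (L v)) * ((n + 1) * (k + 1)) \<le> n * k * ((n + 1) * (k + 1))"
    by (intro mult_le_mono1) simp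
  then show ?thesis by (simp add: meas_def scan_bound_def del: mult_Suc mult_Suc_right)
qed

lemma goes_advance:
  assumes IH: "correct j B"
    and \<sigma>T: "\<sigma> (5 + j) = tp (cells k n L ((\<lambda>_. 0)(p := m))) (int p)"
    and env: "env (Suc j) \<sigma>" and inv: "scan_inv j L0 L p m" and p: "p < n"
  shows "\<exists>\<sigma>' L' p' m'. goes (advance k (5 + j) (4 + j) (decide k j)) (B + 20 * (n + 1) + 3) \<sigma> \<sigma>' \<and>
    \<sigma>' (5 + j) = tp (cells k n L' ((\<lambda>_. 0)(p' := m'))) (int p') \<and>
    env (Suc j) \<sigma>' \<and> frame (Suc j) \<sigma> \<sigma>' \<and> scan_inv j L0 L' p' m' \<and> meas L' p' m' < meas L p m"
proof -
  let ?T = "5 + j" and ?C = "cells k n L ((\<lambda>_. 0)(p := m))"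
  let ?p = "advance k (5 + j) (4 + j) (decide k j)" and ?B = "B + 20 * (n + 1) + 3"
  have L: "\<forall>v<n. L v \<subseteq> {1..k}" and mk: "m \<le> k" using inv by (auto simp: scan_inv_def)
  have Lp: "L p \<subseteq> {..k}" using L p by fastforce
  have mark: "cmark k (rd \<sigma> ?T) = m" "cset k (rd \<sigma> ?T) = L p" using \<sigma>T p mk Lp by simp_all
  have env_upd: "env (Suc j) (\<sigma>(?T := t))" for t using env by (auto simp: env_def scratch_upd)
  have frame_upd: "frame (Suc j) \<sigma> (\<sigma>(?T := t))" for t by (auto simp: frame_def)
  show ?thesis
  proof (cases "m = k")
    case True
    let ?C' = "cells k n L (\<lambda>_. 0)"
    have upd: "?C[p := cell k (L p) 0] = ?C'" using p by (simp add: cells_update fun_upd_idem)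
    have 1: "goes (Write ?T (\<lambda>s. cell k (cset k (s ?T)) 0)) 1 \<sigma> (\<sigma>(?T := tp ?C' (int p)))"
      by (rule goes_Write[of _ _ ?C p]) (use \<sigma>T p upd mark in \<open>auto simp del: rd_apply\<close>)
    have 2: "goes (Move ?T Move_Right) 1 (\<sigma>(?T := tp ?C' (int p))) (\<sigma>(?T := tp ?C' (int (Suc p))))"
      by (rule goes_Right[of _ _ ?C' p]) auto
    have "goes ?p (1 + (1 + 1)) \<sigma> (\<sigma>(?T := tp ?C' (int (Suc p))))"
      unfolding advance_def
      by (rule goes_Cond_True[OF _ goes_Seq[OF 1 2]]) (use True mark in \<open>simp del: rd_apply\<close>)
    then have g: "goes ?p ?B \<sigma> (\<sigma>(?T := tp ?C' (int (Suc p))))" by (rule goes_le) simp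
    show ?thesis
      by (rule exI[of _ "\<sigma>(?T := tp ?C' (int (Suc p)))"], rule exI[of _ L], rule exI[of _ "Suc p"], rule exI[of _ 0])
        (use g env_upd frame_upd scan_inv_next_vertex[OF inv[unfolded True] p] True in \<open>simp add: fun_upd_idem\<close>)
  next
    case False
    then have mk': "m < k" using mk by simp
    let ?C1 = "cells k n L ((\<lambda>_. 0)(p := Suc m))"
    let ?\<sigma>1 = "\<sigma>(?T := tp ?C1 (int p))"
    have upd: "?C[p := cell k (L p) (m + 1)] = ?C1" using p by (simp add: cells_update)
    have 1: "goes (Write ?T (\<lambda>s. cell k (cset k (s ?T)) (cmark k (s ?T) + 1))) 1 \<sigma> ?\<sigma>1"
      by (rule goes_Write[of _ _ ?C p]) (use \<sigma>T p upd mark in \<open>auto simp del: rd_apply\<close>)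
    have mark1: "cmark k (rd ?\<sigma>1 ?T) = Suc m" "cset k (rd ?\<sigma>1 ?T) = L p"
      using p mk' Lp by simp_all
    let ?cond = "Cond (\<lambda>s. cmark k (s ?T) \<in> cset k (s ?T)) (test_colour k (5 + j) (4 + j) (decide k j)) (Move ?T Stay)"
    have finish: "goes ?p ?B \<sigma> \<sigma>'" if "goes ?cond (1 + (B + 20 * (n + 1))) ?\<sigma>1 \<sigma>'" for \<sigma>'
    proof -
      have "goes ?p (1 + (1 + (1 + (B + 20 * (n + 1))))) \<sigma> \<sigma>'"
        unfolding advance_def
        by (rule goes_Cond_False[OF _ goes_Seq[OF 1 that]]) (use False mark in \<open>simp del: rd_apply\<close>)
      then show ?thesis by (rule goes_le) simp
    qed
    show ?thesis
    proof (cases "Suc m \<in> L p")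
      case True
      obtain \<sigma>' where \<sigma>': "goes (test_colour k (5 + j) (4 + j) (decide k j)) (B + 20 * (n + 1)) ?\<sigma>1 \<sigma>'"
        "env (Suc j) \<sigma>'" "frame (Suc j) ?\<sigma>1 \<sigma>'"
        "\<sigma>' ?T = (if consistent j {..<n} (L(p := {Suc m})) then ?\<sigma>1 ?T
          else tp (cells k n (L(p := L p - {Suc m})) (\<lambda>_. 0)) 0)"
        using goes_test_colour[OF IH _ env_upd p True L, of "tp ?C1 (int p)"] by auto
      have "goes ?cond (1 + (B + 20 * (n + 1))) ?\<sigma>1 \<sigma>'"
        by (rule goes_Cond_True[OF _ \<sigma>'(1)]) (use True mark1 in \<open>simp del: rd_apply\<close>)
      note g = finish[OF this]
      have fr: "frame (Suc j) \<sigma> \<sigma>'" using \<sigma>'(3) by (auto simp: frame_def)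
      show ?thesis
      proof (cases "consistent j {..<n} (L(p := {Suc m}))")
        case ok: True
        show ?thesis
          by (rule exI[of _ \<sigma>'], rule exI[of _ L], rule exI[of _ p], rule exI[of _ "Suc m"])
            (use g \<sigma>' fr ok scan_inv_next_colour[OF inv p mk'] in simp)
      next
        case notok: False
        show ?thesis
          by (rule exI[of _ \<sigma>'], rule exI[of _ "L(p := L p - {Suc m})"], rule exI[of _ 0], rule exI[of _ 0])
            (use g \<sigma>' fr notok scan_inv_remove[OF inv p True notok] in \<open>simp add: fun_upd_idem\<close>)
      qed
    next
      case notin: False
      have "goes ?cond (1 + 1) ?\<sigma>1 ?\<sigma>1"
        by (rule goes_Cond_False[OF _ goes_Skip]) (use notin mark1 in \<open>simp del: rd_apply\<close>)
      then have "goes ?cond (1 + (B + 20 * (n + 1))) ?\<sigma>1 ?\<sigma>1" by (rule goes_le) simp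
      note g = finish[OF this]
      show ?thesis
        by (rule exI[of _ ?\<sigma>1], rule exI[of _ L], rule exI[of _ p], rule exI[of _ "Suc m"])
          (use g env_upd frame_upd notin scan_inv_next_colour[OF inv p mk'] in simp)
    qed
  qed
qed

lemma correct_Suc:
  assumes IH: "correct j B"
  shows "correct (Suc j) (scan_bound k n * (B + 20 * (n + 1) + 4) + 1 + 10 * (n + 1))"
  unfolding correct_def
proof (intro allI impI)
  fix \<sigma> L assume *: "\<sigma> (4 + Suc j) = tp (cells k n L (\<lambda>_. 0)) 0" "env (Suc j) \<sigma>" "\<forall>v<n. L v \<subseteq> {1..k}"
  let ?T = "5 + j"
  \<comment> \<open>Lists, position and mark change in every round and stay hidden under the
    quantifier; the loop rule sees only their measure.\<close>
  define I where "I x \<tau> \<longleftrightarrow> (\<exists>L' p m. \<tau> ?T = tp (cells k n L' ((\<lambda>_. 0)(p := m))) (int p) \<and>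
    env (Suc j) \<tau> \<and> frame (Suc j) \<sigma> \<tau> \<and> scan_inv j L L' p m \<and> x = meas L' p m)" for x \<tau>
  let ?b = "advance k (5 + j) (4 + j) (decide k j)" and ?B = "B + 20 * (n + 1) + 3"
  have step: "\<exists>y \<tau>'. y < x \<and> I y \<tau>' \<and> goes ?b ?B \<tau> \<tau>'" if I: "I x \<tau>" and c: "rd \<tau> ?T \<noteq> 0" for x \<tau>
  proof -
    obtain L' p m where h: "\<tau> ?T = tp (cells k n L' ((\<lambda>_. 0)(p := m))) (int p)"
      "env (Suc j) \<tau>" "frame (Suc j) \<sigma> \<tau>" "scan_inv j L L' p m" "x = meas L' p m"
      using I unfolding I_def by blast
    have p: "p < n" using c h(1) by (simp split: if_splits)
    obtain \<tau>' L'' p' m' where t: "goes ?b ?B \<tau> \<tau>'"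
      "\<tau>' ?T = tp (cells k n L'' ((\<lambda>_. 0)(p' := m'))) (int p')"
      "env (Suc j) \<tau>'" "frame (Suc j) \<tau> \<tau>'" "scan_inv j L L'' p' m'" "meas L'' p' m' < x"
      using goes_advance[OF IH h(1,2,4) p] h(5) by blast
    have "frame (Suc j) \<sigma> \<tau>'" using h(3) t(4) by (simp add: frame_def)
    then have "I (meas L'' p' m') \<tau>'" unfolding I_def using t by blast
    then show ?thesis using t by blast
  qed
  have "I (meas L 0 0) \<sigma>"
    unfolding I_def using * scan_inv_start[OF *(3), of j]
    by (intro exI[of _ L] exI[of _ 0]) (auto simp: frame_def fun_upd_idem)
  from goes_while[where I = I and c = "\<lambda>s. s ?T \<noteq> 0" and b = ?b and B = ?B, OF step this]
  obtain y \<tau> where \<tau>: "I y \<tau>" "\<not> rd \<tau> ?T \<noteq> 0"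
    "goes (While (\<lambda>s. s ?T \<noteq> 0) ?b) (meas L 0 0 * (?B + 1) + 1) \<sigma> \<tau>" by blast
  obtain L' p m where h: "\<tau> ?T = tp (cells k n L' ((\<lambda>_. 0)(p := m))) (int p)"
      "env (Suc j) \<tau>" "frame (Suc j) \<sigma> \<tau>" "scan_inv j L L' p m"
    using \<tau>(1) unfolding I_def by blast
  \<comment> \<open>The loop can stop only on the blank behind the table. By then every vertex has
    been passed, so the lists are stable and only their nonemptiness remains to be checked.\<close>
  have p: "p = n" using \<tau>(2) h(1,4) by (auto simp: scan_inv_def split: if_splits)
  have "\<forall>v<n. L' v \<subseteq> {1..k}" using h(4) by (simp add: scan_inv_def)
  then have L': "\<forall>v<n. L' v \<subseteq> {..k}" by fastforce
  obtain f where f: "\<tau> 3 = tp [f] 0" using h(2) by (auto simp: env_def)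
  let ?C = "cells k n L' ((\<lambda>_. 0)(p := m))"
  let ?\<sigma>' = "\<tau>(?T := tp ?C 0, 3 := tp [flag (\<forall>v<n. L' v \<noteq> {})] 0)"
  have g: "goes (all_nonempty k ?T) (10 * (n + 1)) \<tau> ?\<sigma>'"
    by (rule goes_all_nonempty[where f = f]) (use h(1) f L' p in auto)
  have "consistent (Suc j) {..<n} L \<longleftrightarrow> consistent (Suc j) {..<n} L'" using h(4) by (simp add: scan_inv_def del: consistent.simps)
  also have "\<dots> \<longleftrightarrow> (\<forall>v<n. L' v \<noteq> {})"
    using consistent_stable[of "{..<n}" L' j] h(4) p by (auto simp: scan_inv_def simp del: consistent.simps)
  finally have "rd ?\<sigma>' 3 = flag (consistent (Suc j) {..<n} L)" by (simp del: consistent.simps)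
  moreover have "env (Suc (Suc j)) ?\<sigma>'"
    using h(2) unfolding env_def by (auto simp: scratch_upd less_Suc_eq)
  moreover have "frame (Suc j) \<sigma> ?\<sigma>'" using h(3) by (auto simp: frame_def)
  moreover have "goes (decide k (Suc j)) (scan_bound k n * (B + 20 * (n + 1) + 4) + 1 + 10 * (n + 1)) \<sigma> ?\<sigma>'"
  proof -
    have "meas L 0 0 * (?B + 1) \<le> scan_bound k n * (?B + 1)" using meas_start[OF *(3)] by (rule mult_le_mono1)
    then show ?thesis unfolding decide.simps by (intro goes_le[OF goes_Seq[OF \<tau>(3) g]]) simp
  qed
  ultimately show "\<exists>\<sigma>'. goes (decide k (Suc j)) (scan_bound k n * (B + 20 * (n + 1) + 4) + 1 + 10 * (n + 1)) \<sigma> \<sigma>' \<and>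
      env (Suc (Suc j)) \<sigma>' \<and> frame (Suc j) \<sigma> \<sigma>' \<and> rd \<sigma>' 3 = flag (consistent (Suc j) {..<n} L)" by blast
qed

lemma correct_decide: "correct j (decide_time k j n)"
proof (induction j)
  case 0
  show ?case using correct_check by simp
next
  case (Suc j)
  show ?case using correct_Suc[OF Suc] by simp
qed

end

section \<open>Reading the input\<close>

primrec append_all :: "nat list \<Rightarrow> prog" where
  "append_all [] = Move 0 Stay"
| "append_all (i # ts) = Write i (\<lambda>s. 1) ;; Move i Move_Right ;; append_all ts"

primrec rewind_all :: "nat list \<Rightarrow> prog" where
  "rewind_all [] = Move 0 Stay"
| "rewind_all (i # ts) = rewind i ;; rewind_all ts"

text \<open>Every vertex counted adds a cell to all tapes in \<open>ts\<close>. From then on the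
  lengths of the tapes bound the loops, and no separate counters are needed.\<close>

definition read_size :: "nat list \<Rightarrow> prog" where
  "read_size ts = While (\<lambda>s. s 0 = 2) (Move 0 Move_Right ;; append_all ts) ;;
     Move 0 Move_Right ;; rewind_all ts"

text \<open>The matrix has no separators; tapes \<open>2\<close> and \<open>i\<close>, still words
  of \<open>n\<close> ones, count rows and columns.\<close>

definition read_matrix :: "nat \<Rightarrow> prog" where
  "read_matrix i =
     While (\<lambda>s. s 2 \<noteq> 0)
       (While (\<lambda>s. s i \<noteq> 0)
          (Write 1 (\<lambda>s. s 0) ;; Move 0 Move_Right ;; Move 1 Move_Right ;; Move i Move_Right) ;;
        rewind i ;; Move 2 Move_Right) ;;
     rewind 2 ;; rewind 1"

text \<open>The unary colour is counted in the mark of the cell, which has room up to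
  \<open>k\<close>, and is then turned into a list; the count 0 belongs to an uncoloured
  vertex.\<close>

definition read_colours :: "nat \<Rightarrow> nat \<Rightarrow> prog" where
  "read_colours k i =
     While (\<lambda>s. s i \<noteq> 0)
       (Write i (\<lambda>s. cell k {} 0) ;;
        While (\<lambda>s. s 0 = 2)
          (Write i (\<lambda>s. cell k {} (cmark k (s i) + 1)) ;; Move 0 Move_Right) ;;
        Move 0 Move_Right ;;
        Write i (\<lambda>s. cell k (if cmark k (s i) = 0 then {1..k} else {cmark k (s i)}) 0) ;;
        Move i Move_Right) ;;
     rewind i"

text \<open>The last write creates the single cell of tape \<open>3\<close> that the test overwrites
  later.\<close>

definition read_input :: "nat \<Rightarrow> nat \<Rightarrow> prog" where
  "read_input k j = read_size (2 # [4..<5 + j]) ;; read_matrix (4 + j) ;; read_colours k (4 + j) ;;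
     Write 3 (\<lambda>s. 1)"

lemma wf_append_all [simp]: "0 < N \<Longrightarrow> 1 < S \<Longrightarrow> wf_prog N S (append_all ts) \<longleftrightarrow> (\<forall>i\<in>set ts. i < N)"
  by (induction ts) auto

lemma wf_rewind_all [simp]: "0 < N \<Longrightarrow> wf_prog N S (rewind_all ts) \<longleftrightarrow> (\<forall>i\<in>set ts. i < N)"
  by (induction ts) auto

lemma wf_read_input: "5 + j \<le> N \<Longrightarrow> wf_prog N (alphabet k) (read_input k j)"
  using alphabet_ge[of k]
  by (auto simp: read_input_def read_size_def read_matrix_def read_colours_def)

lemma goes_append_all:
  assumes "distinct ts" "\<forall>i\<in>set ts. \<sigma> i = tp xs (int (length xs))"
  shows "goes (append_all ts) (2 * length ts + 1) \<sigma>
    (\<lambda>i. if i \<in> set ts then tp (xs @ [1]) (int (Suc (length xs))) else \<sigma> i)"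
  using assms
proof (induction ts arbitrary: \<sigma>)
  case Nil
  then show ?case using goes_Skip[of 0 \<sigma>] by simp
next
  case (Cons i ts)
  let ?t = "tp (xs @ [1]) (int (Suc (length xs)))"
  have 1: "goes (Write i (\<lambda>s. 1)) 1 \<sigma> (\<sigma>(i := tp (xs @ [1]) (int (length xs))))"
    by (rule goes_append[of _ _ xs "length xs"]) (use Cons.prems in auto)
  have 2: "goes (Move i Move_Right) 1 (\<sigma>(i := tp (xs @ [1]) (int (length xs)))) (\<sigma>(i := ?t))"
    by (rule goes_Right[of _ _ "xs @ [1]" "length xs"]) auto
  have "goes (append_all ts) (2 * length ts + 1) (\<sigma>(i := ?t))
    (\<lambda>l. if l \<in> set ts then ?t else (\<sigma>(i := ?t)) l)"
    by (rule Cons.IH) (use Cons.prems in auto)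
  moreover have "(\<lambda>l. if l \<in> set ts then ?t else (\<sigma>(i := ?t)) l) =
      (\<lambda>l. if l \<in> set (i # ts) then ?t else \<sigma> l)"
    by (auto simp: fun_eq_iff)
  ultimately have 3: "goes (append_all ts) (2 * length ts + 1) (\<sigma>(i := ?t))
      (\<lambda>l. if l \<in> set (i # ts) then ?t else \<sigma> l)" by metis
  show ?case unfolding append_all.simps
    by (rule goes_le[OF goes_Seq[OF 1 goes_Seq[OF 2 3]]]) simp
qed

lemma goes_rewind_all:
  assumes "distinct ts" "\<forall>i\<in>set ts. \<sigma> i = tp xs (int (length xs))" "0 \<notin> set xs"
  shows "goes (rewind_all ts) (length ts * (2 * length xs + 3) + 1) \<sigma>
    (\<lambda>i. if i \<in> set ts then tp xs 0 else \<sigma> i)"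
  using assms
proof (induction ts arbitrary: \<sigma>)
  case Nil
  then show ?case using goes_Skip[of 0 \<sigma>] by simp
next
  case (Cons i ts)
  have 1: "goes (rewind i) (2 * length xs + 3) \<sigma> (\<sigma>(i := tp xs 0))"
    by (rule goes_rewind[of _ _ xs]) (use Cons.prems in auto)
  have "goes (rewind_all ts) (length ts * (2 * length xs + 3) + 1) (\<sigma>(i := tp xs 0))
    (\<lambda>l. if l \<in> set ts then tp xs 0 else (\<sigma>(i := tp xs 0)) l)"
    by (rule Cons.IH) (use Cons.prems in auto)
  moreover have "(\<lambda>l. if l \<in> set ts then tp xs 0 else (\<sigma>(i := tp xs 0)) l) =
      (\<lambda>l. if l \<in> set (i # ts) then tp xs 0 else \<sigma> l)"
    by (auto simp: fun_eq_iff)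
  ultimately have 2: "goes (rewind_all ts) (length ts * (2 * length xs + 3) + 1) (\<sigma>(i := tp xs 0))
      (\<lambda>l. if l \<in> set (i # ts) then tp xs 0 else \<sigma> l)" by metis
  show ?case unfolding rewind_all.simps by (rule goes_le[OF goes_Seq[OF 1 2]]) simp
qed

section \<open>Layout of the input word\<close>

definition unary :: "nat \<Rightarrow> nat list" where
  "unary c = replicate c 2 @ [1]"

definition input_word :: "nat \<Rightarrow> nat list \<Rightarrow> nat list \<Rightarrow> nat list" where
  "input_word n Mx cs = unary n @ Mx @ concat (map unary cs)"

lemma input_word_nth_size:
  "q < n \<Longrightarrow> input_word n Mx cs ! q = 2" "input_word n Mx cs ! n = 1" "n < length (input_word n Mx cs)"
  by (auto simp: input_word_def unary_def nth_append)

lemma input_word_nth_matrix: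
  "q < length Mx \<Longrightarrow> input_word n Mx cs ! (n + 1 + q) = Mx ! q"
  "q < length Mx \<Longrightarrow> n + 1 + q < length (input_word n Mx cs)"
  by (auto simp: input_word_def unary_def nth_append)

definition colour_pos :: "nat \<Rightarrow> nat \<Rightarrow> nat list \<Rightarrow> nat \<Rightarrow> nat" where
  "colour_pos n l cs v = n + 1 + l + length (concat (map unary (take v cs)))"

lemma colour_pos_0: "colour_pos n l cs 0 = n + 1 + l"
  by (simp add: colour_pos_def)

lemma colour_pos_Suc: "v < length cs \<Longrightarrow> colour_pos n l cs (Suc v) = colour_pos n l cs v + cs ! v + 1"
  by (simp add: colour_pos_def take_Suc_conv_app_nth unary_def)

lemma input_word_nth_colour:
  assumes "v < length cs" "q \<le> cs ! v"
  shows "input_word n Mx cs ! (colour_pos n (length Mx) cs v + q) = (if q < cs ! v then 2 else 1)"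
    "colour_pos n (length Mx) cs v + q < length (input_word n Mx cs)"
proof -
  have "cs = take v cs @ cs ! v # drop (Suc v) cs" using assms(1) by (rule id_take_nth_drop)
  then have "concat (map unary cs) =
      concat (map unary (take v cs)) @ unary (cs ! v) @ concat (map unary (drop (Suc v) cs))"
    by (metis concat.simps(2) concat_append list.simps(9) map_append)
  then have w: "input_word n Mx cs = (unary n @ Mx @ concat (map unary (take v cs))) @
      unary (cs ! v) @ concat (map unary (drop (Suc v) cs))"
    by (simp add: input_word_def)
  have l: "colour_pos n (length Mx) cs v = length (unary n @ Mx @ concat (map unary (take v cs)))"
    by (simp add: colour_pos_def unary_def)
  show "input_word n Mx cs ! (colour_pos n (length Mx) cs v + q) = (if q < cs ! v then 2 else 1)"
    using assms(2) unfolding l by (subst w, subst nth_append_length_plus) (auto simp: unary_def nth_append)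
  show "colour_pos n (length Mx) cs v + q < length (input_word n Mx cs)"
    using assms(2) unfolding l by (subst w) (simp add: unary_def)
qed

lemma goes_read_size:
  assumes dist: "distinct ts" "0 \<notin> set ts"
    and \<sigma>: "\<sigma> 0 = tp (input_word n Mx cs) 0" "\<forall>i\<in>set ts. \<sigma> i = tp [] 0"
  shows "goes (read_size ts) (n * (2 * length ts + 3) + 3 + length ts * (2 * n + 3)) \<sigma>
    ((\<lambda>i. if i \<in> set ts then tp (replicate n 1) 0 else \<sigma> i)(0 := tp (input_word n Mx cs) (int (n + 1))))"
proof -
  let ?w = "input_word n Mx cs"
  define st where "st q = (\<lambda>i. if i \<in> set ts then tp (replicate q 1) (int q)
    else if i = 0 then tp ?w (int q) else \<sigma> i)" for q
  have 1: "goes (While (\<lambda>s. s 0 = 2) (Move 0 Move_Right ;; append_all ts))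
      (n * (1 + (2 * length ts + 1) + 1) + 1) (st 0) (st n)"
  proof (rule goes_for, intro conjI)
    fix q assume q: "q < n"
    show "rd (st q) 0 = 2" using q dist(2) input_word_nth_size(1) input_word_nth_size(3)[of n Mx cs] by (auto simp: st_def)
    have m: "goes (Move 0 Move_Right) 1 (st q) ((st q)(0 := tp ?w (int (Suc q))))"
      by (rule goes_Right[of _ _ ?w q]) (use dist(2) in \<open>auto simp: st_def\<close>)
    have "goes (append_all ts) (2 * length ts + 1) ((st q)(0 := tp ?w (int (Suc q))))
      (\<lambda>i. if i \<in> set ts then tp (replicate q 1 @ [1]) (int (Suc (length (replicate q (1 :: nat)))))
        else ((st q)(0 := tp ?w (int (Suc q)))) i)"
      by (rule goes_append_all[OF dist(1)]) (use dist(2) in \<open>auto simp: st_def\<close>)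
    also have "(\<lambda>i. if i \<in> set ts then tp (replicate q 1 @ [1]) (int (Suc (length (replicate q (1 :: nat)))))
        else ((st q)(0 := tp ?w (int (Suc q)))) i) = st (Suc q)"
      using dist(2) by (auto simp: st_def fun_eq_iff replicate_append_same)
    finally show "goes (Move 0 Move_Right ;; append_all ts) (1 + (2 * length ts + 1)) (st q) (st (Suc q))"
      by (rule goes_Seq[OF m])
  next
    show "rd (st n) 0 \<noteq> 2" using dist(2) input_word_nth_size(2,3) by (simp add: st_def)
  qed
  have st0: "st 0 = \<sigma>" using \<sigma> by (auto simp: st_def fun_eq_iff)
  have 2: "goes (Move 0 Move_Right) 1 (st n) ((st n)(0 := tp ?w (int (Suc n))))"
    by (rule goes_Right[of _ _ ?w n]) (use dist(2) in \<open>auto simp: st_def\<close>)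
  have "goes (rewind_all ts) (length ts * (2 * length (replicate n (1 :: nat)) + 3) + 1) ((st n)(0 := tp ?w (int (Suc n))))
    (\<lambda>i. if i \<in> set ts then tp (replicate n 1) 0 else ((st n)(0 := tp ?w (int (Suc n)))) i)"
    by (rule goes_rewind_all[OF dist(1)]) (use dist(2) in \<open>auto simp: st_def\<close>)
  also have "(\<lambda>i. if i \<in> set ts then tp (replicate n 1) 0 else ((st n)(0 := tp ?w (int (Suc n)))) i) =
      (\<lambda>i. if i \<in> set ts then tp (replicate n 1) 0 else \<sigma> i)(0 := tp ?w (int (n + 1)))"
    using dist(2) by (auto simp: st_def fun_eq_iff)
  finally have 3: "goes (rewind_all ts) (length ts * (2 * n + 3) + 1) ((st n)(0 := tp ?w (int (Suc n))))
    ((\<lambda>i. if i \<in> set ts then tp (replicate n 1) 0 else \<sigma> i)(0 := tp ?w (int (n + 1))))"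
    by (simp only: length_replicate)
  show ?thesis
    unfolding read_size_def
    by (rule goes_le[OF goes_Seq[OF 1[unfolded st0] goes_Seq[OF 2 3]]]) (simp add: algebra_simps)
qed

lemma goes_read_matrix:
  assumes Mx: "length Mx = n * n" "0 \<notin> set Mx" and i: "4 \<le> i"
    and \<sigma>: "\<sigma> 0 = tp (input_word n Mx cs) (int (n + 1))" "\<sigma> 1 = tp [] 0"
      "\<sigma> 2 = tp (replicate n 1) 0" "\<sigma> i = tp (replicate n 1) 0"
  shows "goes (read_matrix i) (20 * (n + 1) * (n + 1)) \<sigma>
    (\<sigma>(0 := tp (input_word n Mx cs) (int (n + 1 + n * n)), 1 := tp Mx 0))"
proof -
  let ?w = "input_word n Mx cs" and ?R = "replicate n (1 :: nat)"
  let ?step = "Write 1 (\<lambda>s. s 0) ;; Move 0 Move_Right ;; Move 1 Move_Right ;; Move i Move_Right"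
  define st where "st u v N = \<sigma>(0 := tp ?w (int (n + 1 + N)), 1 := tp (take N Mx) (int N),
    2 := tp ?R (int u), i := tp ?R (int v))" for u v N
  have step: "goes ?step (1 + (1 + (1 + 1))) (st u v (u * n + v)) (st u (Suc v) (u * n + Suc v))"
    if uv: "u < n" "v < n" for u v
  proof (intro goes_Seq)
    let ?N = "u * n + v"
    have "?N < Suc u * n" using uv by simp
    also have "\<dots> \<le> n * n" using uv by (intro mult_le_mono1) simp
    finally have N: "?N < n * n" .
    have "st u v ?N 0 = tp ?w (int (n + 1 + ?N))" using i by (simp add: st_def)
    then have r: "rd (st u v ?N) 0 = Mx ! ?N"
      using N Mx input_word_nth_matrix[of ?N Mx n cs] by (simp del: of_nat_add of_nat_mult add_Suc)
    have t: "take ?N Mx @ [Mx ! ?N] = take (Suc ?N) Mx" using N Mx by (simp add: take_Suc_conv_app_nth)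
    show "goes (Write 1 (\<lambda>s. s 0)) 1 (st u v ?N) ((st u v ?N)(1 := tp (take (Suc ?N) Mx) (int ?N)))"
      by (rule goes_append[of _ _ "take ?N Mx" ?N])
        (use N Mx i t r in \<open>simp_all add: st_def del: of_nat_add of_nat_mult rd_apply\<close>)
    show "goes (Move 0 Move_Right) 1 ((st u v ?N)(1 := tp (take (Suc ?N) Mx) (int ?N)))
        ((st u v ?N)(1 := tp (take (Suc ?N) Mx) (int ?N), 0 := tp ?w (int (Suc (n + 1 + ?N)))))"
      by (rule goes_Right[of _ _ ?w "n + 1 + ?N"]) (use i in \<open>simp_all add: st_def\<close>)
    show "goes (Move 1 Move_Right) 1 ((st u v ?N)(1 := tp (take (Suc ?N) Mx) (int ?N), 0 := tp ?w (int (Suc (n + 1 + ?N)))))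
        ((st u v ?N)(0 := tp ?w (int (Suc (n + 1 + ?N))), 1 := tp (take (Suc ?N) Mx) (int (Suc ?N))))"
      by (rule goes_Right[of _ _ "take (Suc ?N) Mx" ?N]) (auto simp: st_def fun_eq_iff)
    show "goes (Move i Move_Right) 1
        ((st u v ?N)(0 := tp ?w (int (Suc (n + 1 + ?N))), 1 := tp (take (Suc ?N) Mx) (int (Suc ?N))))
        (st u (Suc v) (u * n + Suc v))"
      by (rule goes_Right[of _ _ ?R v]) (use i in \<open>auto simp: st_def fun_eq_iff\<close>)
  qed
  have inner: "goes (While (\<lambda>s. s i \<noteq> 0) ?step) (n * (1 + (1 + (1 + 1)) + 1) + 1)
      (st u 0 (u * n)) (st u n (u * n + n))" if u: "u < n" for u
  proof -
    have "goes (While (\<lambda>s. s i \<noteq> 0) ?step) (n * (1 + (1 + (1 + 1)) + 1) + 1)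
      (st u 0 (u * n + 0)) (st u n (u * n + n))"
      by (rule goes_for[where f = "\<lambda>v. st u v (u * n + v)"], rule conjI[OF _ step[OF u]])
        (use i in \<open>auto simp: st_def\<close>)
    then show ?thesis by (simp only: add_0_right)
  qed
  have outer: "goes (While (\<lambda>s. s 2 \<noteq> 0) (While (\<lambda>s. s i \<noteq> 0) ?step ;; rewind i ;; Move 2 Move_Right))
      (n * ((n * (1 + (1 + (1 + 1)) + 1) + 1 + (2 * n + 3 + 1)) + 1) + 1) (st 0 0 (0 * n)) (st n 0 (n * n))"
  proof (rule goes_for, rule conjI)
    fix u assume u: "u < n"
    show "rd (st u 0 (u * n)) 2 \<noteq> 0" using u i by (simp add: st_def)
    have r: "goes (rewind i) (2 * n + 3) (st u n (u * n + n)) (st u 0 (Suc u * n))"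
      by (rule goes_rewind[of _ _ ?R]) (auto simp: st_def fun_eq_iff add.commute)
    have m: "goes (Move 2 Move_Right) 1 (st u 0 (Suc u * n)) (st (Suc u) 0 (Suc u * n))"
      by (rule goes_Right[of _ _ ?R u]) (use i in \<open>auto simp: st_def fun_eq_iff\<close>)
    show "goes (While (\<lambda>s. s i \<noteq> 0) ?step ;; rewind i ;; Move 2 Move_Right)
        (n * (1 + (1 + (1 + 1)) + 1) + 1 + (2 * n + 3 + 1)) (st u 0 (u * n)) (st (Suc u) 0 (Suc u * n))"
      by (rule goes_Seq[OF inner[OF u] goes_Seq[OF r m]])
  qed (use i in \<open>simp add: st_def\<close>)
  have st0: "st 0 0 (0 * n) = \<sigma>" using \<sigma> i by (auto simp: st_def fun_eq_iff)
  have 1: "goes (rewind 2) (2 * n + 3) (st n 0 (n * n)) (st 0 0 (n * n))"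
    by (rule goes_rewind[of _ _ ?R]) (use i in \<open>auto simp: st_def fun_eq_iff\<close>)
  have 2: "goes (rewind 1) (2 * (n * n) + 3) (st 0 0 (n * n))
      (\<sigma>(0 := tp ?w (int (n + 1 + n * n)), 1 := tp Mx 0))"
    by (rule goes_rewind[of _ _ Mx]) (use Mx i \<sigma> in \<open>auto simp: st_def fun_eq_iff\<close>)
  show ?thesis
    unfolding read_matrix_def
    by (rule goes_le[OF goes_Seq[OF outer[unfolded st0] goes_Seq[OF 1 2]]]) (simp add: algebra_simps)
qed

definition start_list :: "nat \<Rightarrow> nat \<Rightarrow> nat set" where
  "start_list k c = (if c = 0 then {1..k} else {c})"

lemma goes_read_colours:
  assumes cs: "length cs = n" "\<forall>c\<in>set cs. c \<le> k" and i: "4 \<le> i"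
    and \<sigma>: "\<sigma> 0 = tp (input_word n Mx cs) (int (n + 1 + length Mx))" "\<sigma> i = tp (replicate n 1) 0"
  shows "\<exists>t. goes (read_colours k i) (n * (3 * k + 10) + 10) \<sigma>
    (\<sigma>(0 := t, i := tp (cells k n (\<lambda>v. start_list k (cs ! v)) (\<lambda>_. 0)) 0))"
proof -
  let ?w = "input_word n Mx cs" and ?L = "\<lambda>v. start_list k (cs ! v)"
  define pos where "pos = colour_pos n (length Mx) cs"
  \<comment> \<open>Cells before \<open>v\<close> are finished; the others still hold the
    \<open>1\<close> written while the size was read.\<close>
  define xs where "xs v = map (\<lambda>l. cell k (?L l) 0) [0..<v] @ replicate (n - v) 1" for v
  have len: "length (xs v) = n" if "v \<le> n" for v using that by (simp add: xs_def)
  define st where "st v = \<sigma>(0 := tp ?w (int (pos v)), i := tp (xs v) (int v))" for v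
  let ?inner = "Write i (\<lambda>s. cell k {} (cmark k (s i) + 1)) ;; Move 0 Move_Right"
  let ?body = "Write i (\<lambda>s. cell k {} 0) ;; While (\<lambda>s. s 0 = 2) ?inner ;; Move 0 Move_Right ;;
        Write i (\<lambda>s. cell k (if cmark k (s i) = 0 then {1..k} else {cmark k (s i)}) 0) ;;
        Move i Move_Right"
  have 1: "goes (While (\<lambda>s. s i \<noteq> 0) ?body) (n * ((3 * k + 5) + 1) + 1) (st 0) (st n)"
  proof (rule goes_for, rule conjI)
    fix v assume v: "v < n"
    let ?c = "cs ! v"
    have c: "?c \<le> k" using cs v by (metis nth_mem)
    note nth = input_word_nth_colour[of v cs _ n Mx, folded pos_def]
    define st1 where "st1 q = (st v)(0 := tp ?w (int (pos v + q)), i := tp ((xs v)[v := cell k {} q]) (int v))" for q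
    have "xs v ! v = 1" using v by (simp add: xs_def nth_append)
    then show "rd (st v) i \<noteq> 0" using v len[of v] by (simp add: st_def)
    have 1: "goes (Write i (\<lambda>s. cell k {} 0)) 1 (st v) (st1 0)"
      by (rule goes_Write[of _ _ "xs v" v]) (use v len[of v] i in \<open>auto simp: st_def st1_def fun_eq_iff\<close>)
    have 2: "goes (While (\<lambda>s. s 0 = 2) ?inner) (?c * (1 + 1 + 1) + 1) (st1 0) (st1 ?c)"
    proof (rule goes_for, intro conjI)
      fix q assume q: "q < ?c"
      have "st1 q 0 = tp ?w (int (pos v + q))" using i by (simp add: st1_def)
      then show "rd (st1 q) 0 = 2" using nth[of q] v q cs by (simp del: of_nat_add)
      have m: "cmark k (rd (st1 q) i) = q" using v len[of v] q c by (simp add: st1_def)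
      have a: "goes (Write i (\<lambda>s. cell k {} (cmark k (s i) + 1))) 1 (st1 q)
          ((st1 q)(i := tp ((xs v)[v := cell k {} (Suc q)]) (int v)))"
        by (rule goes_Write[of _ _ "(xs v)[v := cell k {} q]" v])
          (use v len[of v] m in \<open>auto simp: st1_def simp del: rd_apply\<close>)
      have b: "goes (Move 0 Move_Right) 1 ((st1 q)(i := tp ((xs v)[v := cell k {} (Suc q)]) (int v))) (st1 (Suc q))"
        by (rule goes_Right[of _ _ ?w "pos v + q"]) (use i in \<open>auto simp: st1_def fun_eq_iff\<close>)
      show "goes ?inner (1 + 1) (st1 q) (st1 (Suc q))" by (rule goes_Seq[OF a b])
    next
      have "st1 ?c 0 = tp ?w (int (pos v + ?c))" using i by (simp add: st1_def)
      then show "rd (st1 ?c) 0 \<noteq> 2" using nth[of ?c] v cs by (simp del: of_nat_add)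
    qed
    have p: "pos (Suc v) = Suc (pos v + ?c)" using v cs by (simp add: pos_def colour_pos_Suc)
    have 3: "goes (Move 0 Move_Right) 1 (st1 ?c) ((st1 ?c)(0 := tp ?w (int (pos (Suc v)))))"
      by (rule goes_Right[of _ _ ?w "pos v + ?c"]) (use i p in \<open>auto simp: st1_def\<close>)
    let ?st2 = "(st1 ?c)(0 := tp ?w (int (pos (Suc v))))"
    have m: "cmark k (rd ?st2 i) = ?c" using v len[of v] c i by (simp add: st1_def)
    have "(xs v)[v := cell k (?L v) 0] = xs (Suc v)"
    proof (rule nth_equalityI)
      fix l assume "l < length ((xs v)[v := cell k (?L v) 0])"
      then show "(xs v)[v := cell k (?L v) 0] ! l = xs (Suc v) ! l"
        using v by (auto simp: xs_def nth_list_update nth_append less_Suc_eq)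
    qed (use v in \<open>simp add: xs_def\<close>)
    then have 4: "goes (Write i (\<lambda>s. cell k (if cmark k (s i) = 0 then {1..k} else {cmark k (s i)}) 0)) 1
        ?st2 (?st2(i := tp (xs (Suc v)) (int v)))"
      by (intro goes_Write[of _ _ "(xs v)[v := cell k {} ?c]" v])
        (use v len[of v] m i in \<open>auto simp: st1_def start_list_def simp del: rd_apply\<close>)
    have 5: "goes (Move i Move_Right) 1 (?st2(i := tp (xs (Suc v)) (int v))) (st (Suc v))"
      by (rule goes_Right[of _ _ "xs (Suc v)" v]) (use i in \<open>auto simp: st_def st1_def fun_eq_iff\<close>)
    show "goes ?body (3 * k + 5) (st v) (st (Suc v))"
      by (rule goes_le[OF goes_Seq[OF 1 goes_Seq[OF 2 goes_Seq[OF 3 goes_Seq[OF 4 5]]]]]) (use c in simp)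
  qed (use len[of n] in \<open>simp add: st_def\<close>)
  have st0: "st 0 = \<sigma>" using \<sigma> by (auto simp: st_def fun_eq_iff pos_def colour_pos_0 xs_def)
  have xsn: "xs n = cells k n ?L (\<lambda>_. 0)" by (simp add: xs_def cells_def)
  have 2: "goes (rewind i) (2 * n + 3) (st n) (\<sigma>(0 := tp ?w (int (pos n)), i := tp (cells k n ?L (\<lambda>_. 0)) 0))"
    by (rule goes_rewind[of _ _ "cells k n ?L (\<lambda>_. 0)"]) (auto simp: st_def xsn)
  show ?thesis
    unfolding read_colours_def
    by (rule exI[of _ "tp ?w (int (pos n))"], rule goes_le[OF goes_Seq[OF 1[unfolded st0] 2]])
      (simp add: algebra_simps)
qed

definition read_input_time :: "nat \<Rightarrow> nat \<Rightarrow> nat \<Rightarrow> nat" where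
  "read_input_time k j n = n * (2 * (j + 2) + 3) + 3 + (j + 2) * (2 * n + 3) + 20 * (n + 1) * (n + 1) +
     (n * (3 * k + 10) + 10) + 1"

lemma goes_read_input:
  assumes Mx: "length Mx = n * n" "0 \<notin> set Mx" and cs: "length cs = n" "\<forall>c\<in>set cs. c \<le> k"
    and \<sigma>: "\<sigma> 0 = tp (input_word n Mx cs) 0" "\<And>i. 0 < i \<Longrightarrow> \<sigma> i = tp [] 0"
  shows "\<exists>\<sigma>'. goes (read_input k j) (read_input_time k j n) \<sigma> \<sigma>' \<and> \<sigma>' 1 = tp Mx 0 \<and>
    \<sigma>' 2 = tp (replicate n 1) 0 \<and> \<sigma>' 3 = tp [1] 0 \<and> (\<forall>i<j. \<sigma>' (4 + i) = tp (replicate n 1) 0) \<and>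
    \<sigma>' (4 + j) = tp (cells k n (\<lambda>v. start_list k (cs ! v)) (\<lambda>_. 0)) 0"
proof -
  let ?is = "2 # [4..<5 + j]" and ?w = "input_word n Mx cs" and ?R = "replicate n (1 :: nat)"
  let ?C = "cells k n (\<lambda>v. start_list k (cs ! v)) (\<lambda>_. 0)"
  define \<sigma>1 where "\<sigma>1 = (\<lambda>i. if i \<in> set ?is then tp ?R 0 else \<sigma> i)(0 := tp ?w (int (n + 1)))"
  define \<sigma>2 where "\<sigma>2 = \<sigma>1(0 := tp ?w (int (n + 1 + n * n)), 1 := tp Mx 0)"
  have 1: "goes (read_size ?is) (n * (2 * length ?is + 3) + 3 + length ?is * (2 * n + 3)) \<sigma> \<sigma>1"
    unfolding \<sigma>1_def by (rule goes_read_size) (use \<sigma> in auto)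
  have 2: "goes (read_matrix (4 + j)) (20 * (n + 1) * (n + 1)) \<sigma>1 \<sigma>2"
    unfolding \<sigma>2_def by (rule goes_read_matrix[OF Mx]) (use \<sigma> in \<open>auto simp: \<sigma>1_def\<close>)
  obtain t where 3: "goes (read_colours k (4 + j)) (n * (3 * k + 10) + 10) \<sigma>2 (\<sigma>2(0 := t, 4 + j := tp ?C 0))"
    using goes_read_colours[OF cs, of "4 + j" \<sigma>2 Mx] Mx by (auto simp: \<sigma>2_def \<sigma>1_def)
  have 4: "goes (Write 3 (\<lambda>s. 1)) 1 (\<sigma>2(0 := t, 4 + j := tp ?C 0)) (\<sigma>2(0 := t, 4 + j := tp ?C 0, 3 := tp [1] 0))"
    by (rule goes_append[of _ _ "[]" 0]) (use \<sigma> in \<open>auto simp: \<sigma>2_def \<sigma>1_def\<close>)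
  show ?thesis
  proof (intro exI conjI)
    show "goes (read_input k j) (read_input_time k j n) \<sigma> (\<sigma>2(0 := t, 4 + j := tp ?C 0, 3 := tp [1] 0))"
      unfolding read_input_def
      by (rule goes_le[OF goes_Seq[OF 1 goes_Seq[OF 2 goes_Seq[OF 3 4]]]]) (simp add: read_input_time_def)
  qed (use \<sigma> in \<open>auto simp: \<sigma>2_def \<sigma>1_def\<close>)
qed

section \<open>Precolouring extension\<close>

context sym_graph
begin

text \<open>The one-element lists of a colouring do not change when one of their colours is fixed,
  so they are a witness at every level.\<close>

lemma list_col_imp_consistent:
  assumes "list_col X L"
  shows "consistent j X L"
proof -
  obtain f where f: "\<forall>v\<in>X. f v \<in> L v" "\<forall>u\<in>X. \<forall>v\<in>X. E u v \<longrightarrow> f u \<noteq> f v"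
    using assms by (auto simp: list_col_def)
  have "consistent j X (\<lambda>v. {f v})"
  proof (induction j)
    case (Suc j)
    have "(\<lambda>v. {f v})(x := {f x}) = (\<lambda>v. {f v})" for x by auto
    then show ?case using Suc unfolding consistent.simps by (intro exI[of _ "\<lambda>v. {f v}"]) auto
  qed (use f in auto)
  then show ?thesis by (rule consistent_mono) (use f in auto)
qed

text \<open>Deleting a precoloured neighbour removes one from the degree and at most one colour from
  the list. So the uncoloured vertices with the lists \<open>M\<close> keep lists at least as large
  as their degrees, and propagation from \<open>W\<close> keeps the pruned lists inside
  \<open>M\<close>.\<close>

lemma consistent_precolouring:
  assumes fin: "finite X" and k: "1 \<le> k" and deg: "\<forall>v\<in>X. card (nb X v) \<le> k"
    and L: "\<forall>v\<in>X. L v = (if v \<in> W then {g v} else {1..k})" and ok: "consistent (Suc k) X L"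
  shows "list_col X L"
proof -
  obtain L' where L': "\<And>v. v \<in> X \<Longrightarrow> L' v \<noteq> {}" "\<And>v. v \<in> X \<Longrightarrow> L' v \<subseteq> L v"
    "\<And>x c. x \<in> X \<Longrightarrow> c \<in> L' x \<Longrightarrow> consistent k X (L'(x := {c}))"
    "\<And>u v c. u \<in> X \<Longrightarrow> v \<in> X \<Longrightarrow> E u v \<Longrightarrow> L' u = {c} \<Longrightarrow> c \<notin> L' v"
    by (rule consistent_Suc_prune[OF ok]) blast
  have W: "L' v = {g v}" if "v \<in> X" "v \<in> W" for v
    using L'(1,2)[OF that(1)] L that by (auto simp: subset_singleton_iff)
  let ?U = "X - W"
  define M where "M v = {1..k} - g ` nb (X \<inter> W) v" for v
  have sub: "L' v \<subseteq> M v" if "v \<in> ?U" for v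
  proof
    fix c assume c: "c \<in> L' v"
    have "c \<noteq> g w" if "w \<in> nb (X \<inter> W) v" for w
      using L'(4)[of w v "g w"] W[of w] c that E_sym \<open>v \<in> ?U\<close> unfolding nb_def by blast
    moreover have "c \<in> {1..k}" using L'(2)[of v] L c that by auto
    ultimately show "c \<in> M v" unfolding M_def by blast
  qed
  have "list_col ?U M"
  proof (rule consistent_imp_list_col[OF _ _ k])
    have "consistent (Suc k) X L'" unfolding consistent.simps using L'(1,3) by (intro exI[of _ L']) blast
    then show "consistent (Suc k) ?U M" by (rule consistent_mono) (use sub in auto)
    show "\<forall>v\<in>?U. finite (M v) \<and> card (M v) \<le> k \<and> card (nb ?U v) \<le> card (M v)"
    proof
      fix v assume v: "v \<in> ?U"
      have "card (M v) \<le> card {1..k}" unfolding M_def by (intro card_mono) auto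
      moreover have "card (nb ?U v) + card (nb (X \<inter> W) v) = card (nb X v)"
        using fin by (subst card_Un_disjoint[symmetric]) (auto simp: nb_def intro!: arg_cong[of _ _ card])
      moreover have "card {1..k} - card (g ` nb (X \<inter> W) v) \<le> card (M v)"
        unfolding M_def using fin by (intro diff_card_le_card_Diff) auto
      moreover have "card (g ` nb (X \<inter> W) v) \<le> card (nb (X \<inter> W) v)"
        using fin by (intro card_image_le) auto
      ultimately show "finite (M v) \<and> card (M v) \<le> k \<and> card (nb ?U v) \<le> card (M v)"
        using deg v by (auto simp: M_def)
    qed
  qed (use fin in auto)
  then obtain f where f: "\<forall>v\<in>?U. f v \<in> M v" "\<forall>u\<in>?U. \<forall>v\<in>?U. E u v \<longrightarrow> f u \<noteq> f v"
    by (auto simp: list_col_def)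
  let ?h = "\<lambda>v. if v \<in> W then g v else f v"
  have cross: "f v \<noteq> g w" if "v \<in> ?U" "w \<in> X" "w \<in> W" "E v w" for v w
    using f(1) that by (auto simp: M_def nb_def)
  have "?h v \<in> L v" if "v \<in> X" for v using f(1) L that by (auto simp: M_def)
  moreover have "?h u \<noteq> ?h v" if uv: "u \<in> X" "v \<in> X" "E u v" for u v
  proof (cases "u \<in> W"; cases "v \<in> W")
    \<comment> \<open>A precolouring may be improper; a clash inside \<open>W\<close> is excluded by
      propagation in the consistent lists.\<close>
    assume "u \<in> W" "v \<in> W"
    then show ?thesis using L'(4)[OF uv W[OF uv(1)]] W[OF uv(2)] by auto
  next
    assume "u \<in> W" "v \<notin> W"
    then show ?thesis using cross[of v u] uv E_sym by auto
  next
    assume "u \<notin> W" "v \<in> W"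
    then show ?thesis using cross[of u v] uv by auto
  next
    assume "u \<notin> W" "v \<notin> W"
    then show ?thesis using f(2) uv by auto
  qed
  ultimately show ?thesis unfolding list_col_def by (intro exI[of _ ?h]) blast
qed

end

section \<open>Polynomial bounds\<close>

definition poly_bounded :: "(nat \<Rightarrow> nat) \<Rightarrow> bool" where
  "poly_bounded f \<longleftrightarrow> (\<exists>p :: nat poly. \<forall>n. f n \<le> poly p n)"

lemma poly_bounded_const [intro]: "poly_bounded (\<lambda>_. c)"
  unfolding poly_bounded_def by (rule exI[of _ "[:c:]"]) simp

lemma poly_bounded_id [intro]: "poly_bounded (\<lambda>n. n)"
  unfolding poly_bounded_def by (rule exI[of _ "[:0, 1:]"]) simp

lemma poly_bounded_add [intro]:
  assumes "poly_bounded f" "poly_bounded g"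
  shows "poly_bounded (\<lambda>n. f n + g n)"
proof -
  obtain p q where "\<forall>n. f n \<le> poly p n" "\<forall>n. g n \<le> poly q n"
    using assms unfolding poly_bounded_def by blast
  then show ?thesis unfolding poly_bounded_def by (intro exI[of _ "p + q"]) (simp add: add_mono)
qed

lemma poly_bounded_mult [intro]:
  assumes "poly_bounded f" "poly_bounded g"
  shows "poly_bounded (\<lambda>n. f n * g n)"
proof -
  obtain p q where "\<forall>n. f n \<le> poly p n" "\<forall>n. g n \<le> poly q n"
    using assms unfolding poly_bounded_def by blast
  then show ?thesis unfolding poly_bounded_def by (intro exI[of _ "p * q"]) (simp add: mult_le_mono)
qed

lemma poly_nat_mono: "n \<le> m \<Longrightarrow> poly (p :: nat poly) n \<le> poly p m"
  by (induction p) (auto intro: add_mono mult_le_mono)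

lemma poly_bounded_decide_time: "poly_bounded (decide_time k j)"
proof (induction j)
  case 0
  have "decide_time k 0 = (\<lambda>n. 20 * (n + 1) * (n + 1))" by auto
  then show ?case by (simp only:) (intro poly_bounded_mult poly_bounded_add poly_bounded_const poly_bounded_id)
next
  case (Suc j)
  have "decide_time k (Suc j) = (\<lambda>n. (n * k * ((n + 1) * (k + 1)) + n * (k + 1) + k) *
      (decide_time k j n + 20 * (n + 1) + 4) + 1 + 10 * (n + 1))"
    by (auto simp: scan_bound_def)
  then show ?case
    by (simp only:) (intro poly_bounded_mult poly_bounded_add poly_bounded_const poly_bounded_id Suc)
qed

lemma poly_bounded_read_input_time: "poly_bounded (read_input_time k j)"
  unfolding read_input_time_def
  by (intro poly_bounded_mult poly_bounded_add poly_bounded_const poly_bounded_id)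

lemma nth_concat_uniform:
  assumes "\<forall>xs\<in>set xss. length xs = n" "u < length xss" "v < n"
  shows "concat xss ! (u * n + v) = xss ! u ! v"
  using assms
proof (induction xss arbitrary: u)
  case (Cons xs xss)
  then show ?case
  proof (cases u)
    case (Suc u')
    then have "concat (xs # xss) ! (u * n + v) = concat xss ! (u' * n + v)"
      using Cons.prems(1) by (simp add: nth_append)
    then show ?thesis using Cons Suc by simp
  qed (simp add: nth_append)
qed simp

section \<open>Encoded instances as graphs on indices\<close>

definition vlist :: "ugraph \<Rightarrow> nat list" where
  "vlist G = sorted_list_of_set (fst G)"

text \<open>Vertices become positions in the sorted list, the only names under which the matrix
  knows them.\<close>

definition index_adj :: "ugraph \<Rightarrow> nat \<Rightarrow> nat \<Rightarrow> bool" where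
  "index_adj G u v \<longleftrightarrow> u < card (fst G) \<and> v < card (fst G) \<and> {vlist G ! u, vlist G ! v} \<in> snd G"

definition matrix :: "ugraph \<Rightarrow> bool list" where
  "matrix G = concat (map (\<lambda>u. map (\<lambda>v. {u, v} \<in> snd G) (vlist G)) (vlist G))"

definition colour_codes :: "ugraph \<Rightarrow> (nat \<rightharpoonup> nat) \<Rightarrow> nat list" where
  "colour_codes G cW = map (\<lambda>v. case cW v of None \<Rightarrow> 0 | Some i \<Rightarrow> i) (vlist G)"

definition bit_sym :: "bool \<Rightarrow> nat" where
  "bit_sym b = (if b then 2 else 1)"

lemma map_bit_sym_unary: "map bit_sym (encode_unary c) = unary c"
  by (simp add: encode_unary_def unary_def bit_sym_def)

lemma length_vlist: "length (vlist G) = card (fst G)"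
  by (simp add: vlist_def)

lemma encode_instance_word:
  "map bit_sym (encode_instance (G, cW)) =
   input_word (card (fst G)) (map bit_sym (matrix G)) (colour_codes G cW)"
  by (cases G)
    (simp add: encode_instance_def input_word_def matrix_def colour_codes_def vlist_def Let_def
      map_concat map_bit_sym_unary o_def)

lemma bij_vlist: "finite (fst G) \<Longrightarrow> bij_betw ((!) (vlist G)) {..<card (fst G)} (fst G)"
  by (rule bij_betw_nth) (auto simp: vlist_def)

lemma length_matrix: "length (matrix G) = card (fst G) * card (fst G)"
  by (simp add: matrix_def length_concat o_def length_vlist sum_list_triv)

lemma matrix_nth:
  "u < card (fst G) \<Longrightarrow> v < card (fst G) \<Longrightarrow> matrix G ! (u * card (fst G) + v) \<longleftrightarrow> index_adj G u v"
  unfolding matrix_def by (subst nth_concat_uniform) (auto simp: length_vlist index_adj_def)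

lemma matrix_graph_index_adj:
  assumes "simple_graph G" "1 \<le> k"
  shows "matrix_graph (index_adj G) k (card (fst G)) (map bit_sym (matrix G))"
proof
  fix u v
  show "index_adj G u v \<Longrightarrow> index_adj G v u" by (simp add: index_adj_def insert_commute)
  show "\<not> index_adj G v v" using assms(1) by (auto simp: simple_graph_def index_adj_def)
  assume uv: "u < card (fst G)" "v < card (fst G)"
  have "u * card (fst G) + v < Suc u * card (fst G)" using uv by simp
  also have "\<dots> \<le> card (fst G) * card (fst G)" using uv by (intro mult_le_mono1) simp
  finally show "index_adj G u v \<longleftrightarrow> map bit_sym (matrix G) ! (u * card (fst G) + v) = 2"
    using matrix_nth[OF uv] by (simp add: length_matrix bit_sym_def)
qed (use assms in \<open>auto simp: length_matrix bit_sym_def\<close>)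

text \<open>Degrees count edges, so each neighbour is sent to the edge joining it to
  \<open>v\<close>; the map is injective because the vertex list has no repetitions.\<close>

lemma card_nb_index:
  assumes G: "simple_graph G" and sg: "sym_graph (index_adj G)" and v: "v < card (fst G)"
  shows "card (sym_graph.nb (index_adj G) {..<card (fst G)} v) \<le> max_degree G"
proof -
  let ?vs = "vlist G" and ?n = "card (fst G)"
  let ?N = "sym_graph.nb (index_adj G) {..<?n} v"
  have fin: "finite (fst G)" "finite (snd G)"
    using G unfolding simple_graph_def by (auto intro!: finite_subset[of "snd G" "Pow (fst G)"])
  note bij = bij_vlist[OF fin(1)]
  have N: "?N = {u \<in> {..<?n}. index_adj G v u}" by (rule sym_graph.nb_def[OF sg])
  have "inj_on (\<lambda>u. {?vs ! v, ?vs ! u}) ?N"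
    using bij v unfolding N bij_betw_def inj_on_def by (auto simp: doubleton_eq_iff)
  then have "card ?N \<le> card {e \<in> snd G. ?vs ! v \<in> e}"
    using fin(2) by (intro card_inj_on_le) (auto simp: N index_adj_def)
  also have "\<dots> = vdegree G (?vs ! v)" by (simp add: vdegree_def)
  also have "\<dots> \<le> max_degree G"
    using bij v fin(1) unfolding max_degree_def bij_betw_def by (intro Max_ge) auto
  finally show ?thesis .
qed

lemma precol_extendable_iff_list_col:
  assumes G: "simple_graph G" and cW: "k_precolouring k G cW" and sg: "sym_graph (index_adj G)"
  shows "precol_extendable k (G, cW) \<longleftrightarrow>
    sym_graph.list_col (index_adj G) {..<card (fst G)} (\<lambda>v. start_list k (colour_codes G cW ! v))"
proof -
  let ?vs = "vlist G" and ?n = "card (fst G)"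
  let ?L = "\<lambda>v. start_list k (colour_codes G cW ! v)"
  have fin: "finite (fst G)" using G by (simp add: simple_graph_def)
  note bij = bij_vlist[OF fin]
  have vs: "?vs ! i \<in> fst G" if "i < ?n" for i using bij that by (auto simp: bij_betw_def)
  have ran: "1 \<le> c \<and> c \<le> k" if "cW v = Some c" for v c
    using cW that by (auto simp: k_precolouring_def ran_def)
  \<comment> \<open>The code 0 of an uncoloured vertex is unambiguous because colours start at
    1.\<close>
  have L: "?L i = (case cW (?vs ! i) of None \<Rightarrow> {1..k} | Some c \<Rightarrow> {c})" if "i < ?n" for i
    using that ran[of "?vs ! i"]
    by (auto simp: colour_codes_def start_list_def length_vlist split: option.split)
  have edge: "u \<in> fst G" "v \<in> fst G" if "{u, v} \<in> snd G" for u v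
    using G that by (auto simp: simple_graph_def)
  show ?thesis
  proof
    assume "precol_extendable k (G, cW)"
    then obtain c where c: "k_colouring k G c" "extends c cW" by (auto simp: precol_extendable_def)
    have "c v = a" if "cW v = Some a" for v a
      using c(2) that unfolding extends_def by (metis domI option.inject)
    then have "c (?vs ! i) \<in> ?L i" if "i < ?n" for i
      using c(1) vs[OF that] L[OF that]
      by (auto simp: k_colouring_def colouring_def image_subset_iff split: option.split)
    moreover have "c (?vs ! u) \<noteq> c (?vs ! v)" if "index_adj G u v" for u v
      using c(1) that by (auto simp: k_colouring_def colouring_def index_adj_def)
    ultimately show "sym_graph.list_col (index_adj G) {..<?n} ?L"
      unfolding sym_graph.list_col_def[OF sg] by (intro exI[of _ "\<lambda>i. c (?vs ! i)"]) auto
  next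
    assume "sym_graph.list_col (index_adj G) {..<?n} ?L"
    then obtain f where f: "\<forall>i<?n. f i \<in> ?L i" "\<forall>u<?n. \<forall>v<?n. index_adj G u v \<longrightarrow> f u \<noteq> f v"
      unfolding sym_graph.list_col_def[OF sg] by auto
    define ix where "ix = inv_into {..<?n} ((!) ?vs)"
    have ix: "ix v < ?n" "?vs ! ix v = v" if "v \<in> fst G" for v
      using bij that inv_into_into[of v "(!) ?vs" "{..<?n}"] f_inv_into_f[of v "(!) ?vs" "{..<?n}"]
      by (auto simp: bij_betw_def ix_def)
    let ?c = "\<lambda>v. f (ix v)"
    have c: "?c v \<in> (case cW v of None \<Rightarrow> {1..k} | Some c \<Rightarrow> {c})" if "v \<in> fst G" for v
      using f(1) ix[OF that] L[of "ix v"] by auto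
    have range: "?c v \<in> {1..k}" if "v \<in> fst G" for v
      using c[OF that] ran[of v] by (auto split: option.splits)
    have "?c u \<noteq> ?c v" if "{u, v} \<in> snd G" for u v
      using f(2) ix[OF edge(1)[OF that]] ix[OF edge(2)[OF that]] that by (auto simp: index_adj_def)
    then have "k_colouring k G ?c" using range by (auto simp: k_colouring_def colouring_def)
    moreover have "extends ?c cW"
      unfolding extends_def
    proof
      fix v assume v: "v \<in> dom cW"
      then have "v \<in> fst G" using cW by (auto simp: k_precolouring_def)
      then show "cW v = Some (?c v)" using c[of v] v by (auto split: option.splits)
    qed
    ultimately show "precol_extendable k (G, cW)" by (auto simp: precol_extendable_def)
  qed
qed

section \<open>The complete decision procedure\<close>

definition solver :: "nat \<Rightarrow> prog" where
  "solver k = read_input k (Suc k) ;; decide k (Suc k)"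

lemma solver_correct:
  assumes k: "1 \<le> k" and G: "simple_graph G" and cW: "k_precolouring k G cW" and deg: "max_degree G \<le> k"
  shows "\<exists>\<sigma>. goes (solver k) (read_input_time k (Suc k) (card (fst G)) + decide_time k (Suc k) (card (fst G)))
      (init_mem (encode_instance (G, cW))) \<sigma> \<and> (rd \<sigma> 3 = 1 \<longleftrightarrow> precol_extendable k (G, cW))"
proof -
  let ?n = "card (fst G)" and ?M = "map bit_sym (matrix G)" and ?cs = "colour_codes G cW"
  let ?L = "\<lambda>v. start_list k (?cs ! v)"
  interpret matrix_graph "index_adj G" k ?n ?M by (rule matrix_graph_index_adj[OF G k])
  have sg: "sym_graph (index_adj G)" by unfold_locales
  have cs: "length ?cs = ?n" "\<forall>c\<in>set ?cs. c \<le> k"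
    using cW by (auto simp: colour_codes_def length_vlist k_precolouring_def ran_def split: option.split)
  have init: "init_mem (encode_instance (G, cW)) 0 = tp (input_word ?n ?M ?cs) 0"
    using encode_instance_word[of G cW, symmetric]
    by (simp only: init_mem_def input_tape_tp bit_sym_def[abs_def] simp_thms if_True)
  obtain \<sigma>1 where \<sigma>1: "goes (read_input k (Suc k)) (read_input_time k (Suc k) ?n) (init_mem (encode_instance (G, cW))) \<sigma>1"
    "\<sigma>1 1 = tp ?M 0" "\<sigma>1 2 = tp (replicate ?n 1) 0" "\<sigma>1 3 = tp [1] 0"
    "\<forall>i<Suc k. \<sigma>1 (4 + i) = tp (replicate ?n 1) 0" "\<sigma>1 (4 + Suc k) = tp (cells k ?n ?L (\<lambda>_. 0)) 0"
    using goes_read_input[where Mx = ?M and n = ?n and cs = ?cs and k = k and j = "Suc k"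
        and \<sigma> = "init_mem (encode_instance (G, cW))", OF length_M M_nonzero cs init]
    by (auto simp: init_mem_def blank_tape_tp)
  have "env (Suc k) \<sigma>1" using \<sigma>1(2-5) by (auto simp: env_def intro!: scratch_tp)
  moreover have L: "\<forall>v<?n. ?L v \<subseteq> {1..k}"
    using cs by (auto simp: start_list_def dest!: nth_mem)
  ultimately obtain \<sigma>2 where \<sigma>2: "goes (decide k (Suc k)) (decide_time k (Suc k) ?n) \<sigma>1 \<sigma>2"
    "rd \<sigma>2 3 = flag (consistent (Suc k) {..<?n} ?L)"
    using correct_decide[of "Suc k"] \<sigma>1(6) unfolding correct_def by blast
  have "consistent (Suc k) {..<?n} ?L \<longleftrightarrow> list_col {..<?n} ?L"
  proof
    assume "consistent (Suc k) {..<?n} ?L"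
    then show "list_col {..<?n} ?L"
    proof (rule consistent_precolouring[where W = "{v. ?cs ! v \<noteq> 0}" and g = "\<lambda>v. ?cs ! v", rotated -1])
      show "\<forall>v\<in>{..<?n}. card (nb {..<?n} v) \<le> k"
        using card_nb_index[OF G sg] deg by (auto intro: order_trans)
    qed (use k in \<open>auto simp: start_list_def\<close>)
  qed (rule list_col_imp_consistent)
  then have "rd \<sigma>2 3 = 1 \<longleftrightarrow> precol_extendable k (G, cW)"
    using \<sigma>2(2) precol_extendable_iff_list_col[OF G cW sg] by auto
  then show ?thesis unfolding solver_def using goes_Seq[OF \<sigma>1(1) \<sigma>2(1)] by blast
qed

theorem theorem12:
  fixes k :: nat
  assumes "k \<ge> 1"
  shows "polytime_solvable encode_instance
           {(G, cW) \<in> precol_instances k. max_degree G \<le> k}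
           (precol_extendable k)"
proof -
  \<comment> \<open>The extra 1 is the step from the exit state to the verdict.\<close>
  let ?time = "\<lambda>n. read_input_time k (Suc k) n + decide_time k (Suc k) n + 1"
  have "poly_bounded ?time"
    by (intro poly_bounded_add poly_bounded_read_input_time poly_bounded_decide_time poly_bounded_const)
  then obtain p :: "nat poly" where p: "\<forall>n. ?time n \<le> poly p n" unfolding poly_bounded_def by blast
  \<comment> \<open>The tapes are \<open>0\<close> to \<open>3\<close> and one table for each level
    from \<open>0\<close> to \<open>k + 1\<close>.\<close>
  define M where "M = machine (6 + k) (alphabet k) (\<lambda>s. s 3 = 1) (solver k)"
  have wf: "wf_prog (6 + k) (alphabet k) (solver k)"
    using wf_read_input[of "Suc k" "6 + k" k] wf_decide[of "Suc k" "6 + k" k] by (simp add: solver_def)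
  have "wf_tm M" unfolding M_def by (rule wf_machine[OF wf _ alphabet_ge]) simp
  moreover have "if precol_extendable k x
      then accepts_within M (encode_instance x) (poly p (length (encode_instance x)))
      else rejects_within M (encode_instance x) (poly p (length (encode_instance x)))"
    if x: "x \<in> {(G, cW) \<in> precol_instances k. max_degree G \<le> k}" for x
  proof -
    obtain G cW where G: "x = (G, cW)" "simple_graph G" "k_precolouring k G cW" "max_degree G \<le> k"
      using x by (auto simp: precol_instances_def)
    let ?w = "encode_instance x" and ?n = "card (fst G)"
    obtain \<sigma> where \<sigma>: "goes (solver k) (read_input_time k (Suc k) ?n + decide_time k (Suc k) ?n) (init_mem ?w) \<sigma>"
      "rd \<sigma> 3 = 1 \<longleftrightarrow> precol_extendable k x"
      using solver_correct[OF assms G(2-4)] G(1) by blast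
    obtain t where t: "t \<le> read_input_time k (Suc k) ?n + decide_time k (Suc k) ?n"
      "runs (solver k) (init_mem ?w) \<sigma> t" using goesE[OF \<sigma>(1)] by blast
    \<comment> \<open>The unary prefix makes the input longer than the number of vertices, so a
      bound in the latter is one in the input length.\<close>
    have "?n \<le> length (map bit_sym ?w)"
      using input_word_nth_size(3) unfolding G(1) encode_instance_word by (rule less_imp_le)
    then have "poly p ?n \<le> poly p (length ?w)" by (intro poly_nat_mono) simp
    moreover have "t + 1 \<le> poly p ?n" using t(1) p[rule_format, of ?n] by simp
    ultimately have le: "t + 1 \<le> poly p (length ?w)" by simp
    have "if rd \<sigma> 3 = 1 then accepts_within M ?w (t + 1) else rejects_within M ?w (t + 1)"
      unfolding M_def by (rule machine_decides[OF wf _ alphabet_ge t(2)]) simp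
    then show ?thesis using \<sigma>(2) le by (auto simp: accepts_within_def rejects_within_def intro: order_trans split: if_splits)
  qed
  ultimately show ?thesis unfolding polytime_solvable_def by blast
qed

end
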